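(* Let $(S, X, \lambda)$ be an ergodic dynamical system with discrete spectrum on a probability space without atoms, and let $\{m_l\}_{l\in\mathbb{N}}$ be a rigidity sequence for $(S,X,\lambda)$. Then there exists a weakly mixing dynamical system $(T, M, m)$ (on a probability space without atoms) such that $\{m_l\}_{l\in\mathbb{N}}$ is a rigidity sequence for $(T,M,m)$.
   Context: A dynamical system $(T,M,m)$ is an invertible measure-preserving transformation $T$ of a standard probability space $(M,m)$. A sequence of integers $\{m_l\}$ is a rigidity sequence for $(T,M,m)$ if $m(T^{m_l}A \,\triangle\, A) \to 0$ as $l \to \infty$ for every measurable set $A \subset M$ (equivalently, $f\circ T^{m_l} \to f$ in $L^2(m)$ for every $f \in L^2(m)$). The system has discrete spectrum if $L^2(m)$ is the closed linear span of eigenfunctions of the operator $f\mapsto f\circ T$. The system is weakly mixing if $T \times T$ is ergodic for $m \times m$ (equivalently, the only eigenfunctions in $L^2(m)$ of $f\mapsto f\circ T$ are the constants). *)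

theory Defs
  imports "HOL-Probability.Probability"
begin

definition polish_topology :: "'a topology \<Rightarrow> bool" where
  "polish_topology \<tau> \<longleftrightarrow> completely_metrizable_space \<tau> \<and> second_countable \<tau>"

(* Both usual conventions are admitted: a Borel probability measure on a Polish space,
   or the completion of such a measure. *)
definition standard_prob_space :: "'a measure \<Rightarrow> bool" where
  "standard_prob_space M \<longleftrightarrow>
     (\<exists>N \<tau>. prob_space N \<and> polish_topology \<tau> \<and> topspace \<tau> = space N \<and>
            sets N = sigma_sets (space N) {U. openin \<tau> U} \<and>
            (M = N \<or> M = completion N))"

definition no_atoms :: "'a measure \<Rightarrow> bool" where
  "no_atoms M \<longleftrightarrow>
     \<not> (\<exists>A\<in>sets M. emeasure M A > 0 \<and>
          (\<forall>B\<in>sets M. B \<subseteq> A \<longrightarrow> emeasure M B = 0 \<or> emeasure M B = emeasure M A))"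

definition dynamical_system :: "('a \<Rightarrow> 'a) \<Rightarrow> 'a measure \<Rightarrow> bool" where
  "dynamical_system T M \<longleftrightarrow>
     standard_prob_space M \<and>
     bij_betw T (space M) (space M) \<and>
     T \<in> measurable M M \<and>
     inv_into (space M) T \<in> measurable M M \<and>
     (\<forall>A\<in>sets M. emeasure M (T -` A \<inter> space M) = emeasure M A)"

definition iterate :: "'a measure \<Rightarrow> ('a \<Rightarrow> 'a) \<Rightarrow> int \<Rightarrow> 'a \<Rightarrow> 'a" where
  "iterate M T k =
     (if 0 \<le> k then T ^^ nat k else inv_into (space M) T ^^ nat (- k))"

definition rigidity_sequence :: "('a \<Rightarrow> 'a) \<Rightarrow> 'a measure \<Rightarrow> (nat \<Rightarrow> int) \<Rightarrow> bool" where
  "rigidity_sequence T M m \<longleftrightarrow>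
     (\<forall>A\<in>sets M. (\<lambda>l. measure M (sym_diff (iterate M T (m l) ` A) A)) \<longlonglongrightarrow> 0)"

definition ergodic :: "('a \<Rightarrow> 'a) \<Rightarrow> 'a measure \<Rightarrow> bool" where
  "ergodic T M \<longleftrightarrow>
     (\<forall>A\<in>sets M. T -` A \<inter> space M = A \<longrightarrow> measure M A = 0 \<or> measure M A = 1)"

definition weakly_mixing :: "('a \<Rightarrow> 'a) \<Rightarrow> 'a measure \<Rightarrow> bool" where
  "weakly_mixing T M \<longleftrightarrow> ergodic (map_prod T T) (M \<Otimes>\<^sub>M M)"

(* Elements of L2 are represented by functions; the identification of functions that agree
   almost everywhere is made explicit where it matters. *)
definition L2_fun :: "'a measure \<Rightarrow> ('a \<Rightarrow> complex) \<Rightarrow> bool" where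
  "L2_fun M f \<longleftrightarrow> f \<in> borel_measurable M \<and> integrable M (\<lambda>x. (cmod (f x))\<^sup>2)"

definition L2_dist :: "'a measure \<Rightarrow> ('a \<Rightarrow> complex) \<Rightarrow> ('a \<Rightarrow> complex) \<Rightarrow> real" where
  "L2_dist M f g = sqrt (\<integral>x. (cmod (f x - g x))\<^sup>2 \<partial>M)"

definition eigenfunction :: "('a \<Rightarrow> 'a) \<Rightarrow> 'a measure \<Rightarrow> ('a \<Rightarrow> complex) \<Rightarrow> bool" where
  "eigenfunction T M f \<longleftrightarrow>
     L2_fun M f \<and> \<not> (AE x in M. f x = 0) \<and> (\<exists>c. AE x in M. f (T x) = c * f x)"

definition discrete_spectrum :: "('a \<Rightarrow> 'a) \<Rightarrow> 'a measure \<Rightarrow> bool" where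
  "discrete_spectrum T M \<longleftrightarrow>
     (\<forall>f. L2_fun M f \<longrightarrow> (\<forall>\<epsilon>>0. \<exists>(n::nat) a g.
        (\<forall>i<n. eigenfunction T M (g i)) \<and>
        L2_dist M f (\<lambda>x. \<Sum>i<n. a i * g i x) < \<epsilon>))"

end

theory Submission
  imports Defs
begin

text \<open>
  The new system is a Gaussian one: the shift on two-sided real sequences, with the law of a centred
  stationary Gaussian process. Everything is decided by its covariance
  \<open>r k\<close>, the Fourier transform of a probability measure on the circle. If that measure has no
  atoms, the process decorrelates along some sequence of times, which forces the product of the
  shift with itself to be ergodic. If \<open>r (m l)\<close> tends to \<open>1\<close>, the coordinates return in mean
  square along \<open>m\<close>, and \<open>m\<close> is a rigidity sequence. So the task is to find a measure without atoms
  that concentrates, under every map \<open>z \<mapsto> z ^ m l\<close> with \<open>l\<close> large, near \<open>1\<close>; this is an idea of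
  Fayad and Thouvenot.

  The angles \<open>t\<close> with \<open>cis (m l * t) \<longlonglongrightarrow> 1\<close> form a group, and it contains the argument of every
  eigenvalue of \<open>S\<close>. By Dirichlet's approximation theorem either it contains arbitrarily small
  positive angles, or all the eigenvalues are \<open>q\<close>-th roots of unity for one \<open>q > 0\<close>. In the
  second case discrete spectrum makes \<open>S ^^ q\<close> the identity modulo null sets, and the union of the first
  \<open>q\<close> preimages of a very small set contradicts ergodicity; small sets exist because there
  are no atoms (\<open>small_rigid_angles\<close>).

  Given small angles \<open>th j\<close> in the group, the measure is the law of a random sum of independent
  terms: the \<open>j\<close>-th one is \<open>0\<close> with probability \<open>1 - p j\<close>, and \<open>th j\<close> or \<open>- th j\<close>
  with probability \<open>p j / 2\<close> each, where \<open>p j = 1 / (j + 2)\<close>. Hence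
  \<open>r k = (\<Prod>j. 1 - p j + p j * cos (k * th j))\<close>. Two features of \<open>p\<close> work against each other and are both
  used. Because \<open>\<Sum>j. p j\<close> diverges, the measure has no atoms: for lacunary angles the time
  average of the partial product is \<open>\<Prod>j<J. (1 - p j) = 1 / (J + 1)\<close>
  (\<open>riesz_cov_mixing_times\<close>). Because \<open>p j \<longlonglongrightarrow> 0\<close>, one uncontrolled
  angle is harmless, and the angles can be chosen one after the other so that at each \<open>l\<close> at most one of them
  is not yet under control (\<open>choose_angles\<close>).

  The process itself is a triangular linear image of independent standard normal variables. All
  of its properties are read off from the identity
  \<open>E cos (Y + b) = cos b * exp (- E Y\<^sup>2 / 2)\<close> for linear forms \<open>Y\<close>, since the functions
  \<open>cos (Y + b)\<close> span a dense subspace of \<open>L\<^sup>1\<close> (\<open>trig_dense\<close>). This gives the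
  invariance of the measure, the rigidity (\<open>L2_convergence_imp_rigid\<close>) and the weak mixing
  (\<open>decorrelation_imp_ergodic\<close>, applied to the product system, which is Gaussian as well).
\<close>


section \<open>Angles along which the sequence is rigid\<close>

definition rigid_angles :: "(nat \<Rightarrow> int) \<Rightarrow> real set" where
  "rigid_angles m = {t. (\<lambda>l. cis (of_int (m l) * t)) \<longlonglongrightarrow> 1}"

lemma rigid_angles_diff:
  assumes "s \<in> rigid_angles m" "t \<in> rigid_angles m"
  shows "s - t \<in> rigid_angles m"
proof -
  have "(\<lambda>l. cis (of_int (m l) * s) / cis (of_int (m l) * t)) \<longlonglongrightarrow> 1 / 1"
    using assms by (intro tendsto_divide) (auto simp: rigid_angles_def)
  then show ?thesis by (simp add: rigid_angles_def cis_divide algebra_simps)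
qed

lemma rigid_angles_minus: "t \<in> rigid_angles m \<Longrightarrow> - t \<in> rigid_angles m"
  using rigid_angles_diff[of 0 m t] by (simp add: rigid_angles_def)

lemma rigid_angles_add:
  "s \<in> rigid_angles m \<Longrightarrow> t \<in> rigid_angles m \<Longrightarrow> s + t \<in> rigid_angles m"
  using rigid_angles_diff[of s m "- t"] rigid_angles_minus[of t m] by simp

lemma rigid_angles_of_nat: "t \<in> rigid_angles m \<Longrightarrow> of_nat k * t \<in> rigid_angles m"
proof (induction k)
  case 0
  show ?case by (simp add: rigid_angles_def)
next
  case (Suc k)
  then show ?case using rigid_angles_add[of t m "of_nat k * t"] by (simp add: algebra_simps)
qed

lemma rigid_angles_2pi: "2 * pi * of_int h \<in> rigid_angles m"
proof -
  have "cis (of_int (m l) * (2 * pi * of_int h)) = 1" for l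
    using cis_multiple_2pi[of "of_int (m l * h)"] by (simp add: mult_ac)
  then show ?thesis by (simp add: rigid_angles_def)
qed

text \<open>By Dirichlet's approximation theorem some multiple \<open>k * t\<close>, with \<open>k\<close>
bounded independently of \<open>t\<close>, is close to a multiple of \<open>2 * pi\<close>. The
difference lies in the group again, so it vanishes if the group has no small positive element.\<close>

lemma rigid_angles_small_or_torsion:
  assumes "\<not> (\<forall>d>0. \<exists>t\<in>rigid_angles m. 0 < t \<and> t < d)"
  obtains q :: nat where "q > 0" "\<And>t. t \<in> rigid_angles m \<Longrightarrow> cis t ^ q = 1"
proof -
  obtain d where d: "d > 0" and nod: "\<And>t. t \<in> rigid_angles m \<Longrightarrow> 0 < t \<Longrightarrow> d \<le> t"
    using assms by (meson not_less)
  define N where "N = nat \<lceil>2 * pi / d\<rceil>"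
  have Ngt: "2 * pi / d \<le> real N" and N0: "N > 0"
    using d by (auto simp: N_def real_nat_ceiling_ge)
  show thesis
  proof (rule that[of "fact N"])
    fix t assume t: "t \<in> rigid_angles m"
    obtain h k where hk: "0 < k" "k \<le> int N" "\<bar>of_int k * (t / (2 * pi)) - of_int h\<bar> < 1 / N"
      using Dirichlet_approx[OF N0] by blast
    define s where "s = of_nat (nat k) * t - 2 * pi * of_int h"
    have s: "s \<in> rigid_angles m"
      unfolding s_def by (intro rigid_angles_diff rigid_angles_of_nat rigid_angles_2pi t)
    have "s = 2 * pi * (of_int k * (t / (2 * pi)) - of_int h)"
      using hk by (simp add: s_def field_simps)
    then have "\<bar>s\<bar> = 2 * pi * \<bar>of_int k * (t / (2 * pi)) - of_int h\<bar>"
      by (simp add: abs_mult)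
    also have "\<dots> < 2 * pi * (1 / N)" using hk by (intro mult_strict_left_mono) auto
    also have "\<dots> \<le> d" using Ngt N0 d by (simp add: field_simps)
    finally have "\<bar>s\<bar> < d" .
    then have "s = 0"
      using nod[OF s] nod[OF rigid_angles_minus[OF s]] by linarith
    then have "cis t ^ nat k = 1"
      using cis_multiple_2pi[of "of_int h"] by (simp add: s_def Complex.DeMoivre)
    moreover have "nat k dvd fact N" using hk by (intro dvd_fact) auto
    ultimately show "cis t ^ fact N = 1" by (auto simp: power_mult elim!: dvdE)
  qed simp
qed

lemma rigid_angles_cos:
  "t \<in> rigid_angles m \<Longrightarrow> (\<lambda>l. 1 - cos (of_int (m l) * t)) \<longlonglongrightarrow> 0"
  using tendsto_diff[OF tendsto_const[of 1] tendsto_Re[of "\<lambda>l. cis (of_int (m l) * t)" 1]]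
  by (fastforce simp: rigid_angles_def)

lemma small_angle_cos:
  fixes L :: "int set"
  assumes "finite L" "e > 0"
  shows "\<exists>d>0. \<forall>t::real. 0 < t \<and> t < d \<longrightarrow> (\<forall>k\<in>L. 1 - cos (of_int k * t) \<le> e)"
proof -
  have "\<forall>\<^sub>F t in at_right (0::real). 1 - cos (of_int k * t) < e" for k
  proof -
    have "((\<lambda>t::real. 1 - cos (of_int k * t)) \<longlongrightarrow> 1 - cos (of_int k * 0)) (at_right 0)"
      by (intro tendsto_intros)
    then show ?thesis using assms(2) by (auto dest: order_tendstoD(2))
  qed
  then have "\<forall>\<^sub>F t in at_right (0::real). \<forall>k\<in>L. 1 - cos (of_int k * t) < e"
    using assms(1) by (intro eventually_ball_finite) auto
  then show ?thesis
    unfolding eventually_at_right_field by (auto intro: less_imp_le)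
qed

text \<open>The angles are chosen together with times \<open>N j\<close>. The angle \<open>th (Suc
j)\<close> is so small that it is still negligible before time \<open>N j\<close>, and rigidity
makes it negligible again after time \<open>N (Suc j)\<close>. In between there is no control,
but these time windows are disjoint, and an uncontrolled term contributes at most \<open>2 / (j
+ 2)\<close>, which is small because only large \<open>j\<close> are concerned for large
\<open>l\<close>.\<close>

lemma choose_angles:
  assumes small: "\<forall>d>0. \<exists>t\<in>rigid_angles m. 0 < t \<and> t < d"
  obtains th :: "nat \<Rightarrow> real" where
    "\<And>j. 0 < th j" "\<And>j. th j < 1" "\<And>j. th (Suc j) < th j / 3"
    "\<And>e. e > 0 \<Longrightarrow>
       \<forall>\<^sub>F l in sequentially. \<forall>J. (\<Sum>j<J. (1 - cos (of_int (m l) * th j)) / (real j + 2)) \<le> e"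
proof -
  let ?a = "\<lambda>t l. 1 - cos (of_int (m l) * t)"
  let ?P = "\<lambda>n x. fst x \<in> rigid_angles m \<and> 0 < fst x \<and> fst x < 1 \<and>
              (\<forall>l\<ge>snd x. ?a (fst x) l \<le> (1/2)^n)"
  let ?Q = "\<lambda>n x y. fst y < fst x / 3 \<and> snd x \<le> snd y \<and>
              (\<forall>l<snd x. ?a (fst y) l \<le> (1/2)^Suc n)"
  have tail: "\<exists>N\<ge>N0. \<forall>l\<ge>N. ?a t l \<le> (1/2)^n"
    if "t \<in> rigid_angles m" for t N0 n
  proof -
    have "\<forall>\<^sub>F l in sequentially. ?a t l < (1/2)^n"
      using rigid_angles_cos[OF that] by (rule order_tendstoD) simp
    then obtain N where "\<forall>l\<ge>N. ?a t l < (1/2)^n"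
      by (auto simp: eventually_sequentially)
    then show ?thesis by (intro exI[of _ "max N N0"]) (auto intro: less_imp_le)
  qed
  obtain f where f: "\<And>n. ?P n (f n)" "\<And>n. ?Q n (f n) (f (Suc n))"
  proof -
    have "\<exists>f. \<forall>n. ?P n (f n) \<and> ?Q n (f n) (f (Suc n))"
    proof (rule dependent_nat_choice)
      obtain t where t: "t \<in> rigid_angles m" "0 < t" "t < 1"
        using small by (meson zero_less_one)
      obtain N where "\<forall>l\<ge>N. ?a t l \<le> (1/2)^0" using tail[OF t(1)] by blast
      with t show "\<exists>x. ?P 0 x" by (intro exI[of _ "(t, N)"]) simp
    next
      fix x n assume x: "?P n x"
      have "\<exists>d>0. \<forall>t::real. 0 < t \<and> t < d \<longrightarrow> (\<forall>k\<in>m ` {..<snd x}. 1 - cos (of_int k * t) \<le> (1/2)^Suc n)"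
        by (rule small_angle_cos) auto
      then obtain d where "d > 0"
        and d': "\<forall>t::real. 0 < t \<and> t < d \<longrightarrow> (\<forall>k\<in>m ` {..<snd x}. 1 - cos (of_int k * t) \<le> (1/2)^Suc n)"
        by (elim exE conjE)
      have d: "d > 0" by fact
      have dl: "?a t l \<le> (1/2)^Suc n" if "0 < t" "t < d" "l < snd x" for t l
        using d' that by simp
      obtain t where t: "t \<in> rigid_angles m" "0 < t" "t < min d (fst x / 3)"
        using small[rule_format, of "min d (fst x / 3)"] d x by auto
      obtain N where N: "N \<ge> snd x" "\<forall>l\<ge>N. ?a t l \<le> (1/2)^Suc n" using tail[OF t(1)] by blast
      show "\<exists>y. ?P (Suc n) y \<and> ?Q n x y"
        using t N x d dl by (intro exI[of _ "(t, N)"]) auto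
    qed
    then show thesis using that by blast
  qed
  define th where "th n = fst (f n)" for n
  define N where "N n = snd (f n)" for n
  have th: "th n \<in> rigid_angles m" "0 < th n" "th n < 1" "th (Suc n) < th n / 3"
    and late: "N n \<le> l \<Longrightarrow> ?a (th n) l \<le> (1/2)^n"
    and Nmono: "N n \<le> N (Suc n)"
    and early: "l < N n \<Longrightarrow> ?a (th (Suc n)) l \<le> (1/2)^Suc n" for n l
    using f(1)[of n] f(2)[of n] by (auto simp: th_def N_def)
  have Nm: "N i \<le> N j" if "i \<le> j" for i j
    using Nmono that by (rule lift_Suc_mono_le)
  show thesis
  proof (rule that[of th])
    fix e :: real assume e: "e > 0"
    \<comment> \<open>an angle is bad at l if the geometric bound fails; only one index can be bad\<close>
    define bad where "bad l = {j. ?a (th j) l > (1/2)^j}" for l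
    have onebad: "i = j" if "i \<in> bad l" "j \<in> bad l" for i j l
    proof -
      have False if "i < j" "i \<in> bad l" "j \<in> bad l" for i j
      proof -
        obtain j' where j': "j = Suc j'" "i \<le> j'" using \<open>i < j\<close> by (cases j) auto
        have "l < N i" using late[of i l] that by (force simp: bad_def)
        also have "\<dots> \<le> N j'" using Nm j' by simp
        finally show False using early[of l j'] that j' by (force simp: bad_def)
      qed
      with that show ?thesis by (meson linorder_neqE_nat)
    qed
    obtain K where K: "(1/2)^K < e / 8" "2 / real (K + 2) < e / 4"
    proof -
      have "\<forall>\<^sub>F K in sequentially. (1/2::real)^K < e / 8"
        using e by (intro order_tendstoD(2)[OF LIMSEQ_realpow_zero]) auto
      moreover have "\<forall>\<^sub>F K in sequentially. 2 / real (K + 2) < e / 4"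
        using e by (intro order_tendstoD(2)[where y = 0]) (real_asymp | simp)+
      ultimately have "\<forall>\<^sub>F K in sequentially. (1/2::real)^K < e / 8 \<and> 2 / real (K + 2) < e / 4"
        by (rule eventually_conj)
      then show ?thesis using that by (auto simp: eventually_sequentially)
    qed
    have "(\<lambda>l. \<Sum>j<K. ?a (th j) l) \<longlonglongrightarrow> (\<Sum>j<K. 0)"
      by (intro tendsto_sum rigid_angles_cos th)
    then have "\<forall>\<^sub>F l in sequentially. (\<Sum>j<K. ?a (th j) l) < e / 2"
      using e by (intro order_tendstoD) auto
    then show "\<forall>\<^sub>F l in sequentially. \<forall>J. (\<Sum>j<J. ?a (th j) l / (real j + 2)) \<le> e"
    proof (eventually_elim, intro allI)
      fix l J assume l: "(\<Sum>j<K. ?a (th j) l) < e / 2"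
      have nn: "?a (th j) l \<ge> 0" for j by simp
      let ?b = "\<lambda>j. ?a (th j) l / (real j + 2)"
      have b0: "?b j \<ge> 0" for j by (intro divide_nonneg_nonneg nn) simp
      have ba: "?b j \<le> ?a (th j) l" for j
        using frac_le[of "?a (th j) l" "?a (th j) l" 1 "real j + 2"] by simp
      have "(\<Sum>j<J. ?b j) \<le> (\<Sum>j\<in>{..<K} \<union> {K..<J}. ?b j)"
        by (intro sum_mono2 b0) auto
      also have "\<dots> = (\<Sum>j<K. ?b j) + (\<Sum>j\<in>{K..<J}. ?b j)"
        by (intro sum.union_disjoint) auto
      also have "(\<Sum>j\<in>{K..<J}. ?b j) = (\<Sum>j\<in>{K..<J} \<inter> bad l. ?b j) + (\<Sum>j\<in>{K..<J} - bad l. ?b j)"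
        by (intro sum.Int_Diff) auto
      also have "(\<Sum>j<K. ?b j) \<le> (\<Sum>j<K. ?a (th j) l)"
        by (intro sum_mono ba)
      also have "(\<Sum>j\<in>{K..<J} - bad l. ?b j) \<le> (\<Sum>j\<in>{K..<J}. (1/2)^j)"
      proof (rule order_trans)
        show "(\<Sum>j\<in>{K..<J} - bad l. ?b j) \<le> (\<Sum>j\<in>{K..<J} - bad l. (1/2)^j)"
        proof (intro sum_mono)
          fix j assume "j \<in> {K..<J} - bad l"
          then have "?a (th j) l \<le> (1/2)^j" by (auto simp: bad_def)
          with ba[of j] show "?b j \<le> (1/2)^j" by simp
        qed
        show "(\<Sum>j\<in>{K..<J} - bad l. (1/2)^j) \<le> (\<Sum>j\<in>{K..<J}. (1/2::real)^j)"
          by (intro sum_mono2) auto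
      qed
      also have "(\<Sum>j\<in>{K..<J}. (1/2::real)^j) \<le> 2 * (1/2)^K"
      proof -
        have "K \<le> J \<Longrightarrow> (\<Sum>j\<in>{K..<J}. (1/2::real)^j) = 2 * (1/2)^K - 2 * (1/2)^J"
          by (induction J rule: dec_induct) auto
        then show ?thesis by (cases "K \<le> J") auto
      qed
      also have "\<dots> \<le> e / 4" using K by simp
      also have "(\<Sum>j\<in>{K..<J} \<inter> bad l. ?b j) \<le> e / 4"
      proof (cases "{K..<J} \<inter> bad l = {}")
        case False
        then obtain i where i: "i \<in> {K..<J} \<inter> bad l" by (meson all_not_in_conv)
        then have "{K..<J} \<inter> bad l = {i}" using onebad by auto
        moreover have "?b i \<le> 2 / real (K + 2)"
          using i cos_ge_minus_one[of "of_int (m l) * th i"] by (intro frac_le) auto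
        ultimately show ?thesis using K(2) by (simp only: sum.insert finite.emptyI empty_iff not_False_eq_True sum.empty)
      qed (use e in auto)
      finally show "(\<Sum>j<J. ?b j) \<le> e" using l by simp
    qed
  qed (use th in auto)
qed

section \<open>Riesz products as covariances\<close>

text \<open>The Fourier transform, at frequency \<open>x\<close>, of the law of a sum of independent
variables indexed by \<open>F\<close>, the \<open>j\<close>-th being \<open>0\<close>, \<open>th
j\<close> or \<open>- th j\<close> as described above, with \<open>p j = 1 / (j + 2)\<close>.
Since \<open>p j \<le> 1 / 2\<close>, all factors lie between \<open>0\<close> and
\<open>1\<close>.\<close>

definition riesz :: "(nat \<Rightarrow> real) \<Rightarrow> nat set \<Rightarrow> real \<Rightarrow> real" where
  "riesz th F x = (\<Prod>j\<in>F. 1 - (1 - cos (x * th j)) / (real j + 2))"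

definition riesz_cov :: "(nat \<Rightarrow> real) \<Rightarrow> real \<Rightarrow> real" where
  "riesz_cov th x = lim (\<lambda>J. riesz th {..<J} x)"

lemma riesz_factor:
  fixes t :: real and j :: nat
  shows "0 \<le> 1 - (1 - cos t) / (real j + 2)" "1 - (1 - cos t) / (real j + 2) \<le> 1"
proof -
  have "1 - cos t \<le> real j + 2" using cos_ge_minus_one[of t] by linarith
  then have "(1 - cos t) / (real j + 2) \<le> 1" by (subst divide_le_eq) auto
  then show "0 \<le> 1 - (1 - cos t) / (real j + 2)" by simp
  show "1 - (1 - cos t) / (real j + 2) \<le> 1" by simp
qed

lemma riesz_insert:
  assumes "finite F" "j \<notin> F"
  shows "riesz th (insert j F) x =
    (1 - 1 / (real j + 2)) * riesz th F x + 1 / (real j + 2) * (cos (x * th j) * riesz th F x)"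
proof -
  have "riesz th (insert j F) x = (1 - (1 - cos (x * th j)) * (1 / (real j + 2))) * riesz th F x"
    using assms by (simp add: riesz_def)
  then show ?thesis by (simp only: algebra_simps)
qed

lemma riesz_nonneg: "0 \<le> riesz th F x"
  unfolding riesz_def by (intro prod_nonneg ballI riesz_factor)

lemma riesz_le_1: "riesz th F x \<le> 1"
  unfolding riesz_def by (intro prod_le_1 conjI riesz_factor)

lemma riesz_Suc: "riesz th {..<Suc J} x = riesz th {..<J} x * (1 - (1 - cos (x * th J)) / (real J + 2))"
  by (simp add: riesz_def)

lemma riesz_decseq: "decseq (\<lambda>J. riesz th {..<J} x)"
proof (rule decseq_SucI)
  fix J show "riesz th {..<Suc J} x \<le> riesz th {..<J} x"
    unfolding riesz_Suc by (intro mult_left_le riesz_factor riesz_nonneg)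
qed

lemma riesz_tendsto: "(\<lambda>J. riesz th {..<J} x) \<longlonglongrightarrow> riesz_cov th x"
proof -
  have "convergent (\<lambda>J. riesz th {..<J} x)"
    using decseq_convergent[OF riesz_decseq[of th x], of 0] riesz_nonneg by (metis convergentI)
  then show ?thesis unfolding riesz_cov_def by (simp add: convergent_LIMSEQ_iff)
qed

lemma riesz_cov_nonneg: "0 \<le> riesz_cov th x"
  using riesz_tendsto by (rule LIMSEQ_le_const) (auto intro: riesz_nonneg)

lemma riesz_cov_le: "riesz_cov th x \<le> riesz th {..<J} x"
  using riesz_decseq riesz_tendsto by (rule decseq_ge)

lemma riesz_cov_0: "riesz_cov th 0 = 1"
  using LIMSEQ_unique[OF riesz_tendsto[of th 0]] by (auto simp: riesz_def)

lemma riesz_cov_minus: "riesz_cov th (- x) = riesz_cov th x"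
  by (simp add: riesz_cov_def riesz_def)

text \<open>The union bound for the complements of the factors.\<close>

lemma riesz_ge: "1 - riesz th {..<J} x \<le> (\<Sum>j<J. (1 - cos (x * th j)) / (real j + 2))"
proof (induction J)
  case (Suc J)
  let ?u = "(1 - cos (x * th J)) / (real J + 2)" and ?R = "riesz th {..<J} x"
  have "?R * ?u \<le> ?u" using riesz_le_1[of th "{..<J}" x] by (intro mult_left_le_one_le riesz_nonneg) auto
  then have "1 - riesz th {..<Suc J} x \<le> (1 - ?R) + ?u" by (simp only: riesz_Suc) (simp only: algebra_simps)
  with Suc show ?case by simp
qed (simp add: riesz_def)

lemma riesz_cov_tendsto_1:
  assumes "\<And>e. e > 0 \<Longrightarrow>
       \<forall>\<^sub>F l in sequentially. \<forall>J. (\<Sum>j<J. (1 - cos (x l * th j)) / (real j + 2)) \<le> e"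
  shows "(\<lambda>l. riesz_cov th (x l)) \<longlonglongrightarrow> 1"
proof (rule tendstoI)
  fix e :: real assume "e > 0"
  then have "\<forall>\<^sub>F l in sequentially. \<forall>J. (\<Sum>j<J. (1 - cos (x l * th j)) / (real j + 2)) \<le> e / 2"
    by (intro assms) simp
  then show "\<forall>\<^sub>F l in sequentially. dist (riesz_cov th (x l)) 1 < e"
  proof eventually_elim
    case (elim l)
    have "1 - riesz_cov th (x l) \<le> e / 2"
    proof (rule LIMSEQ_le_const2)
      show "(\<lambda>J. 1 - riesz th {..<J} (x l)) \<longlonglongrightarrow> 1 - riesz_cov th (x l)"
        by (intro tendsto_intros riesz_tendsto)
      show "\<exists>N. \<forall>n\<ge>N. 1 - riesz th {..<n} (x l) \<le> e / 2"
        using elim riesz_ge[of th _ "x l"] by (meson order_trans)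
    qed
    moreover have "riesz_cov th (x l) \<le> 1"
      using riesz_cov_le[of th "x l" 0] by (simp add: riesz_def)
    ultimately show ?case using \<open>e > 0\<close> by (simp add: dist_real_def)
  qed
qed

definition psd_kernel :: "('i \<Rightarrow> 'i \<Rightarrow> real) \<Rightarrow> bool" where
  "psd_kernel R \<longleftrightarrow> (\<forall>i j. R i j = R j i) \<and>
     (\<forall>F a. finite F \<longrightarrow> 0 \<le> (\<Sum>i\<in>F. \<Sum>j\<in>F. a i * a j * R i j))"

text \<open>Multiplying a positive semidefinite kernel by \<open>cos (s - t) = cos s * cos t + sin s * sin
t\<close> amounts to adding the forms for the coefficients multiplied by \<open>cos\<close> and
by \<open>sin\<close>.\<close>

lemma psd_riesz: "finite F \<Longrightarrow>
   0 \<le> (\<Sum>i\<in>F. \<Sum>j\<in>F. a i * a j * riesz th {..<J} (x i - x j))"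
proof (induction J arbitrary: a)
  case 0
  have "(\<Sum>i\<in>F. \<Sum>j\<in>F. a i * a j) = (\<Sum>i\<in>F. a i)\<^sup>2"
    by (simp add: power2_eq_square sum_product)
  then show ?case by (simp add: riesz_def)
next
  case (Suc J)
  define p where "p = 1 / (real J + 2)"
  have p: "0 \<le> p" "p \<le> 1" by (auto simp: p_def)
  let ?R = "\<lambda>i j. riesz th {..<J} (x i - x j)"
  have "riesz th {..<Suc J} (x i - x j) = (1 - p) * ?R i j +
      p * (cos (x i * th J) * cos (x j * th J) * ?R i j + sin (x i * th J) * sin (x j * th J) * ?R i j)" for i j
  proof -
    have "riesz th {..<Suc J} (x i - x j) = ?R i j * (1 - (1 - cos (x i * th J - x j * th J)) * p)"
      by (simp add: riesz_Suc left_diff_distrib p_def)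
    then show ?thesis by (simp add: cos_diff algebra_simps)
  qed
  then have "(\<Sum>i\<in>F. \<Sum>j\<in>F. a i * a j * riesz th {..<Suc J} (x i - x j)) =
     (1 - p) * (\<Sum>i\<in>F. \<Sum>j\<in>F. a i * a j * ?R i j) +
     p * ((\<Sum>i\<in>F. \<Sum>j\<in>F. (a i * cos (x i * th J)) * (a j * cos (x j * th J)) * ?R i j) +
           (\<Sum>i\<in>F. \<Sum>j\<in>F. (a i * sin (x i * th J)) * (a j * sin (x j * th J)) * ?R i j))"
    by (simp add: sum_distrib_left flip: sum.distrib) (simp add: algebra_simps)
  also have "\<dots> \<ge> 0"
    by (intro add_nonneg_nonneg mult_nonneg_nonneg Suc) (use p in \<open>auto simp: Suc.prems\<close>)
  finally show ?case .
qed

lemma psd_riesz_cov: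
  fixes x :: "'i \<Rightarrow> real"
  shows "psd_kernel (\<lambda>i j. riesz_cov th (x i - x j))"
  unfolding psd_kernel_def
proof (intro conjI allI impI)
  show "riesz_cov th (x i - x j) = riesz_cov th (x j - x i)" for i j
    using riesz_cov_minus[of th "x i - x j"] by simp
next
  fix F :: "'i set" and a assume "finite F"
  then have "0 \<le> (\<Sum>i\<in>F. \<Sum>j\<in>F. a i * a j * riesz th {..<J} (x i - x j))" for J
    by (rule psd_riesz)
  moreover have "(\<lambda>J. \<Sum>i\<in>F. \<Sum>j\<in>F. a i * a j * riesz th {..<J} (x i - x j)) \<longlonglongrightarrow>
      (\<Sum>i\<in>F. \<Sum>j\<in>F. a i * a j * riesz_cov th (x i - x j))"
    by (intro tendsto_intros riesz_tendsto)
  ultimately show "0 \<le> (\<Sum>i\<in>F. \<Sum>j\<in>F. a i * a j * riesz_cov th (x i - x j))"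
    by (intro LIMSEQ_le_const) auto
qed

text \<open>The offset \<open>s\<close> is carried along because decorrelation is needed for finitely many
lags at the same time.\<close>

definition time_mean :: "(real \<Rightarrow> real) \<Rightarrow> real \<Rightarrow> nat \<Rightarrow> real" where
  "time_mean f s N = (\<Sum>n<N. f (real n + s)) / real N"

lemma time_mean_linear:
  "time_mean (\<lambda>x. c * f x + d * g x) s N = c * time_mean f s N + d * time_mean g s N"
  by (simp add: time_mean_def sum.distrib add_divide_distrib flip: sum_distrib_left)

lemma time_mean_cos:
  assumes "0 < \<bar>b\<bar>" "\<bar>b\<bar> < 2 * pi"
  shows "time_mean (\<lambda>x. cos (x * b)) s \<longlonglongrightarrow> 0"
proof -
  have ne: "cis b \<noteq> 1"
  proof
    assume "cis b = 1"
    then have "cos b = 1" by (metis cis.simps(1) one_complex.simps(1))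
    then obtain n :: int where n: "b = of_int n * (2 * pi)"
      using cos_one_2pi_int[of b] by (auto simp: mult_ac)
    then have "n = 0" using assms by (auto simp: abs_mult)
    with n assms show False by simp
  qed
  let ?C = "2 / cmod (cis b - 1)"
  have bd: "\<bar>\<Sum>n<N. cos ((real n + s) * b)\<bar> \<le> ?C" for N
  proof -
    have "(\<Sum>n<N. cos ((real n + s) * b)) = Re (\<Sum>n<N. cis (s * b) * cis b ^ n)"
      by (simp add: Complex.DeMoivre cis_mult algebra_simps flip: cis.sel(1))
    also have "(\<Sum>n<N. cis (s * b) * cis b ^ n) = cis (s * b) * ((cis b ^ N - 1) / (cis b - 1))"
      using ne by (simp add: geometric_sum flip: sum_distrib_left)
    also have "\<bar>Re \<dots>\<bar> \<le> cmod \<dots>" by (rule abs_Re_le_cmod)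
    also have "\<dots> = cmod (cis b ^ N - 1) / cmod (cis b - 1)" by (simp add: norm_mult norm_divide)
    also have "cmod (cis b ^ N - 1) \<le> 2"
      using norm_triangle_ineq4[of "cis b ^ N" 1] by (simp add: norm_power)
    finally show ?thesis by (simp add: divide_right_mono)
  qed
  show ?thesis
  proof (rule Lim_null_comparison)
    show "(\<lambda>N. ?C / real N) \<longlonglongrightarrow> 0" by (intro lim_const_over_n)
    show "\<forall>\<^sub>F N in sequentially. norm (time_mean (\<lambda>x. cos (x * b)) s N) \<le> ?C / real N"
    proof (intro always_eventually allI)
      show "norm (time_mean (\<lambda>x. cos (x * b)) s N) \<le> ?C / real N" for N
        using divide_right_mono[OF bd[of N], of "real N"] by (simp add: time_mean_def)
    qed
  qed
qed

text \<open>Expanding the product turns the function into a combination of cosines with frequencies \<open>b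
+ (\<Sum>j\<in>F. e j * th j)\<close>, \<open>e j \<in> {-1, 0, 1}\<close>. The hypotheses keep
all of them away from the multiples of \<open>2 * pi\<close>, so every term averages to
\<open>0\<close>.\<close>

lemma time_mean_cos_riesz:
  assumes "finite F" "(\<Sum>j\<in>F. \<bar>th j\<bar>) < \<bar>b\<bar>" "\<bar>b\<bar> + (\<Sum>j\<in>F. \<bar>th j\<bar>) < 2 * pi"
  shows "time_mean (\<lambda>x. cos (x * b) * riesz th F x) s \<longlonglongrightarrow> 0"
  using assms
proof (induction F arbitrary: b rule: finite_induct)
  case empty
  then show ?case by (simp add: riesz_def time_mean_cos)
next
  case (insert j F)
  define p where "p = 1 / (real j + 2)"
  let ?f = "\<lambda>c x. cos (x * c) * riesz th F x"
  have eq: "cos (x * b) * riesz th (insert j F) x =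
        (1 - p) * ?f b x + p / 2 * (?f (b + th j) x + ?f (b - th j) x)" for x
  proof -
    have "?f (b + th j) x + ?f (b - th j) x = 2 * (cos (x * b) * cos (x * th j)) * riesz th F x"
      by (simp add: ring_distribs cos_add cos_diff)
    moreover have "cos (x * b) * riesz th (insert j F) x =
        (1 - p) * ?f b x + p / 2 * (2 * (cos (x * b) * cos (x * th j)) * riesz th F x)"
      using insert.hyps by (simp add: riesz_insert flip: p_def) (simp add: algebra_simps)
    ultimately show ?thesis by simp
  qed
  have "time_mean (\<lambda>x. cos (x * b) * riesz th (insert j F) x) s =
     (\<lambda>N. (1 - p) * time_mean (?f b) s N +
        p / 2 * (time_mean (?f (b + th j)) s N + time_mean (?f (b - th j)) s N))"
    unfolding eq time_mean_linear
    using time_mean_linear[of 1 "?f (b + th j)" 1 "?f (b - th j)"] by simp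
  moreover have "(\<lambda>N. (1 - p) * time_mean (?f b) s N +
        p / 2 * (time_mean (?f (b + th j)) s N + time_mean (?f (b - th j)) s N))
       \<longlonglongrightarrow> (1 - p) * 0 + p / 2 * (0 + 0)"
    using insert.prems insert.hyps by (intro tendsto_intros insert.IH) auto
  ultimately show ?case by simp
qed

text \<open>For lacunary angles the largest one dominates the sum of the others. Splitting it off leaves, by
the preceding lemma, only the constant part of its factor.\<close>

lemma time_mean_riesz:
  assumes pos: "\<And>j. 0 < th j" and le1: "\<And>j. th j < 1" and lac: "\<And>j. th (Suc j) < th j / 3"
    and "i \<le> J"
  shows "time_mean (riesz th {i..<J}) s \<longlonglongrightarrow> (\<Prod>j\<in>{i..<J}. 1 - 1 / (real j + 2))"
  using \<open>i \<le> J\<close>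
proof (induction i rule: inc_induct)
  case base
  have "\<forall>\<^sub>F N in sequentially. time_mean (riesz th {}) s N = 1"
    using eventually_gt_at_top[of 0] by eventually_elim (simp add: time_mean_def riesz_def)
  then show ?case by (simp add: tendsto_eventually)
next
  case (step i)
  have tails: "(\<Sum>j\<in>{k..<J}. th j) < 3 / 2 * th k" if "k \<le> J" for k
    using that
  proof (induction k rule: inc_induct)
    case (step k)
    then have "(\<Sum>j\<in>{k..<J}. th j) = th k + (\<Sum>j\<in>{Suc k..<J}. th j)"
      by (simp add: sum.atLeast_Suc_lessThan)
    with step lac[of k] show ?case by simp
  qed (use pos in simp)
  have lt: "(\<Sum>j\<in>{Suc i..<J}. th j) < th i / 2"
    using tails[of "Suc i"] lac[of i] step.hyps by simp
  define p where "p = 1 / (real i + 2)"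
  let ?F = "{Suc i..<J}"
  have ins: "{i..<J} = insert i ?F" using step.hyps by auto
  have eq: "riesz th {i..<J} x = (1 - p) * riesz th ?F x + p * (cos (x * th i) * riesz th ?F x)" for x
    unfolding ins p_def by (rule riesz_insert) auto
  have "time_mean (riesz th {i..<J}) s = (\<lambda>N. (1 - p) * time_mean (riesz th ?F) s N +
           p * time_mean (\<lambda>x. cos (x * th i) * riesz th ?F x) s N)"
    unfolding eq time_mean_linear ..
  moreover have "(\<lambda>N. (1 - p) * time_mean (riesz th ?F) s N +
           p * time_mean (\<lambda>x. cos (x * th i) * riesz th ?F x) s N) \<longlonglongrightarrow>
      (1 - p) * (\<Prod>j\<in>?F. 1 - 1 / (real j + 2)) + p * 0"
  proof (intro tendsto_intros step.IH time_mean_cos_riesz)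
    have abs: "\<bar>th j\<bar> = th j" for j using pos[of j] by simp
    show "(\<Sum>j\<in>?F. \<bar>th j\<bar>) < \<bar>th i\<bar>" using lt pos[of i] by (simp add: abs)
    show "\<bar>th i\<bar> + (\<Sum>j\<in>?F. \<bar>th j\<bar>) < 2 * pi"
      using lt le1[of i] pi_gt3 pos[of i] by (simp add: abs)
  qed simp
  ultimately show ?case unfolding ins by (simp add: p_def)
qed

text \<open>The average over time of the sum of \<open>riesz th {..<J}\<close> over all lags up to
\<open>L\<close> tends to \<open>(2 * L + 1) / (J + 1)\<close>. As the values are nonnegative,
for large \<open>J\<close> some single time makes all of these lags small at once.\<close>

lemma riesz_cov_mixing_times:
  assumes pos: "\<And>j. 0 < th j" and le1: "\<And>j. th j < 1" and lac: "\<And>j. th (Suc j) < th j / 3"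
  obtains n :: "nat \<Rightarrow> nat" where "\<And>k::int. (\<lambda>i. riesz_cov th (real (n i) + of_int k)) \<longlonglongrightarrow> 0"
proof -
  have ex: "\<exists>n::nat. \<forall>k\<in>{- int L..int L}. riesz_cov th (real n + of_int k) < 1 / real (Suc L)" for L
  proof -
    have telescope: "(\<Prod>j\<in>{0..<J}. 1 - 1 / (real j + 2)) = 1 / (real J + 1)" for J
    proof (induction J)
      case (Suc J)
      then show ?case by (simp add: field_simps)
    qed simp
    define K where "K = {- int L..int L}"
    have K: "finite K" "card K = 2 * L + 1" by (auto simp: K_def)
    \<comment> \<open>the average \<open>1 / (J + 1)\<close>, summed over \<open>2 * L + 1\<close> lags, falls below \<open>1 / Suc L\<close>\<close>
    define J where "J = (2 * L + 1) * Suc L"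
    have lim: "(\<lambda>N. \<Sum>k\<in>K. time_mean (riesz th {0..<J}) (of_int k) N) \<longlonglongrightarrow> (\<Sum>k\<in>K. 1 / (real J + 1))"
      unfolding telescope[symmetric] by (intro tendsto_sum time_mean_riesz assms) auto
    have "(\<Sum>k\<in>K. 1 / (real J + 1)) < 1 / real (Suc L)"
    proof -
      have "real (2 * L + 1) * real (Suc L) < real J + 1" by (simp only: J_def of_nat_mult)
      then have "real (2 * L + 1) < (real J + 1) / real (Suc L)"
        by (subst less_divide_eq) auto
      then have "real (2 * L + 1) / (real J + 1) < 1 / real (Suc L)"
        by (subst divide_less_eq) auto
      then show ?thesis using K by simp
    qed
    then have "\<forall>\<^sub>F N in sequentially. (\<Sum>k\<in>K. time_mean (riesz th {0..<J}) (of_int k) N) < 1 / real (Suc L)"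
      using lim by (rule order_tendstoD(2)[rotated])
    then have "\<forall>\<^sub>F N in sequentially. (\<Sum>k\<in>K. time_mean (riesz th {0..<J}) (of_int k) N) < 1 / real (Suc L) \<and> 0 < N"
      using eventually_gt_at_top[of 0] by (rule eventually_conj)
    then obtain N where N: "N > 0" "(\<Sum>k\<in>K. time_mean (riesz th {0..<J}) (of_int k) N) < 1 / real (Suc L)"
      by (auto simp: eventually_sequentially)
    have "(\<Sum>k\<in>K. time_mean (riesz th {0..<J}) (of_int k) N) =
        (\<Sum>n<N. \<Sum>k\<in>K. riesz th {0..<J} (real n + of_int k)) / N"
      unfolding time_mean_def by (subst sum.swap) (simp add: sum_divide_distrib)
    with N(2) have "(\<Sum>n<N. \<Sum>k\<in>K. riesz th {0..<J} (real n + of_int k)) / N < 1 / real (Suc L)"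
      by simp
    then have "(\<Sum>n<N. \<Sum>k\<in>K. riesz th {0..<J} (real n + of_int k)) < (\<Sum>n<N. 1 / real (Suc L))"
      using N(1) by (subst (asm) divide_less_eq) (simp add: mult.commute)
    then obtain n where n: "(\<Sum>k\<in>K. riesz th {0..<J} (real n + of_int k)) < 1 / real (Suc L)"
      by (meson not_less sum_mono)
    show ?thesis
    proof (intro exI ballI)
      fix k assume k: "k \<in> {- int L..int L}"
      have "riesz_cov th (real n + of_int k) \<le> riesz th {0..<J} (real n + of_int k)"
        using riesz_cov_le by (simp add: atLeast0LessThan)
      also have "\<dots> \<le> (\<Sum>k\<in>K. riesz th {0..<J} (real n + of_int k))"
        using k K by (intro member_le_sum riesz_nonneg) (auto simp: K_def)
      finally show "riesz_cov th (real n + of_int k) < 1 / real (Suc L)" using n by simp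
    qed
  qed
  then obtain n where n: "\<And>L k. k \<in> {- int L..int L} \<Longrightarrow> riesz_cov th (real (n L) + of_int k) < 1 / real (Suc L)"
    by metis
  show thesis
  proof (rule that[of n])
    fix k :: int
    show "(\<lambda>i. riesz_cov th (real (n i) + of_int k)) \<longlonglongrightarrow> 0"
    proof (rule Lim_null_comparison[OF _ LIMSEQ_inverse_real_of_nat])
      show "\<forall>\<^sub>F i in sequentially. norm (riesz_cov th (real (n i) + of_int k)) \<le> inverse (real (Suc i))"
        using eventually_ge_at_top[of "nat \<bar>k\<bar>"]
      proof eventually_elim
        case (elim i)
        then have "k \<in> {- int i..int i}" by auto
        from n[OF this] show ?case
          using riesz_cov_nonneg[of th "real (n i) + of_int k"] by (simp add: inverse_eq_divide)
      qed
    qed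
  qed
qed

section \<open>Triangular factorisation of positive semidefinite kernels\<close>

lemma psd_kernel_sym: "psd_kernel R \<Longrightarrow> R i j = R j i"
  unfolding psd_kernel_def by blast

lemma psd_kernel_nonneg:
  "psd_kernel R \<Longrightarrow> finite F \<Longrightarrow> 0 \<le> (\<Sum>i\<in>F. \<Sum>j\<in>F. a i * a j * R i j)"
  unfolding psd_kernel_def by blast

lemma psd_diag_nonneg: "psd_kernel R \<Longrightarrow> 0 \<le> R i i"
  using psd_kernel_nonneg[of R "{i}" "\<lambda>_. 1"] by simp

text \<open>Otherwise the form on the span of the \<open>i\<close>-th and \<open>j\<close>-th vectors would
be affine and not constant along a line, hence negative somewhere.\<close>

lemma psd_zero_row:
  assumes "psd_kernel R" "R j j = 0"
  shows "R i j = 0"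
proof (cases "i = j")
  case False
  have sym: "R j i = R i j" using assms(1) by (rule psd_kernel_sym)
  have q: "0 \<le> R i i + 2 * t * R i j" for t
  proof -
    show ?thesis
      using psd_kernel_nonneg[OF assms(1), of "{i, j}" "\<lambda>k. if k = i then 1 else t"] False assms(2) sym
      by (simp add: algebra_simps)
  qed
  show ?thesis
  proof (rule ccontr)
    assume "R i j \<noteq> 0"
    then have "2 * (- (R i i + 1) / (2 * R i j)) * R i j = - (R i i + 1)" by (simp add: field_simps)
    with q[of "- (R i i + 1) / (2 * R i j)"] show False by linarith
  qed
qed (use assms in simp)

text \<open>The covariance left after the part explained by the \<open>j\<close>-th vector has been removed.
If \<open>R j j = 0\<close>, division by zero makes this \<open>R\<close> itself, which is right
since that vector is then null.\<close>

definition schur :: "nat \<Rightarrow> (nat \<Rightarrow> nat \<Rightarrow> real) \<Rightarrow> nat \<Rightarrow> nat \<Rightarrow> real" where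
  "schur j R = (\<lambda>k l. R k l - R k j * R l j / R j j)"

lemma psd_schur:
  assumes R: "psd_kernel R"
  shows "psd_kernel (schur j R)"
proof (cases "R j j = 0")
  case True
  then show ?thesis using R by (simp add: schur_def)
next
  case False
  have sym: "R k l = R l k" for k l using R by (rule psd_kernel_sym)
  show ?thesis
    unfolding psd_kernel_def
  proof (intro conjI allI impI)
    show "schur j R k l = schur j R l k" for k l using sym by (simp add: schur_def mult.commute)
  next
    fix F :: "nat set" and a :: "nat \<Rightarrow> real" assume F: "finite F"
    define s where "s = (\<Sum>k\<in>F. a k * R k j)"
    define G where "G = insert j F"
    \<comment> \<open>completing the square: the best multiple of the j-th vector is subtracted\<close>
    define b where "b k = (if k \<in> F then a k else 0) - (if k = j then s / R j j else 0)" for k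
    have G: "finite G" "F \<subseteq> G" "j \<in> G" using F by (auto simp: G_def)
    have lin: "(\<Sum>k\<in>G. b k * g k) = (\<Sum>k\<in>F. a k * g k) - s / R j j * g j" for g
    proof -
      have "(\<Sum>k\<in>G. b k * g k) = (\<Sum>k\<in>G. (if k \<in> F then a k * g k else 0)) - (\<Sum>k\<in>G. if k = j then s / R j j * g k else 0)"
        by (simp add: b_def left_diff_distrib if_distrib[where f="\<lambda>x. x * _"] sum_subtractf cong: if_cong)
      also have "(\<Sum>k\<in>G. if k \<in> F then a k * g k else 0) = (\<Sum>k\<in>F. a k * g k)"
        using G by (simp add: sum.inter_restrict[symmetric] Int_absorb1)
      finally show ?thesis using G by (simp add: sum.delta)
    qed
    have "0 \<le> (\<Sum>k\<in>G. \<Sum>l\<in>G. b k * b l * R k l)"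
      using R G(1) by (rule psd_kernel_nonneg)
    also have "\<dots> = (\<Sum>k\<in>G. b k * (\<Sum>l\<in>G. b l * R k l))"
      by (simp add: sum_distrib_left mult.assoc)
    also have "\<dots> = (\<Sum>k\<in>F. a k * ((\<Sum>l\<in>F. a l * R k l) - s / R j j * R k j))
        - s / R j j * ((\<Sum>l\<in>F. a l * R j l) - s / R j j * R j j)"
      by (simp only: lin)
    also have "(\<Sum>l\<in>F. a l * R j l) - s / R j j * R j j = 0"
    proof -
      have "(\<Sum>l\<in>F. a l * R j l) = s"
        unfolding s_def by (rule sum.cong[OF refl], subst sym, rule refl)
      then show ?thesis using False by simp
    qed
    also have "(\<Sum>k\<in>F. a k * ((\<Sum>l\<in>F. a l * R k l) - s / R j j * R k j)) - s / R j j * 0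
        = (\<Sum>k\<in>F. \<Sum>l\<in>F. a k * a l * schur j R k l)"
    proof -
      have "(\<Sum>l\<in>F. a l * R k l) - s / R j j * R k j = (\<Sum>l\<in>F. a l * schur j R k l)" for k
        by (simp add: s_def schur_def right_diff_distrib sum_subtractf sum_divide_distrib
            sum_distrib_left mult_ac)
      then show ?thesis by (simp add: sum_distrib_left mult.assoc)
    qed
    finally show "0 \<le> (\<Sum>k\<in>F. \<Sum>l\<in>F. a k * a l * schur j R k l)" .
  qed
qed

text \<open>Schur complements are taken one index after the other: after step \<open>j\<close> the row and
the column of \<open>j\<close> vanish, so the parts removed so far add up to \<open>R\<close>.\<close>

lemma cholesky:
  fixes R :: "nat \<Rightarrow> nat \<Rightarrow> real"
  assumes "psd_kernel R"
  obtains L where "\<And>k l. R k l = (\<Sum>j\<le>k. L k j * L l j)" "\<And>k j. k < j \<Longrightarrow> L k j = 0"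
proof -
  define Q where "Q n = rec_nat R schur n" for n
  have Q0: "Q 0 = R" and QS: "Q (Suc n) = schur n (Q n)" for n by (simp_all add: Q_def)
  have psd: "psd_kernel (Q n)" for n
    by (induction n) (use assms in \<open>simp_all add: Q0 QS psd_schur\<close>)
  have sym: "Q n k l = Q n l k" for n k l using psd by (rule psd_kernel_sym)
  define L where "L k j = Q j k j / sqrt (Q j j j)" for k j
  have LL: "L k j * L l j = Q j k j * Q j l j / Q j j j" for k l j
    using psd_diag_nonneg[OF psd] by (simp add: L_def)
  have zero: "Q n k l = 0" if "l < n" for n k l
    using that
  proof (induction n arbitrary: k)
    case (Suc n)
    show ?case
    proof (cases "l = n")
      case True
      then show ?thesis
        using psd_zero_row[OF psd, of n n k] by (cases "Q n n n = 0") (simp_all add: QS schur_def)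
    next
      case False
      then have "Q n k l = 0" "Q n n l = 0" using Suc by auto
      then show ?thesis using sym by (simp add: QS schur_def)
    qed
  qed simp
  have "R k l = Q n k l + (\<Sum>j<n. L k j * L l j)" for n k l
    by (induction n) (simp_all add: Q0 QS schur_def LL)
  then have "R k l = Q (Suc k) k l + (\<Sum>j<Suc k. L k j * L l j)" for k l .
  moreover have "Q (Suc k) k l = 0" for k l using zero[of k "Suc k" l] sym by simp
  ultimately have "R k l = (\<Sum>j\<le>k. L k j * L l j)" for k l by (simp add: lessThan_Suc_atMost)
  moreover have "L k j = 0" if "k < j" for k j
    using zero[OF that, of j] sym by (simp add: L_def)
  ultimately show thesis by (rule that)
qed

section \<open>Density of trigonometric polynomials in linear forms\<close>

definition lin_closed :: "('x \<Rightarrow> real) set \<Rightarrow> bool" where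
  "lin_closed V \<longleftrightarrow> (\<lambda>_. 0) \<in> V \<and> (\<forall>Y\<in>V. \<forall>Z\<in>V. \<forall>c d. (\<lambda>x. c * Y x + d * Z x) \<in> V)"

inductive_set trig :: "('x \<Rightarrow> real) set \<Rightarrow> ('x \<Rightarrow> real) set" for V :: "('x \<Rightarrow> real) set" where
  zero: "(\<lambda>_. 0) \<in> trig V"
| add: "f \<in> trig V \<Longrightarrow> Y \<in> V \<Longrightarrow> (\<lambda>x. c * cos (Y x + b) + f x) \<in> trig V"

lemma trig_plus: "f \<in> trig V \<Longrightarrow> g \<in> trig V \<Longrightarrow> (\<lambda>x. f x + g x) \<in> trig V"
  by (induction rule: trig.induct) (simp_all add: add.assoc trig.add)

lemma trig_cmult: "f \<in> trig V \<Longrightarrow> (\<lambda>x. a * f x) \<in> trig V"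
proof (induction rule: trig.induct)
  case zero
  show ?case by (simp add: trig.zero)
next
  case (add f Y c b)
  then show ?case using trig.add[OF add.IH add.hyps(2), of "a * c" b] by (simp add: algebra_simps)
qed

lemma trig_cos: "Y \<in> V \<Longrightarrow> (\<lambda>x. cos (Y x + b)) \<in> trig V"
  using trig.add[OF trig.zero, of Y V 1 b] by simp

lemma trig_cos_mult:
  assumes V: "lin_closed V" and Y: "Y \<in> V" and g: "g \<in> trig V"
  shows "(\<lambda>x. cos (Y x + b) * g x) \<in> trig V"
  using g
proof (induction rule: trig.induct)
  case (add f Z d e)
  have sum: "(\<lambda>x. Y x + Z x) \<in> V" "(\<lambda>x. Y x - Z x) \<in> V"
    using V[unfolded lin_closed_def, THEN conjunct2, rule_format, OF Y add.hyps(2), of 1 1]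
      V[unfolded lin_closed_def, THEN conjunct2, rule_format, OF Y add.hyps(2), of 1 "- 1"] by simp_all
  have "(\<lambda>x. d / 2 * cos (Y x + Z x + (b + e)) + (d / 2 * cos (Y x - Z x + (b - e)) + cos (Y x + b) * f x)) \<in> trig V"
    by (intro trig.add add.IH sum)
  moreover have "d / 2 * cos (Y x + Z x + (b + e)) + (d / 2 * cos (Y x - Z x + (b - e)) + cos (Y x + b) * f x)
      = cos (Y x + b) * (d * cos (Z x + e) + f x)" for x
  proof -
    have "cos (Y x + Z x + (b + e)) + cos (Y x - Z x + (b - e)) = 2 * cos (Y x + b) * cos (Z x + e)"
      using cos_add[of "Y x + b" "Z x + e"] cos_diff[of "Y x + b" "Z x + e"] by (simp add: algebra_simps)
    then have "d / 2 * (cos (Y x + Z x + (b + e)) + cos (Y x - Z x + (b - e))) = d * cos (Y x + b) * cos (Z x + e)"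
      by simp
    then show ?thesis by (simp add: algebra_simps)
  qed
  ultimately show ?case by simp
qed (simp add: trig.zero)

lemma trig_mult:
  assumes V: "lin_closed V" and f: "f \<in> trig V" and g: "g \<in> trig V"
  shows "(\<lambda>x. f x * g x) \<in> trig V"
  using f
proof (induction rule: trig.induct)
  case (add f Y c b)
  have "(\<lambda>x. c * (cos (Y x + b) * g x) + f x * g x) \<in> trig V"
    using add by (intro trig_plus trig_cmult trig_cos_mult V g)
  then show ?case by (simp add: algebra_simps)
qed (simp add: trig.zero)

lemma trig_bounded: "f \<in> trig V \<Longrightarrow> \<exists>C. \<forall>x. \<bar>f x\<bar> \<le> C"
proof (induction rule: trig.induct)
  case (add f Y c b)
  then obtain C where "\<And>x. \<bar>f x\<bar> \<le> C" by auto
  moreover have "\<bar>c * cos (Y x + b)\<bar> \<le> \<bar>c\<bar>" for x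
    by (simp add: abs_mult mult_left_le)
  ultimately have "\<bar>c * cos (Y x + b) + f x\<bar> \<le> \<bar>c\<bar> + C" for x
    by (meson abs_triangle_ineq add_mono order_trans)
  then show ?case by blast
qed auto

lemma trig_measurable:
  "f \<in> trig V \<Longrightarrow> V \<subseteq> borel_measurable M \<Longrightarrow> f \<in> borel_measurable M"
  by (induction rule: trig.induct) auto

text \<open>Approximation is required in the mean for finitely many measures at once, because invariance of
a measure will follow from comparing it with its image.\<close>

locale trig_density =
  fixes K :: "'x measure" and LL :: "'x measure set" and V :: "('x \<Rightarrow> real) set"
  assumes prob: "L \<in> LL \<Longrightarrow> prob_space L"
    and sets_LL: "L \<in> LL \<Longrightarrow> sets L = sets K"
    and finite_LL: "finite LL"
    and V_meas: "V \<subseteq> borel_measurable K"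
    and V_lin: "lin_closed V"
    and space_K: "space K = UNIV"
    and gen: "sets K \<subseteq> sigma_sets UNIV {{x. Y x > t} |Y t. Y \<in> V}"
begin

definition bdd :: "('x \<Rightarrow> real) \<Rightarrow> bool" where
  "bdd f \<longleftrightarrow> f \<in> borel_measurable K \<and> (\<exists>C. \<forall>x. \<bar>f x\<bar> \<le> C)"

definition approx :: "('x \<Rightarrow> real) \<Rightarrow> bool" where
  "approx f \<longleftrightarrow> bdd f \<and> (\<forall>e>0. \<exists>g\<in>trig V. \<forall>L\<in>LL. (\<integral>x. \<bar>f x - g x\<bar> \<partial>L) < e)"

lemma meas_L: "L \<in> LL \<Longrightarrow> borel_measurable L = borel_measurable K"
  using sets_LL by (intro measurable_cong_sets) auto

lemma bdd_integrable:
  assumes "bdd f" "L \<in> LL" shows "integrable L f"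
proof -
  interpret prob_space L using assms prob by blast
  obtain C where "\<And>x. \<bar>f x\<bar> \<le> C" using assms by (auto simp: bdd_def)
  then show ?thesis
    using assms by (intro integrable_const_bound[where B = C]) (auto simp: bdd_def meas_L)
qed

lemma bdd_lin: "bdd f \<Longrightarrow> bdd g \<Longrightarrow> bdd (\<lambda>x. a * f x + b * g x)"
proof -
  assume f: "bdd f" and g: "bdd g"
  then obtain C D where "\<And>x. \<bar>f x\<bar> \<le> C" "\<And>x. \<bar>g x\<bar> \<le> D" by (auto simp: bdd_def)
  then have "\<bar>a * f x\<bar> \<le> \<bar>a\<bar> * C" "\<bar>b * g x\<bar> \<le> \<bar>b\<bar> * D" for x
    by (auto simp: abs_mult intro!: mult_left_mono)
  then have "\<bar>a * f x + b * g x\<bar> \<le> \<bar>a\<bar> * C + \<bar>b\<bar> * D" for x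
    by (meson abs_triangle_ineq add_mono order_trans)
  then show ?thesis using f g by (auto simp: bdd_def)
qed

lemma bdd_mult: "bdd f \<Longrightarrow> bdd g \<Longrightarrow> bdd (\<lambda>x. f x * g x)"
proof -
  assume f: "bdd f" and g: "bdd g"
  then obtain C D where CD: "\<And>x. \<bar>f x\<bar> \<le> C" "\<And>x. \<bar>g x\<bar> \<le> D" by (auto simp: bdd_def)
  have "\<bar>f x * g x\<bar> \<le> C * D" for x
    unfolding abs_mult using CD(1)[of x] CD(2)[of x] by (intro mult_mono) auto
  then show ?thesis using f g by (auto simp: bdd_def)
qed

lemma bdd_diff: "bdd f \<Longrightarrow> bdd g \<Longrightarrow> bdd (\<lambda>x. f x - g x)"
  using bdd_lin[of f g 1 "- 1"] by simp

lemma bdd_abs: "bdd f \<Longrightarrow> bdd (\<lambda>x. \<bar>f x\<bar>)"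
  by (auto simp: bdd_def)

lemma bdd_trig: "g \<in> trig V \<Longrightarrow> bdd g"
  using trig_bounded trig_measurable[OF _ V_meas] by (auto simp: bdd_def)

lemma approx_bdd: "approx f \<Longrightarrow> bdd f" by (simp add: approx_def)

lemma abs_diff_integrable: "bdd f \<Longrightarrow> bdd g \<Longrightarrow> L \<in> LL \<Longrightarrow> integrable L (\<lambda>x. \<bar>f x - g x\<bar>)"
  by (intro bdd_integrable bdd_abs bdd_diff)

lemma approx_trig: "g \<in> trig V \<Longrightarrow> approx g"
  unfolding approx_def using bdd_trig by (auto intro!: bexI[of _ g])

lemma approx_lin:
  assumes "approx f" "approx g" shows "approx (\<lambda>x. a * f x + b * g x)"
  unfolding approx_def
proof (intro conjI allI impI)
  show "bdd (\<lambda>x. a * f x + b * g x)" using assms by (intro bdd_lin approx_bdd)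
  fix e :: real assume "e > 0"
  define d where "d = e / (\<bar>a\<bar> + \<bar>b\<bar> + 1)"
  have d: "d > 0" using \<open>e > 0\<close> by (simp add: d_def)
  obtain f' where f': "f' \<in> trig V" "\<And>L. L \<in> LL \<Longrightarrow> (\<integral>x. \<bar>f x - f' x\<bar> \<partial>L) < d"
    using assms(1) d by (auto simp: approx_def)
  obtain g' where g': "g' \<in> trig V" "\<And>L. L \<in> LL \<Longrightarrow> (\<integral>x. \<bar>g x - g' x\<bar> \<partial>L) < d"
    using assms(2) d by (auto simp: approx_def)
  show "\<exists>h\<in>trig V. \<forall>L\<in>LL. (\<integral>x. \<bar>a * f x + b * g x - h x\<bar> \<partial>L) < e"
  proof (intro bexI ballI)
    show "(\<lambda>x. a * f' x + b * g' x) \<in> trig V" using f' g' by (intro trig_plus trig_cmult)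
    fix L assume L: "L \<in> LL"
    have int: "integrable L (\<lambda>x. \<bar>f x - f' x\<bar>)" "integrable L (\<lambda>x. \<bar>g x - g' x\<bar>)"
      using assms f' g' L by (auto intro!: abs_diff_integrable dest: approx_bdd bdd_trig)
    have "(\<integral>x. \<bar>a * f x + b * g x - (a * f' x + b * g' x)\<bar> \<partial>L) \<le>
        (\<integral>x. \<bar>a\<bar> * \<bar>f x - f' x\<bar> + \<bar>b\<bar> * \<bar>g x - g' x\<bar> \<partial>L)"
    proof (rule integral_mono)
      show "integrable L (\<lambda>x. \<bar>a * f x + b * g x - (a * f' x + b * g' x)\<bar>)"
        using assms f' g' L by (intro bdd_integrable bdd_abs bdd_diff bdd_lin bdd_trig approx_bdd)
      show "\<bar>a * f x + b * g x - (a * f' x + b * g' x)\<bar> \<le> \<bar>a\<bar> * \<bar>f x - f' x\<bar> + \<bar>b\<bar> * \<bar>g x - g' x\<bar>" for x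
        using abs_triangle_ineq[of "a * (f x - f' x)" "b * (g x - g' x)"]
        by (simp add: abs_mult[symmetric] algebra_simps)
    qed (use int in simp)
    also have "\<dots> = \<bar>a\<bar> * (\<integral>x. \<bar>f x - f' x\<bar> \<partial>L) + \<bar>b\<bar> * (\<integral>x. \<bar>g x - g' x\<bar> \<partial>L)"
      using int by simp
    also have "\<dots> \<le> \<bar>a\<bar> * d + \<bar>b\<bar> * d"
      using f'(2)[OF L] g'(2)[OF L] by (intro add_mono mult_left_mono) auto
    also have "\<dots> < (\<bar>a\<bar> + \<bar>b\<bar> + 1) * d" using d by (simp add: algebra_simps)
    also have "\<dots> = e" by (simp add: d_def)
    finally show "(\<integral>x. \<bar>a * f x + b * g x - (a * f' x + b * g' x)\<bar> \<partial>L) < e" .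
  qed
qed

text \<open>No uniform bound on the approximants is needed: the first factor is approximated first, and the
second one with a precision that depends on the bound of that approximant.\<close>

lemma approx_mult:
  assumes "approx f" "approx g" shows "approx (\<lambda>x. f x * g x)"
  unfolding approx_def
proof (intro conjI allI impI)
  show "bdd (\<lambda>x. f x * g x)" using assms by (intro bdd_mult approx_bdd)
  fix e :: real assume "e > 0"
  obtain D where D: "\<And>x. \<bar>g x\<bar> \<le> D" using assms(2) by (auto simp: approx_def bdd_def)
  have D0: "0 \<le> D" using D[of undefined] by linarith
  have "e / 2 / (D + 1) > 0" using \<open>e > 0\<close> D0 by simp
  then obtain f' where f': "f' \<in> trig V" "\<And>L. L \<in> LL \<Longrightarrow> (\<integral>x. \<bar>f x - f' x\<bar> \<partial>L) < e / 2 / (D + 1)"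
    using assms(1) unfolding approx_def by blast
  \<comment> \<open>the second precision depends on the bound of the first approximant\<close>
  obtain C where C: "\<And>x. \<bar>f' x\<bar> \<le> C" using trig_bounded[OF f'(1)] by auto
  have C0: "0 \<le> C" using C[of undefined] by linarith
  have "e / 2 / (C + 1) > 0" using \<open>e > 0\<close> C0 by simp
  then obtain g' where g': "g' \<in> trig V" "\<And>L. L \<in> LL \<Longrightarrow> (\<integral>x. \<bar>g x - g' x\<bar> \<partial>L) < e / 2 / (C + 1)"
    using assms(2) unfolding approx_def by blast
  show "\<exists>h\<in>trig V. \<forall>L\<in>LL. (\<integral>x. \<bar>f x * g x - h x\<bar> \<partial>L) < e"
  proof (intro bexI ballI)
    show "(\<lambda>x. f' x * g' x) \<in> trig V" using f' g' by (intro trig_mult V_lin)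
    fix L assume L: "L \<in> LL"
    have int: "integrable L (\<lambda>x. \<bar>f x - f' x\<bar>)" "integrable L (\<lambda>x. \<bar>g x - g' x\<bar>)"
      using assms f' g' L by (auto intro!: abs_diff_integrable dest: approx_bdd bdd_trig)
    have "(\<integral>x. \<bar>f x * g x - f' x * g' x\<bar> \<partial>L) \<le>
        (\<integral>x. D * \<bar>f x - f' x\<bar> + C * \<bar>g x - g' x\<bar> \<partial>L)"
    proof (rule integral_mono)
      show "integrable L (\<lambda>x. \<bar>f x * g x - f' x * g' x\<bar>)"
        using assms f' g' L by (intro bdd_integrable bdd_abs bdd_diff bdd_mult bdd_trig approx_bdd)
      fix x
      have "\<bar>f x * g x - f' x * g' x\<bar> = \<bar>g x * (f x - f' x) + f' x * (g x - g' x)\<bar>"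
        by (simp add: algebra_simps)
      also have "\<dots> \<le> \<bar>g x\<bar> * \<bar>f x - f' x\<bar> + \<bar>f' x\<bar> * \<bar>g x - g' x\<bar>"
        by (metis abs_mult abs_triangle_ineq)
      also have "\<dots> \<le> D * \<bar>f x - f' x\<bar> + C * \<bar>g x - g' x\<bar>"
        using C D by (intro add_mono mult_right_mono) auto
      finally show "\<bar>f x * g x - f' x * g' x\<bar> \<le> D * \<bar>f x - f' x\<bar> + C * \<bar>g x - g' x\<bar>" .
    qed (use int in simp)
    also have "\<dots> = D * (\<integral>x. \<bar>f x - f' x\<bar> \<partial>L) + C * (\<integral>x. \<bar>g x - g' x\<bar> \<partial>L)"
      using int by simp
    also have "\<dots> \<le> D * (e / 2 / (D + 1)) + C * (e / 2 / (C + 1))"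
      using f'(2)[OF L] g'(2)[OF L] C0 D0 by (intro add_mono mult_left_mono) auto
    also have "\<dots> < e / 2 + e / 2"
      using C0 D0 \<open>e > 0\<close> by (intro add_strict_mono) (simp_all add: field_simps)
    finally show "(\<integral>x. \<bar>f x * g x - f' x * g' x\<bar> \<partial>L) < e" by simp
  qed
qed

lemma approx_lim:
  assumes "\<And>n. approx (f n)" "\<And>n x. \<bar>f n x\<bar> \<le> C" "\<And>x. (\<lambda>n. f n x) \<longlonglongrightarrow> h x"
  shows "approx h"
  unfolding approx_def
proof (intro conjI allI impI)
  have fm: "f n \<in> borel_measurable K" for n using assms(1) by (simp add: approx_def bdd_def)
  have "\<bar>h x\<bar> \<le> C" for x
    using tendsto_rabs[OF assms(3)] by (rule LIMSEQ_le_const2) (use assms(2) in auto)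
  then show h: "bdd h"
    unfolding bdd_def using borel_measurable_LIMSEQ_real[OF assms(3) fm] by auto
  fix e :: real assume "e > 0"
  have "\<forall>\<^sub>F n in sequentially. (\<integral>x. \<bar>h x - f n x\<bar> \<partial>L) < e / 2" if L: "L \<in> LL" for L
  proof -
    interpret prob_space L using L by (rule prob)
    have "(\<lambda>n. \<integral>x. \<bar>h x - f n x\<bar> \<partial>L) \<longlonglongrightarrow> (\<integral>x. 0 \<partial>L)"
    proof (rule integral_dominated_convergence[where w="\<lambda>_. 2 * C"])
      show "AE x in L. (\<lambda>n. \<bar>h x - f n x\<bar>) \<longlonglongrightarrow> 0"
        using assms(3) by (auto intro!: AE_I2 tendsto_eq_intros)
      show "AE x in L. norm \<bar>h x - f n x\<bar> \<le> 2 * C" for n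
      proof (rule AE_I2)
        fix x
        show "norm \<bar>h x - f n x\<bar> \<le> 2 * C"
          using assms(2)[of n x] \<open>\<bar>h x\<bar> \<le> C\<close> by simp
      qed
      show "(\<lambda>x. \<bar>h x - f n x\<bar>) \<in> borel_measurable L" for n
        unfolding meas_L[OF L] using fm h[unfolded bdd_def, THEN conjunct1] by measurable
    qed auto
    then show ?thesis using \<open>e > 0\<close> by (auto dest!: order_tendstoD(2)[of _ _ _ "e / 2"])
  qed
  then have "\<forall>\<^sub>F n in sequentially. \<forall>L\<in>LL. (\<integral>x. \<bar>h x - f n x\<bar> \<partial>L) < e / 2"
    using finite_LL by (intro eventually_ball_finite) auto
  then obtain n where n: "\<And>L. L \<in> LL \<Longrightarrow> (\<integral>x. \<bar>h x - f n x\<bar> \<partial>L) < e / 2"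
    by (auto simp: eventually_sequentially)
  obtain g where g: "g \<in> trig V" "\<And>L. L \<in> LL \<Longrightarrow> (\<integral>x. \<bar>f n x - g x\<bar> \<partial>L) < e / 2"
    using assms(1)[of n] half_gt_zero[OF \<open>e > 0\<close>] unfolding approx_def by blast
  show "\<exists>g\<in>trig V. \<forall>L\<in>LL. (\<integral>x. \<bar>h x - g x\<bar> \<partial>L) < e"
  proof (intro bexI ballI)
    fix L assume L: "L \<in> LL"
    have int: "integrable L (\<lambda>x. \<bar>h x - f n x\<bar>)" "integrable L (\<lambda>x. \<bar>f n x - g x\<bar>)"
      "integrable L (\<lambda>x. \<bar>h x - g x\<bar>)"
      using assms(1)[of n] h g L by (auto intro!: abs_diff_integrable dest: approx_bdd bdd_trig)
    have "(\<integral>x. \<bar>h x - g x\<bar> \<partial>L) \<le> (\<integral>x. \<bar>h x - f n x\<bar> + \<bar>f n x - g x\<bar> \<partial>L)"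
      using int by (intro integral_mono) auto
    also have "\<dots> < e" using int n[OF L] g(2)[OF L] by simp
    finally show "(\<integral>x. \<bar>h x - g x\<bar> \<partial>L) < e" .
  qed (rule g)
qed

lemma approx_const: "approx (\<lambda>_. c)"
proof -
  have "(\<lambda>_. 0) \<in> V" using V_lin by (simp add: lin_closed_def)
  then have "(\<lambda>x. c * cos (0 + 0)) \<in> trig V" by (intro trig_cmult trig_cos)
  then show ?thesis using approx_trig by simp
qed

lemma approx_polynomial: "real_polynomial_function p \<Longrightarrow> approx u \<Longrightarrow> approx (\<lambda>x. p (u x))"
proof (induction rule: real_polynomial_function.induct)
  case (linear p)
  have "approx (\<lambda>x. u x * p 1)" by (intro approx_mult linear.prems approx_const)
  moreover have "p (u x) = u x * p 1" for x
    using linear_cmul[OF bounded_linear.linear[OF linear.hyps], of "u x" 1] by simp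
  ultimately show ?case by simp
next
  case (add f g)
  then show ?case using approx_lin[of "\<lambda>x. f (u x)" "\<lambda>x. g (u x)" 1 1] by simp
qed (auto intro: approx_const approx_mult)

lemma approx_continuous:
  fixes h :: "real \<Rightarrow> real"
  assumes h: "continuous_on {-1..1} h" and u: "approx u" "\<And>x. \<bar>u x\<bar> \<le> 1"
  shows "approx (\<lambda>x. h (u x))"
proof -
  have "\<exists>p. real_polynomial_function p \<and> (\<forall>t\<in>{-1..1}. \<bar>h t - p t\<bar> < 1 / real (Suc n))" for n
    using Stone_Weierstrass_real_polynomial_function[of "{-1..1}" h "1 / real (Suc n)"] h
    by (metis compact_Icc of_nat_0_less_iff zero_less_Suc zero_less_divide_1_iff)
  then obtain p where p: "\<And>n. real_polynomial_function (p n)"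
    "\<And>n t. t \<in> {-1..1} \<Longrightarrow> \<bar>h t - p n t\<bar> < 1 / real (Suc n)" by metis
  obtain B where B: "\<And>t. t \<in> {-1..1} \<Longrightarrow> \<bar>h t\<bar> \<le> B"
    using compact_imp_bounded[OF compact_continuous_image[OF h compact_Icc]]
    unfolding bounded_iff by (metis imageI real_norm_def)
  have ux: "u x \<in> {-1..1}" for x using u(2)[of x] by (simp add: abs_le_iff)
  show ?thesis
  proof (rule approx_lim)
    show "approx (\<lambda>x. p n (u x))" for n by (rule approx_polynomial[OF p(1) u(1)])
    show "\<bar>p n (u x)\<bar> \<le> B + 1" for n x
    proof -
      have "1 / real (Suc n) \<le> 1" by simp
      then show ?thesis using B[OF ux[of x]] p(2)[OF ux[of x], of n] by linarith
    qed
    show "(\<lambda>n. p n (u x)) \<longlonglongrightarrow> h (u x)" for x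
    proof (rule LIM_zero_cancel, rule Lim_null_comparison[OF _ LIMSEQ_inverse_real_of_nat], rule always_eventually, rule allI)
      show "norm (p n (u x) - h (u x)) \<le> inverse (real (Suc n))" for n
        using p(2)[OF ux[of x], of n] by (simp add: inverse_eq_divide abs_minus_commute)
    qed
  qed
qed

lemma approx_positive:
  assumes u: "approx u" "\<And>x. \<bar>u x\<bar> \<le> 1"
  shows "approx (\<lambda>x. if 0 < u x then 1 else 0)"
proof (rule approx_lim)
  let ?h = "\<lambda>n t. min 1 (max 0 (real n * t))"
  show "approx (\<lambda>x. ?h n (u x))" for n
    by (intro approx_continuous[of "?h n"] u continuous_intros)
  show "\<bar>?h n (u x)\<bar> \<le> 1" for n x by simp
  show "(\<lambda>n. ?h n (u x)) \<longlonglongrightarrow> (if 0 < u x then 1 else 0)" for x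
  proof (cases "0 < u x")
    case True
    obtain n0 :: nat where n0: "1 / u x < real n0" using reals_Archimedean2 by blast
    have "\<forall>\<^sub>F n in sequentially. ?h n (u x) = 1"
      using eventually_ge_at_top[of n0]
    proof eventually_elim
      case (elim n)
      have "1 / u x < real n" using n0 elim by simp
      then have "1 < real n * u x" using True by (simp add: divide_less_eq)
      then show ?case by simp
    qed
    then show ?thesis using True by (simp add: tendsto_eventually)
  next
    case False
    then have "?h n (u x) = 0" for n by (simp add: mult_nonneg_nonpos)
    then show ?thesis using False by simp
  qed
qed

text \<open>As \<open>n\<close> grows, \<open>(Y - t) / n\<close> enters the interval on which the sign of
the sine is the sign of its argument. Thus half spaces are pointwise limits of sets \<open>{x.
sin ((Y x - t) / n) > 0}\<close>, to which the preceding lemma applies.\<close>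

lemma approx_half_space:
  assumes Y: "Y \<in> V"
  shows "approx (indicator {x. Y x > t})"
proof (rule approx_lim)
  let ?u = "\<lambda>n x. sin ((Y x - t) / real (Suc n))"
  show "approx (\<lambda>x. if 0 < ?u n x then 1 else 0)" for n
  proof (rule approx_positive)
    have "(\<lambda>x. 1 / real (Suc n) * Y x + 0 * Y x) \<in> V"
      using V_lin Y unfolding lin_closed_def by blast
    then have "(\<lambda>x. cos ((1 / real (Suc n) * Y x + 0 * Y x) + (- t / real (Suc n) - pi / 2))) \<in> trig V"
      by (rule trig_cos)
    moreover have "cos ((1 / real (Suc n) * Y x + 0 * Y x) + (- t / real (Suc n) - pi / 2)) = ?u n x" for x
      unfolding sin_cos_eq by (subst cos_minus[symmetric]) (simp add: diff_divide_distrib algebra_simps)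
    ultimately show "approx (?u n)" using approx_trig by simp
  qed simp
  show "\<bar>if 0 < ?u n x then 1 else 0\<bar> \<le> (1::real)" for n x by simp
  show "(\<lambda>n. if 0 < ?u n x then 1 else 0) \<longlonglongrightarrow> (indicator {x. Y x > t} x :: real)" for x
  proof (rule tendsto_eventually)
    have "(\<lambda>n. (Y x - t) / real (Suc n)) \<longlonglongrightarrow> 0"
      using LIMSEQ_Suc[OF lim_const_over_n] .
    then have "\<forall>\<^sub>F n in sequentially. \<bar>(Y x - t) / real (Suc n)\<bar> < pi"
      by (intro order_tendstoD(2)[OF tendsto_rabs_zero]) auto
    then show "\<forall>\<^sub>F n in sequentially. (if 0 < ?u n x then 1 else 0) = (indicator {x. Y x > t} x :: real)"
    proof eventually_elim
      case (elim n)
      show ?case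
      proof (cases "Y x > t")
        case True
        then have "0 < ?u n x" using elim by (intro sin_gt_zero) auto
        with True show ?thesis by simp
      next
        case False
        then have "(Y x - t) / real (Suc n) \<le> 0" by (intro divide_nonpos_pos) auto
        then have "0 \<le> sin (- ((Y x - t) / real (Suc n)))"
          using elim by (intro sin_ge_zero) linarith+
        then have "\<not> 0 < ?u n x" by (simp only: sin_minus)
        with False show ?thesis by simp
      qed
    qed
  qed
qed

text \<open>Sets with approximable indicator functions are closed under complements and, by products and
limits, under countable unions; they contain the half spaces, which generate.\<close>

theorem trig_dense:
  assumes "A \<in> sets K" "e > 0"
  obtains g where "g \<in> trig V" "\<And>L. L \<in> LL \<Longrightarrow> (\<integral>x. \<bar>indicator A x - g x\<bar> \<partial>L) < e"
proof -
  have "A \<in> sigma_sets UNIV {{x. Y x > t} |Y t. Y \<in> V}" using assms(1) gen by blast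
  then have "approx (indicator A)"
  proof (induction rule: sigma_sets.induct)
    case (Basic a)
    then show ?case using approx_half_space by auto
  next
    case Empty
    then show ?case using approx_const[of 0] by (simp add: indicator_def[abs_def])
  next
    case (Compl a)
    have "approx (\<lambda>x. 1 * 1 + - 1 * indicator a x)"
      by (intro approx_lin approx_const Compl.IH)
    moreover have "1 * 1 + - 1 * indicator a x = (indicator (UNIV - a) x :: real)" for x
      by (simp add: indicator_def)
    ultimately show ?case by simp
  next
    case (Union a)
    have fin: "approx (indicator (\<Union>i<n. a i))" for n :: nat
    proof (induction n)
      case 0
      then show ?case using approx_const[of 0] by (simp add: indicator_def[abs_def])
    next
      case (Suc n)
      let ?U = "indicator (\<Union>i<n. a i) :: _ \<Rightarrow> real"
      have "approx (\<lambda>x. 1 * ?U x + 1 * (1 * indicator (a n) x + - 1 * (?U x * indicator (a n) x)))"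
        by (intro approx_lin approx_mult Suc Union.IH)
      moreover have "1 * ?U x + 1 * (1 * indicator (a n) x + - 1 * (?U x * indicator (a n) x))
          = indicator (\<Union>i<Suc n. a i) x" for x
        by (auto simp: indicator_def lessThan_Suc)
      ultimately show ?case by simp
    qed
    show ?case
    proof (rule approx_lim[OF fin, where C = 1])
      show "(\<lambda>n. indicator (\<Union>i<n. a i) x) \<longlonglongrightarrow> (indicator (\<Union>i. a i) x :: real)" for x
        by (rule LIMSEQ_indicator_UN)
    qed (simp add: indicator_def)
  qed
  then show thesis using that assms(2) unfolding approx_def by blast
qed

end

section \<open>Systems generated by a Gaussian space\<close>

text \<open>Linear spaces of centred normal random variables. Normality is stated through the characteristic
function, whose real form with a phase \<open>b\<close> avoids complex exponentials.\<close>

definition gauss_space :: "'x measure \<Rightarrow> ('x \<Rightarrow> real) set \<Rightarrow> bool" where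
  "gauss_space K V \<longleftrightarrow> prob_space K \<and> V \<subseteq> borel_measurable K \<and> lin_closed V \<and>
     (\<forall>Y\<in>V. integrable K (\<lambda>x. (Y x)\<^sup>2) \<and> (\<integral>x. Y x \<partial>K) = 0 \<and>
        (\<forall>b. (\<integral>x. cos (Y x + b) \<partial>K) = cos b * exp (- (\<integral>x. (Y x)\<^sup>2 \<partial>K) / 2)))"

lemma gauss_space_distr:
  assumes P: "gauss_space P W" and Phi: "Phi \<in> measurable P K" and V: "V \<subseteq> borel_measurable K" "lin_closed V"
    and VW: "\<And>Y. Y \<in> V \<Longrightarrow> (\<lambda>w. Y (Phi w)) \<in> W"
  shows "gauss_space (distr P K Phi) V"
  unfolding gauss_space_def
proof (intro conjI ballI allI)
  interpret prob_space P using P by (simp add: gauss_space_def)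
  show "prob_space (distr P K Phi)" using Phi by (rule prob_space_distr)
  show "V \<subseteq> borel_measurable (distr P K Phi)" "lin_closed V" using V by auto
  fix Y b assume Y: "Y \<in> V"
  then have m: "Y \<in> borel_measurable K" using V by auto
  show "integrable (distr P K Phi) (\<lambda>x. (Y x)\<^sup>2)"
    using P VW[OF Y] m Phi by (subst integrable_distr_eq) (auto simp: gauss_space_def)
  show "(\<integral>x. Y x \<partial>distr P K Phi) = 0"
    using P VW[OF Y] m Phi by (subst integral_distr) (auto simp: gauss_space_def)
  show "(\<integral>x. cos (Y x + b) \<partial>distr P K Phi) = cos b * exp (- (\<integral>x. (Y x)\<^sup>2 \<partial>distr P K Phi) / 2)"
    using P VW[OF Y] m Phi by (subst (1 2) integral_distr) (auto simp: gauss_space_def)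
qed

lemma (in prob_space) square_integrableD:
  assumes "f \<in> borel_measurable M" "integrable M (\<lambda>x. (f x)\<^sup>2)"
  shows "integrable M (f :: 'a \<Rightarrow> real)"
  by (rule square_integrable_imp_integrable) (use assms in auto)

lemma (in prob_space) mult_integrable:
  assumes "f \<in> borel_measurable M" "integrable M (\<lambda>x. (f x)\<^sup>2)"
    and "g \<in> borel_measurable M" "integrable M (\<lambda>x. (g x)\<^sup>2)"
  shows "integrable M (\<lambda>x. f x * g x :: real)"
proof (rule Bochner_Integration.integrable_bound)
  show "integrable M (\<lambda>x. (f x)\<^sup>2 + (g x)\<^sup>2)" using assms by simp
  have "\<bar>f x * g x\<bar> \<le> (f x)\<^sup>2 + (g x)\<^sup>2" for x
    using sum_squares_bound[of "\<bar>f x\<bar>" "\<bar>g x\<bar>"] mult_nonneg_nonneg[of "\<bar>f x\<bar>" "\<bar>g x\<bar>"]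
    unfolding abs_mult by (simp only: power2_abs) linarith
  then show "AE x in M. norm (f x * g x) \<le> norm ((f x)\<^sup>2 + (g x)\<^sup>2)" by simp
qed (use assms in simp)

lemma (in prob_space) abs_integral_le_L2:
  fixes f :: "'a \<Rightarrow> real"
  assumes "f \<in> borel_measurable M" "integrable M (\<lambda>x. (f x)\<^sup>2)"
  shows "(\<integral>x. \<bar>f x\<bar> \<partial>M) \<le> sqrt (\<integral>x. (f x)\<^sup>2 \<partial>M)"
proof -
  have "0 \<le> variance (\<lambda>x. \<bar>f x\<bar>)" by simp
  also have "\<dots> = (\<integral>x. (f x)\<^sup>2 \<partial>M) - (\<integral>x. \<bar>f x\<bar> \<partial>M)\<^sup>2"
    using assms square_integrableD[OF assms] by (subst variance_eq) auto
  finally show ?thesis by (intro real_le_rsqrt) simp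
qed

locale gaussian_system = prob_space K for K :: "'x measure" +
  fixes V :: "('x \<Rightarrow> real) set"
  assumes gauss: "gauss_space K V"
    and space_K: "space K = UNIV"
    and gen: "sets K \<subseteq> sigma_sets UNIV {{x. Y x > t} |Y t. Y \<in> V}"
begin

lemma V_meas [measurable]: "Y \<in> V \<Longrightarrow> Y \<in> borel_measurable K"
  and V_sq: "Y \<in> V \<Longrightarrow> integrable K (\<lambda>x. (Y x)\<^sup>2)"
  and V_mean: "Y \<in> V \<Longrightarrow> (\<integral>x. Y x \<partial>K) = 0"
  and V_cos: "Y \<in> V \<Longrightarrow> (\<integral>x. cos (Y x + b) \<partial>K) = cos b * exp (- (\<integral>x. (Y x)\<^sup>2 \<partial>K) / 2)"
  using gauss by (auto simp: gauss_space_def)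

lemma V_lin: "Y \<in> V \<Longrightarrow> Z \<in> V \<Longrightarrow> (\<lambda>x. c * Y x + d * Z x) \<in> V"
proof -
  assume "Y \<in> V" "Z \<in> V"
  moreover have "lin_closed V" using gauss by (simp add: gauss_space_def)
  ultimately show ?thesis unfolding lin_closed_def by (elim conjE) (erule ballE, erule ballE, erule allE, erule allE, assumption, simp_all)
qed

lemma density_finite:
  assumes "finite LL" "\<And>L. L \<in> LL \<Longrightarrow> prob_space L \<and> sets L = sets K"
  shows "trig_density K LL V"
proof (rule trig_density.intro)
  show "V \<subseteq> borel_measurable K" "lin_closed V" using gauss by (simp_all add: gauss_space_def)
  show "prob_space L" "sets L = sets K" if "L \<in> LL" for L
    using assms(2)[OF that] by simp_all
qed (fact assms(1) space_K gen)+

lemma trig_meas [measurable]: "g \<in> trig V \<Longrightarrow> g \<in> borel_measurable K"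
  using gauss by (auto simp: gauss_space_def intro: trig_measurable)

lemma trig_comp_integrable:
  assumes "g \<in> trig V" and T[measurable]: "T \<in> measurable K K"
  shows "integrable K (\<lambda>x. g (T x))"
proof -
  obtain C where "\<And>x. \<bar>g x\<bar> \<le> C" using trig_bounded assms(1) by blast
  moreover have [measurable]: "g \<in> borel_measurable K" using assms by (intro trig_meas)
  ultimately show ?thesis by (intro integrable_const_bound[where B = C]) auto
qed

text \<open>A measure and its image give the same integrals to \<open>cos (Y + b)\<close>, as these depend
on the variance of \<open>Y\<close> only; they coincide by density.\<close>

lemma covariance_preserving_imp_measure_preserving:
  assumes T[measurable]: "T \<in> measurable K K"
    and TV: "\<And>Y. Y \<in> V \<Longrightarrow> (\<lambda>x. Y (T x)) \<in> V"
    and Tq: "\<And>Y. Y \<in> V \<Longrightarrow> (\<integral>x. (Y (T x))\<^sup>2 \<partial>K) = (\<integral>x. (Y x)\<^sup>2 \<partial>K)"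
  shows "distr K K T = K"
proof (rule measure_eqI)
  show "sets (distr K K T) = sets K" by simp
  fix A assume "A \<in> sets (distr K K T)"
  then have A: "A \<in> sets K" by simp
  interpret T: prob_space "distr K K T" by (rule prob_space_distr) simp
  interpret trig_density K "{K, distr K K T}" V
    using prob_space_axioms T.prob_space_axioms by (intro density_finite) (simp, elim insertE, simp_all)
  have trig_eq: "(\<integral>x. g (T x) \<partial>K) = (\<integral>x. g x \<partial>K)" if "g \<in> trig V" for g
    using that
  proof (induction rule: trig.induct)
    case (add f Y c b)
    have int: "integrable K (\<lambda>x. c * cos (Y (T x) + b))" "integrable K (\<lambda>x. f (T x))"
      "integrable K (\<lambda>x. c * cos (Y x + b))" "integrable K f"
      using add.hyps trig_comp_integrable[OF add.hyps(1) T] trig_comp_integrable[OF add.hyps(1), of "\<lambda>x. x"]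
        trig_comp_integrable[OF trig_cos[OF add.hyps(2)] T] trig_comp_integrable[OF trig_cos[OF add.hyps(2)], of "\<lambda>x. x"]
      by auto
    show ?case using int add.IH V_cos[OF add.hyps(2)] V_cos[OF TV[OF add.hyps(2)]] Tq[OF add.hyps(2)]
      by simp
  qed simp
  have "\<bar>T.prob A - prob A\<bar> < e" if "e > 0" for e
  proof -
    obtain g where g: "g \<in> trig V"
      "\<And>L. L \<in> {K, distr K K T} \<Longrightarrow> (\<integral>x. \<bar>indicator A x - g x\<bar> \<partial>L) < e / 2"
      using trig_dense[OF A, of "e / 2"] \<open>e > 0\<close> by auto
    have close: "\<bar>measure L A - (\<integral>x. g x \<partial>L)\<bar> < e / 2" if L: "L \<in> {K, distr K K T}" for L
    proof -
      interpret L: prob_space L using L prob by blast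
      have int: "integrable L g" "integrable L (indicator A :: _ \<Rightarrow> real)"
        using L g(1) A bdd_integrable[OF bdd_trig] by (auto simp: less_top[symmetric])
      have "measure L A - (\<integral>x. g x \<partial>L) = (\<integral>x. indicator A x - g x \<partial>L)"
        using int L A by auto
      also have "\<bar>\<dots>\<bar> \<le> (\<integral>x. \<bar>indicator A x - g x\<bar> \<partial>L)" by (rule integral_abs_bound)
      finally show ?thesis using g(2)[OF L] by simp
    qed
    have "(\<integral>x. g x \<partial>distr K K T) = (\<integral>x. g x \<partial>K)"
      using trig_eq[OF g(1)] g(1) by (subst integral_distr) auto
    with close[OF insertI1] close[OF insertI2[OF insertI1]] show ?thesis
      by (smt (verit) field_sum_of_halves)
  qed
  then have "T.prob A = prob A"
    by (metis abs_le_zero_iff dense_ge eq_iff_diff_eq_0 less_imp_le)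
  then show "emeasure (distr K K T) A = emeasure K A"
    by (simp add: T.emeasure_eq_measure emeasure_eq_measure)
qed

lemma integral_preserved:
  assumes T[measurable]: "T \<in> measurable K K" and pres: "distr K K T = K"
    and f: "f \<in> borel_measurable K"
  shows "(\<integral>x. f (T x) \<partial>K) = (\<integral>x. (f x :: real) \<partial>K)"
  using integral_distr[OF T f] by (simp add: pres)

text \<open>The cosine is Lipschitz, so trigonometric polynomials are moved little in the mean. Density and
the invariance of the measure carry this over to sets.\<close>

lemma L2_convergence_imp_rigid:
  assumes T: "\<And>l. T l \<in> measurable K K" and pres: "\<And>l. distr K K (T l) = K"
    and TV: "\<And>Y l. Y \<in> V \<Longrightarrow> (\<lambda>x. Y (T l x)) \<in> V"
    and lim: "\<And>Y. Y \<in> V \<Longrightarrow> (\<lambda>l. \<integral>x. (Y (T l x) - Y x)\<^sup>2 \<partial>K) \<longlonglongrightarrow> 0"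
    and A: "A \<in> sets K"
  shows "(\<lambda>l. measure K (sym_diff (T l -` A) A)) \<longlonglongrightarrow> 0"
proof -
  note T[measurable] A[measurable]
  have trig_lim: "(\<lambda>l. \<integral>x. \<bar>g (T l x) - g x\<bar> \<partial>K) \<longlonglongrightarrow> 0" if "g \<in> trig V" for g
    using that
  proof (induction rule: trig.induct)
    case (add f Y c b)
    have [measurable]: "f \<in> borel_measurable K" "Y \<in> borel_measurable K" using add.hyps by auto
    let ?B = "\<lambda>l. \<bar>c\<bar> * sqrt (\<integral>x. (Y (T l x) - Y x)\<^sup>2 \<partial>K) + (\<integral>x. \<bar>f (T l x) - f x\<bar> \<partial>K)"
    have le: "(\<integral>x. \<bar>c * cos (Y (T l x) + b) + f (T l x) - (c * cos (Y x + b) + f x)\<bar> \<partial>K) \<le> ?B l" for l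
    proof -
      have D: "(\<lambda>x. 1 * Y (T l x) + - 1 * Y x) \<in> V" by (rule V_lin[OF TV[OF add.hyps(2)] add.hyps(2)])
      have Ds: "integrable K (\<lambda>x. (Y (T l x) - Y x)\<^sup>2)" using V_sq[OF D] by simp
      then have Di: "integrable K (\<lambda>x. \<bar>Y (T l x) - Y x\<bar>)"
        using square_integrableD[of "\<lambda>x. Y (T l x) - Y x"] by simp
      have fi: "integrable K (\<lambda>x. \<bar>f (T l x) - f x\<bar>)"
        using trig_comp_integrable[OF add.hyps(1) T[of l]] trig_comp_integrable[OF add.hyps(1), of "\<lambda>x. x"] by simp
      have ci: "integrable K (\<lambda>x. \<bar>c * cos (Y (T l x) + b) + f (T l x) - (c * cos (Y x + b) + f x)\<bar>)"
        using trig_comp_integrable[OF trig.add[OF add.hyps, of c b] T[of l]]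
          trig_comp_integrable[OF trig.add[OF add.hyps, of c b], of "\<lambda>x. x"] by simp
      have "(\<integral>x. \<bar>c * cos (Y (T l x) + b) + f (T l x) - (c * cos (Y x + b) + f x)\<bar> \<partial>K)
          \<le> (\<integral>x. \<bar>c\<bar> * \<bar>Y (T l x) - Y x\<bar> + \<bar>f (T l x) - f x\<bar> \<partial>K)"
      proof (rule integral_mono[OF ci])
        fix x
        have lip: "\<bar>cos u - cos v\<bar> \<le> \<bar>u - v\<bar>" for u v :: real
        proof -
          have "\<bar>cos u - cos v\<bar> = 2 * (\<bar>sin ((u + v) / 2)\<bar> * \<bar>sin ((v - u) / 2)\<bar>)"
            by (simp add: cos_diff_cos abs_mult)
          also have "\<dots> \<le> 2 * (1 * \<bar>(v - u) / 2\<bar>)"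
            by (intro mult_left_mono mult_mono abs_sin_le_one abs_sin_x_le_abs_x) auto
          finally show ?thesis by (simp add: abs_minus_commute)
        qed
        have "\<bar>c * cos (Y (T l x) + b) + f (T l x) - (c * cos (Y x + b) + f x)\<bar>
          = \<bar>c * (cos (Y (T l x) + b) - cos (Y x + b)) + (f (T l x) - f x)\<bar>" by (simp add: algebra_simps)
        also have "\<dots> \<le> \<bar>c\<bar> * \<bar>cos (Y (T l x) + b) - cos (Y x + b)\<bar> + \<bar>f (T l x) - f x\<bar>"
          by (metis abs_mult abs_triangle_ineq)
        also have "\<dots> \<le> \<bar>c\<bar> * \<bar>Y (T l x) - Y x\<bar> + \<bar>f (T l x) - f x\<bar>"
          using lip[of "Y (T l x) + b" "Y x + b"] by (intro add_right_mono mult_left_mono) auto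
        finally show "\<bar>c * cos (Y (T l x) + b) + f (T l x) - (c * cos (Y x + b) + f x)\<bar>
          \<le> \<bar>c\<bar> * \<bar>Y (T l x) - Y x\<bar> + \<bar>f (T l x) - f x\<bar>" .
      qed (use Di fi in simp)
      also have "\<dots> = \<bar>c\<bar> * (\<integral>x. \<bar>Y (T l x) - Y x\<bar> \<partial>K) + (\<integral>x. \<bar>f (T l x) - f x\<bar> \<partial>K)"
        using Di fi by simp
      also have "\<dots> \<le> ?B l"
        using Ds by (intro add_right_mono mult_left_mono abs_integral_le_L2) auto
      finally show ?thesis .
    qed
    have "?B \<longlonglongrightarrow> \<bar>c\<bar> * sqrt 0 + 0"
      using lim[OF add.hyps(2)] add.IH by (intro tendsto_intros)
    then have B: "?B \<longlonglongrightarrow> 0" by simp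
    show ?case
    proof (rule Lim_null_comparison[OF always_eventually B], rule allI)
      fix l
      have "0 \<le> (\<integral>x. \<bar>c * cos (Y (T l x) + b) + f (T l x) - (c * cos (Y x + b) + f x)\<bar> \<partial>K)" by simp
      with le[of l]
      show "norm (\<integral>x. \<bar>c * cos (Y (T l x) + b) + f (T l x) - (c * cos (Y x + b) + f x)\<bar> \<partial>K) \<le> ?B l"
        by (simp only: real_norm_def abs_of_nonneg)
    qed
  qed simp
  interpret trig_density K "{K}" V
    using prob_space_axioms by (intro density_finite; simp)
  show ?thesis
  proof (rule tendstoI)
    fix e :: real assume "e > 0"
    then obtain g where g: "g \<in> trig V" "(\<integral>x. \<bar>indicator A x - g x\<bar> \<partial>K) < e / 3"
      using trig_dense[OF A, of "e / 3"] by auto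
    have [measurable]: "g \<in> borel_measurable K" using g by auto
    have ind: "integrable K (indicator A :: _ \<Rightarrow> real)" by (simp add: less_top[symmetric])
    have gi: "integrable K (\<lambda>x. g (T l x))" "integrable K g" for l
      using trig_comp_integrable[OF g(1) T[of l]] trig_comp_integrable[OF g(1), of "\<lambda>x. x"] by auto
    have "\<forall>\<^sub>F l in sequentially. (\<integral>x. \<bar>g (T l x) - g x\<bar> \<partial>K) < e / 3"
      using trig_lim[OF g(1)] \<open>e > 0\<close> by (auto dest!: order_tendstoD(2)[of _ _ _ "e / 3"])
    then show "\<forall>\<^sub>F l in sequentially. dist (measure K (sym_diff (T l -` A) A)) 0 < e"
    proof eventually_elim
      case (elim l)
      have indT: "integrable K (\<lambda>x. indicator A (T l x) :: real)"
        by (intro integrable_const_bound[where B = 1]) auto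
      have [measurable]: "T l -` A \<in> sets K" using measurable_sets[OF T[of l] A] by (simp add: space_K)
      have "measure K (sym_diff (T l -` A) A) = (\<integral>x. indicator (sym_diff (T l -` A) A) x \<partial>K)" by simp
      also have "\<dots> = (\<integral>x. \<bar>indicator A (T l x) - indicator A x\<bar> \<partial>K)"
        by (intro Bochner_Integration.integral_cong) (auto simp: indicator_def)
      also have "\<dots> \<le> (\<integral>x. \<bar>indicator A (T l x) - g (T l x)\<bar> + \<bar>g (T l x) - g x\<bar> + \<bar>indicator A x - g x\<bar> \<partial>K)"
        using ind indT gi(1)[of l] gi(2) by (intro integral_mono) auto
      also have "\<dots> = (\<integral>x. \<bar>indicator A (T l x) - g (T l x)\<bar> \<partial>K) + (\<integral>x. \<bar>g (T l x) - g x\<bar> \<partial>K)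
           + (\<integral>x. \<bar>indicator A x - g x\<bar> \<partial>K)"
        using ind indT gi(1)[of l] gi(2) by simp
      also have "(\<integral>x. \<bar>indicator A (T l x) - g (T l x)\<bar> \<partial>K) = (\<integral>x. \<bar>indicator A x - g x\<bar> \<partial>K)"
        by (rule integral_preserved[OF T pres]) auto
      finally show ?case using g(2) elim by simp
    qed
  qed
qed

text \<open>The product \<open>cos (Y + b) * cos (Z + d)\<close> is a sum of cosines of linear forms whose
variances are those of independent \<open>Y\<close> and \<open>Z\<close> up to twice the
covariance. If the covariances of \<open>Y\<close> after time \<open>n i\<close> with
\<open>Z\<close> vanish in the limit, trigonometric polynomials become independent, and by
density an invariant set becomes independent of itself, that is \<open>p = p * p\<close> for its
measure \<open>p\<close>.\<close>

lemma decorrelation_imp_ergodic: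
  assumes T: "T \<in> measurable K K" and pres: "distr K K T = K"
    and TV: "\<And>Y. Y \<in> V \<Longrightarrow> (\<lambda>x. Y (T x)) \<in> V"
    and decor: "\<And>Y Z. Y \<in> V \<Longrightarrow> Z \<in> V \<Longrightarrow>
        (\<lambda>i. \<integral>x. Y ((T ^^ n i) x) * Z x \<partial>K) \<longlonglongrightarrow> 0"
    and A: "A \<in> sets K" and inv: "T -` A = A"
  shows "measure K A = 0 \<or> measure K A = 1"
proof -
  have Tn: "T ^^ k \<in> measurable K K" for k by (induction k) (simp, simp only: funpow.simps, rule measurable_comp[OF _ T])
  note Tn[measurable] A[measurable]
  have presn: "distr K K (T ^^ k) = K" for k
  proof (induction k)
    case (Suc k)
    have "distr K K (T ^^ Suc k) = distr (distr K K (T ^^ k)) K T"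
      using distr_distr[OF T Tn[of k]] by simp
    then show ?case by (simp only: Suc pres)
  qed (simp add: distr_id2)
  have TVn: "(\<lambda>x. Y ((T ^^ k) x)) \<in> V" if "Y \<in> V" for Y k
    using that
  proof (induction k arbitrary: Y)
    case (Suc k)
    then show ?case using Suc.IH[OF TV[OF Suc.prems]] by simp
  qed simp
  have invn: "(T ^^ k) x \<in> A \<longleftrightarrow> x \<in> A" for k x
  proof (induction k)
    case (Suc k)
    then show ?case using inv by auto
  qed simp
  have cos_lim: "(\<lambda>i. \<integral>x. cos (Y ((T ^^ n i) x) + b) * cos (Z x + d) \<partial>K) \<longlonglongrightarrow>
      (\<integral>x. cos (Y x + b) \<partial>K) * (\<integral>x. cos (Z x + d) \<partial>K)" if Y: "Y \<in> V" and Z: "Z \<in> V" for Y Z b d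
  proof -
    note V_meas[OF Y, measurable] V_meas[OF Z, measurable]
    let ?y = "\<integral>x. (Y x)\<^sup>2 \<partial>K" and ?z = "\<integral>x. (Z x)\<^sup>2 \<partial>K"
    let ?c = "\<lambda>i. \<integral>x. Y ((T ^^ n i) x) * Z x \<partial>K"
    have eq: "(\<integral>x. cos (Y ((T ^^ n i) x) + b) * cos (Z x + d) \<partial>K) =
       (cos (b - d) * exp (- (?y + ?z - 2 * ?c i) / 2) + cos (b + d) * exp (- (?y + ?z + 2 * ?c i) / 2)) / 2" for i
    proof -
      define W where "W = (\<lambda>x. Y ((T ^^ n i) x))"
      have W: "W \<in> V" unfolding W_def by (rule TVn[OF Y])
      note V_meas[OF W, measurable]
      have P: "(\<lambda>x. 1 * W x + 1 * Z x) \<in> V" and M: "(\<lambda>x. 1 * W x + - 1 * Z x) \<in> V"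
        by (rule V_lin[OF W Z])+
      have WZ: "integrable K (\<lambda>x. W x * Z x)" using W Z by (intro mult_integrable V_sq) auto
      have w: "(\<integral>x. (W x)\<^sup>2 \<partial>K) = ?y"
        unfolding W_def by (rule integral_preserved[OF Tn presn]) simp
      have "(\<integral>x. (W x + Z x)\<^sup>2 \<partial>K) = (\<integral>x. (W x)\<^sup>2 + (Z x)\<^sup>2 + 2 * (W x * Z x) \<partial>K)"
        by (simp add: power2_sum mult.assoc)
      then have p: "(\<integral>x. (W x + Z x)\<^sup>2 \<partial>K) = ?y + ?z + 2 * ?c i"
        using V_sq[OF W] V_sq[OF Z] WZ w by (simp add: W_def)
      have "(\<integral>x. (W x - Z x)\<^sup>2 \<partial>K) = (\<integral>x. (W x)\<^sup>2 + (Z x)\<^sup>2 - 2 * (W x * Z x) \<partial>K)"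
        by (simp add: power2_diff mult.assoc)
      then have m: "(\<integral>x. (W x - Z x)\<^sup>2 \<partial>K) = ?y + ?z - 2 * ?c i"
        using V_sq[OF W] V_sq[OF Z] WZ w by (simp add: W_def)
      have "cos (W x + b) * cos (Z x + d) = (cos (W x - Z x + (b - d)) + cos (W x + Z x + (b + d))) / 2" for x
        by (simp add: cos_times_cos algebra_simps)
      then have "(\<integral>x. cos (W x + b) * cos (Z x + d) \<partial>K) =
          (\<integral>x. (cos (W x - Z x + (b - d)) + cos (W x + Z x + (b + d))) / 2 \<partial>K)"
        by (intro Bochner_Integration.integral_cong) auto
      also have "\<dots> =
          ((\<integral>x. cos (W x - Z x + (b - d)) \<partial>K) + (\<integral>x. cos (W x + Z x + (b + d)) \<partial>K)) / 2"
        using integrable_const_bound[of "\<lambda>x. cos (W x - Z x + (b - d))" 1]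
          integrable_const_bound[of "\<lambda>x. cos (W x + Z x + (b + d))" 1] by simp
      also have "\<dots> = (cos (b - d) * exp (- (?y + ?z - 2 * ?c i) / 2) + cos (b + d) * exp (- (?y + ?z + 2 * ?c i) / 2)) / 2"
        using V_cos[OF P, of "b + d"] V_cos[OF M, of "b - d"] p m by simp
      finally show ?thesis by (simp add: W_def)
    qed
    have "(\<lambda>i. (cos (b - d) * exp (- (?y + ?z - 2 * ?c i) / 2) + cos (b + d) * exp (- (?y + ?z + 2 * ?c i) / 2)) / 2)
        \<longlonglongrightarrow> (cos (b - d) * exp (- (?y + ?z - 2 * 0) / 2) + cos (b + d) * exp (- (?y + ?z + 2 * 0) / 2)) / 2"
      by (intro tendsto_intros decor Y Z) auto
    also have "(cos (b - d) * exp (- (?y + ?z - 2 * 0) / 2) + cos (b + d) * exp (- (?y + ?z + 2 * 0) / 2)) / 2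
        = (cos b * exp (- ?y / 2)) * (cos d * exp (- ?z / 2))"
    proof -
      have "- (?y + ?z) / 2 = - ?y / 2 + - ?z / 2" by (simp add: field_simps)
      then have e: "exp (- (?y + ?z) / 2) = exp (- ?y / 2) * exp (- ?z / 2)"
        by (simp only: exp_add)
      show ?thesis
        unfolding mult_zero_right diff_zero add_0_right e by (simp add: cos_add cos_diff algebra_simps)
    qed
    finally show ?thesis unfolding eq V_cos[OF Y] V_cos[OF Z] .
  qed
  have bounded_int: "integrable K (\<lambda>x. g ((T ^^ k) x) * h x)" if gh: "g \<in> trig V" "h \<in> trig V" for g h k
  proof -
    obtain C D where CD: "\<And>x. \<bar>g x\<bar> \<le> C" "\<And>x. \<bar>h x\<bar> \<le> D" using gh[THEN trig_bounded] by blast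
    have "\<bar>g ((T ^^ k) x) * h x\<bar> \<le> C * D" for x
      unfolding abs_mult using CD(1)[of "(T ^^ k) x"] CD(2)[of x] by (intro mult_mono) auto
    then show ?thesis using that by (intro integrable_const_bound[where B = "C * D"]) auto
  qed
  have trig_int: "integrable K g" if "g \<in> trig V" for g
    using trig_comp_integrable[OF that, of "\<lambda>x. x"] by simp
  have trig_lim: "(\<lambda>i. \<integral>x. g ((T ^^ n i) x) * h x \<partial>K) \<longlonglongrightarrow> (\<integral>x. g x \<partial>K) * (\<integral>x. h x \<partial>K)"
    if g: "g \<in> trig V" and h: "h \<in> trig V" for g h
    using g
  proof (induction rule: trig.induct)
    case (add f Y c b)
    have cosY: "(\<lambda>x. cos (Y x + b)) \<in> trig V" using add.hyps by (intro trig_cos)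
    have one: "(\<lambda>i. \<integral>x. cos (Y ((T ^^ n i) x) + b) * h x \<partial>K) \<longlonglongrightarrow> (\<integral>x. cos (Y x + b) \<partial>K) * (\<integral>x. h x \<partial>K)"
      using h
    proof (induction rule: trig.induct)
      case (add f' Z c' b')
      have cosZ: "(\<lambda>x. cos (Z x + b')) \<in> trig V" using add.hyps by (intro trig_cos)
      have "(\<integral>x. cos (Y ((T ^^ n i) x) + b) * (c' * cos (Z x + b') + f' x) \<partial>K) =
          c' * (\<integral>x. cos (Y ((T ^^ n i) x) + b) * cos (Z x + b') \<partial>K) +
          (\<integral>x. cos (Y ((T ^^ n i) x) + b) * f' x \<partial>K)" for i
        using bounded_int[OF cosY cosZ, of "n i"] bounded_int[OF cosY add.hyps(1), of "n i"]
        by (simp add: distrib_left mult.left_commute)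
      moreover have "(\<integral>x. c' * cos (Z x + b') + f' x \<partial>K) = c' * (\<integral>x. cos (Z x + b') \<partial>K) + (\<integral>x. f' x \<partial>K)"
        using trig_int[OF cosZ] trig_int[OF add.hyps(1)] by simp
      moreover have "(\<lambda>i. c' * (\<integral>x. cos (Y ((T ^^ n i) x) + b) * cos (Z x + b') \<partial>K) +
          (\<integral>x. cos (Y ((T ^^ n i) x) + b) * f' x \<partial>K)) \<longlonglongrightarrow>
          c' * ((\<integral>x. cos (Y x + b) \<partial>K) * (\<integral>x. cos (Z x + b') \<partial>K)) + (\<integral>x. cos (Y x + b) \<partial>K) * (\<integral>x. f' x \<partial>K)"
        using \<open>Y \<in> V\<close> add by (intro tendsto_intros cos_lim) auto
      ultimately show ?case by (simp add: algebra_simps)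
    qed simp
    have "(\<integral>x. (c * cos (Y ((T ^^ n i) x) + b) + f ((T ^^ n i) x)) * h x \<partial>K) =
        c * (\<integral>x. cos (Y ((T ^^ n i) x) + b) * h x \<partial>K) + (\<integral>x. f ((T ^^ n i) x) * h x \<partial>K)" for i
      using bounded_int[OF cosY h, of "n i"] bounded_int[OF add.hyps(1) h, of "n i"]
      by (simp add: distrib_right mult.assoc)
    moreover have "(\<integral>x. c * cos (Y x + b) + f x \<partial>K) = c * (\<integral>x. cos (Y x + b) \<partial>K) + (\<integral>x. f x \<partial>K)"
      using trig_int[OF cosY] trig_int[OF add.hyps(1)] by simp
    moreover have "(\<lambda>i. c * (\<integral>x. cos (Y ((T ^^ n i) x) + b) * h x \<partial>K) + (\<integral>x. f ((T ^^ n i) x) * h x \<partial>K)) \<longlonglongrightarrow>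
        c * ((\<integral>x. cos (Y x + b) \<partial>K) * (\<integral>x. h x \<partial>K)) + (\<integral>x. f x \<partial>K) * (\<integral>x. h x \<partial>K)"
      using one add.IH by (intro tendsto_intros)
    ultimately show ?case by (simp add: algebra_simps)
  qed simp
  interpret trig_density K "{K}" V
    using prob_space_axioms by (intro density_finite; simp)
  let ?p = "measure K A"
  have ind: "integrable K (indicator A :: _ \<Rightarrow> real)" by (simp add: less_top[symmetric])
  have est: "\<bar>?p - ?p * ?p\<bar> \<le> 4 * e" if e: "e > 0" for e
  proof -
    obtain g where g: "g \<in> trig V" "(\<integral>x. \<bar>indicator A x - g x\<bar> \<partial>K) < e"
      using trig_dense[OF A e] by auto
    obtain C where C: "\<And>x. \<bar>g x\<bar> \<le> C" using trig_bounded g(1) by blast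
    have C0: "0 \<le> C" using C[of undefined] by linarith
    have "e / (C + 1) > 0" using e C0 by simp
    from trig_dense[OF A this] obtain h where h: "h \<in> trig V" "(\<integral>x. \<bar>indicator A x - h x\<bar> \<partial>K) < e / (C + 1)"
      by auto
    note trig_meas[OF g(1), measurable] trig_meas[OF h(1), measurable]
    have gi: "integrable K g" and hi: "integrable K h" using g h trig_int by auto
    have close: "\<bar>?p - (\<integral>x. g' x \<partial>K)\<bar> \<le> (\<integral>x. \<bar>indicator A x - g' x\<bar> \<partial>K)" if "integrable K g'" for g'
    proof -
      have "?p - (\<integral>x. g' x \<partial>K) = (\<integral>x. indicator A x - g' x \<partial>K)" using ind that by auto
      then show ?thesis using integral_abs_bound[of K "\<lambda>x. indicator A x - g' x"] by simp
    qed
    have near: "\<bar>?p - (\<integral>x. g ((T ^^ k) x) * h x \<partial>K)\<bar> \<le> 2 * e" for k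
    proof -
      have giT: "integrable K (\<lambda>x. g ((T ^^ k) x))" by (rule trig_comp_integrable[OF g(1) Tn])
      have gh: "integrable K (\<lambda>x. g ((T ^^ k) x) * h x)" by (rule bounded_int[OF g(1) h(1)])
      have iT: "(indicator A ((T ^^ k) x) :: real) = indicator A x" for x using invn by (simp add: indicator_def)
      have "?p - (\<integral>x. g ((T ^^ k) x) * h x \<partial>K) = (\<integral>x. indicator A x - g ((T ^^ k) x) * h x \<partial>K)"
        using ind gh by simp
      also have "\<bar>\<dots>\<bar> \<le> (\<integral>x. \<bar>indicator A x - g ((T ^^ k) x) * h x\<bar> \<partial>K)" by (rule integral_abs_bound)
      also have "\<dots> \<le> (\<integral>x. \<bar>indicator A ((T ^^ k) x) - g ((T ^^ k) x)\<bar> + C * \<bar>indicator A x - h x\<bar> \<partial>K)"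
      proof (rule integral_mono)
        fix x
        have "indicator A x - g ((T ^^ k) x) * h x =
          (indicator A ((T ^^ k) x) - g ((T ^^ k) x)) * indicator A x + g ((T ^^ k) x) * (indicator A x - h x)"
          unfolding iT by (simp add: indicator_def algebra_simps)
        also have "\<bar>\<dots>\<bar> \<le> \<bar>indicator A ((T ^^ k) x) - g ((T ^^ k) x)\<bar> * indicator A x + \<bar>g ((T ^^ k) x)\<bar> * \<bar>indicator A x - h x\<bar>"
          by (rule order_trans[OF abs_triangle_ineq]) (simp add: abs_mult)
        also have "\<dots> \<le> \<bar>indicator A ((T ^^ k) x) - g ((T ^^ k) x)\<bar> * 1 + C * \<bar>indicator A x - h x\<bar>"
          using C by (intro add_mono mult_left_mono mult_right_mono) (auto simp: indicator_def)
        finally show "\<bar>indicator A x - g ((T ^^ k) x) * h x\<bar> \<le>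
          \<bar>indicator A ((T ^^ k) x) - g ((T ^^ k) x)\<bar> + C * \<bar>indicator A x - h x\<bar>" by simp
      qed (use ind gi hi giT gh iT in \<open>auto\<close>)
      also have "\<dots> = (\<integral>x. \<bar>indicator A ((T ^^ k) x) - g ((T ^^ k) x)\<bar> \<partial>K) + C * (\<integral>x. \<bar>indicator A x - h x\<bar> \<partial>K)"
        using ind hi giT iT by simp
      also have "(\<integral>x. \<bar>indicator A ((T ^^ k) x) - g ((T ^^ k) x)\<bar> \<partial>K) = (\<integral>x. \<bar>indicator A x - g x\<bar> \<partial>K)"
        by (rule integral_preserved[OF Tn presn]) auto
      also have "\<dots> + C * (\<integral>x. \<bar>indicator A x - h x\<bar> \<partial>K) \<le> e + C * (e / (C + 1))"
        using g(2) h(2) C0 by (intro add_mono mult_left_mono) auto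
      also have "\<dots> \<le> 2 * e" using e C0 by (simp add: field_simps)
      finally show ?thesis .
    qed
    have "(\<lambda>i. \<bar>?p - (\<integral>x. g ((T ^^ n i) x) * h x \<partial>K)\<bar>) \<longlonglongrightarrow> \<bar>?p - (\<integral>x. g x \<partial>K) * (\<integral>x. h x \<partial>K)\<bar>"
      by (intro tendsto_intros trig_lim g h)
    then have 1: "\<bar>?p - (\<integral>x. g x \<partial>K) * (\<integral>x. h x \<partial>K)\<bar> \<le> 2 * e"
      by (rule LIMSEQ_le_const2) (use near in auto)
    have "(\<integral>x. g x \<partial>K) * (\<integral>x. h x \<partial>K) - ?p * ?p =
       ((\<integral>x. g x \<partial>K) - ?p) * ?p + (\<integral>x. g x \<partial>K) * ((\<integral>x. h x \<partial>K) - ?p)" by (simp add: algebra_simps)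
    also have "\<bar>\<dots>\<bar> \<le> \<bar>(\<integral>x. g x \<partial>K) - ?p\<bar> * ?p + \<bar>\<integral>x. g x \<partial>K\<bar> * \<bar>(\<integral>x. h x \<partial>K) - ?p\<bar>"
      by (rule order_trans[OF abs_triangle_ineq]) (simp add: abs_mult)
    also have "\<dots> \<le> e * 1 + C * (e / (C + 1))"
    proof (intro add_mono mult_mono)
      show "\<bar>(\<integral>x. g x \<partial>K) - ?p\<bar> \<le> e" using close[OF gi] g(2) by (simp add: abs_minus_commute)
      show "\<bar>(\<integral>x. h x \<partial>K) - ?p\<bar> \<le> e / (C + 1)" using close[OF hi] h(2) by (simp add: abs_minus_commute)
      have "\<bar>\<integral>x. g x \<partial>K\<bar> \<le> (\<integral>x. \<bar>g x\<bar> \<partial>K)" by (rule integral_abs_bound)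
      also have "\<dots> \<le> (\<integral>x. C \<partial>K)" using gi C by (intro integral_mono) auto
      finally show "\<bar>\<integral>x. g x \<partial>K\<bar> \<le> C" by (simp add: prob_space)
    qed (use e C0 in auto)
    also have "\<dots> \<le> 2 * e" using e C0 by (simp add: field_simps)
    finally show ?thesis using 1 by linarith
  qed
  have "\<bar>?p - ?p * ?p\<bar> \<le> 0"
  proof (rule field_le_epsilon)
    fix e :: real assume "e > 0"
    then show "\<bar>?p - ?p * ?p\<bar> \<le> 0 + e" using est[of "e / 4"] by simp
  qed
  then have "?p * (1 - ?p) = 0" by (simp add: right_diff_distrib)
  then show ?thesis by auto
qed

end

section \<open>Gaussian processes with a prescribed covariance\<close>

inductive_set lin_span :: "('x \<Rightarrow> real) set \<Rightarrow> ('x \<Rightarrow> real) set" for G :: "('x \<Rightarrow> real) set" where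
  zero: "(\<lambda>_. 0) \<in> lin_span G"
| add: "f \<in> lin_span G \<Longrightarrow> g \<in> G \<Longrightarrow> (\<lambda>x. c * g x + f x) \<in> lin_span G"

lemma lin_span_plus: "f \<in> lin_span G \<Longrightarrow> g \<in> lin_span G \<Longrightarrow> (\<lambda>x. f x + g x) \<in> lin_span G"
  by (induction rule: lin_span.induct) (simp_all add: add.assoc lin_span.add)

lemma lin_span_cmult: "f \<in> lin_span G \<Longrightarrow> (\<lambda>x. a * f x) \<in> lin_span G"
proof (induction rule: lin_span.induct)
  case zero
  show ?case by (simp add: lin_span.zero)
next
  case (add f g c)
  then show ?case using lin_span.add[OF add.IH add.hyps(2), of "a * c"] by (simp add: algebra_simps)
qed

lemma lin_span_base: "g \<in> G \<Longrightarrow> g \<in> lin_span G"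
  using lin_span.add[OF lin_span.zero, of g G 1] by simp

lemma lin_span_sum:
  "finite J \<Longrightarrow> (\<And>j. j \<in> J \<Longrightarrow> f j \<in> lin_span G) \<Longrightarrow> (\<lambda>x. \<Sum>j\<in>J. f j x) \<in> lin_span G"
  by (induction J rule: finite_induct) (simp_all add: lin_span.zero lin_span_plus)

lemma lin_closed_lin_span: "lin_closed (lin_span G)"
  by (simp add: lin_closed_def lin_span.zero lin_span_plus lin_span_cmult)

lemma lin_span_measurable:
  "f \<in> lin_span G \<Longrightarrow> G \<subseteq> borel_measurable M \<Longrightarrow> f \<in> borel_measurable M"
  by (induction rule: lin_span.induct) auto

lemma lin_span_compose:
  assumes "\<And>g. g \<in> G \<Longrightarrow> (\<lambda>x. g (T x)) \<in> lin_span H" "f \<in> lin_span G"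
  shows "(\<lambda>x. f (T x)) \<in> lin_span H"
  using assms(2)
  by (induction rule: lin_span.induct) (simp_all add: lin_span.zero lin_span_plus lin_span_cmult assms(1))

definition coords :: "(('i \<Rightarrow> real) \<Rightarrow> real) set" where
  "coords = range (\<lambda>i x. x i)"

lemma coords_measurable: "sets M = sets (PiM UNIV (\<lambda>_. borel)) \<Longrightarrow> coords \<subseteq> borel_measurable M"
  using measurable_cong_sets[of M "PiM UNIV (\<lambda>_. borel)"] by (fastforce simp: coords_def)

definition iid_normal :: "(nat \<Rightarrow> real) measure" where
  "iid_normal = PiM UNIV (\<lambda>_. std_normal_distribution)"

lemma sets_iid_normal: "sets iid_normal = sets (PiM UNIV (\<lambda>_. borel))"
  unfolding iid_normal_def by (intro sets_PiM_cong) auto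

lemma coord_iid_normal [measurable]: "(\<lambda>w. w j) \<in> borel_measurable iid_normal"
  using coords_measurable[OF sets_iid_normal] by (auto simp: coords_def)

interpretation iid_normal: prob_space iid_normal
  unfolding iid_normal_def by (intro prob_space_PiM prob_space_normal_density) simp

lemma distr_coord_iid_normal: "distr iid_normal borel (\<lambda>w. w j) = std_normal_distribution"
proof -
  have "distr iid_normal std_normal_distribution (\<lambda>w. w j) = std_normal_distribution"
    unfolding iid_normal_def by (rule distr_PiM_component) (auto intro: prob_space_normal_density)
  moreover have "distr iid_normal std_normal_distribution (\<lambda>w. w j) = distr iid_normal borel (\<lambda>w. w j)"
    by (intro distr_cong) auto
  ultimately show ?thesis by simp
qed

lemma indep_iid_normal: "iid_normal.indep_vars (\<lambda>_. borel) (\<lambda>j w. w j) UNIV"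
proof (subst iid_normal.indep_vars_iff_distr_eq_PiM)
  have "(\<lambda>w. \<lambda>i\<in>UNIV. w i) = (\<lambda>w. w :: nat \<Rightarrow> real)" by (simp add: restrict_def)
  moreover have "distr iid_normal (PiM UNIV (\<lambda>_. borel)) (\<lambda>w. w) = iid_normal"
    by (rule distr_id2) (simp add: sets_iid_normal)
  ultimately show "distr iid_normal (PiM UNIV (\<lambda>_. borel)) (\<lambda>w. \<lambda>i\<in>UNIV. w i) =
      PiM UNIV (\<lambda>i. distr iid_normal borel (\<lambda>w. w i))"
    by (simp only: distr_coord_iid_normal flip: iid_normal_def)
qed auto

lemma moments_iid_normal:
  shows "integrable iid_normal (\<lambda>w. w j)" "(\<integral>w. w j \<partial>iid_normal) = 0"
    and "integrable iid_normal (\<lambda>w. w i * w j)"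
    and "(\<integral>w. w i * w j \<partial>iid_normal) = (if i = j then 1 else 0)"
proof -
  have tr: "integrable iid_normal (\<lambda>w. (w j) ^ k) \<and>
      (\<integral>w. (w j) ^ k \<partial>iid_normal) = (\<integral>x. x ^ k \<partial>std_normal_distribution)" for j k
  proof -
    have "integrable (distr iid_normal borel (\<lambda>w. w j)) (\<lambda>x. x ^ k)"
      unfolding distr_coord_iid_normal by (rule integrable_std_normal_distribution_moment)
    then have "integrable iid_normal (\<lambda>w. (w j) ^ k)" by (subst (asm) integrable_distr_eq) auto
    moreover have "(\<integral>w. (w j) ^ k \<partial>iid_normal) = (\<integral>x. x ^ k \<partial>distr iid_normal borel (\<lambda>w. w j))"
      by (subst integral_distr) auto
    ultimately show ?thesis by (simp add: distr_coord_iid_normal)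
  qed
  show int: "integrable iid_normal (\<lambda>w. w j)" for j using tr[of j 1] by simp
  show mean: "(\<integral>w. w j \<partial>iid_normal) = 0" for j
    using tr[of j 1] integral_std_normal_distribution_moment_odd[of 1] by simp
  have sq: "integrable iid_normal (\<lambda>w. (w j)\<^sup>2)" for j using tr[of j 2] by simp
  show "integrable iid_normal (\<lambda>w. w i * w j)" by (intro iid_normal.mult_integrable sq) auto
  show "(\<integral>w. w i * w j \<partial>iid_normal) = (if i = j then 1 else 0)"
  proof (cases "i = j")
    case True
    then show ?thesis using tr[of j 2] std_normal_distribution_even_moments[of 1]
      by (simp add: power2_eq_square)
  next
    case False
    have "iid_normal.indep_vars (\<lambda>_. borel) (\<lambda>j w. w j) {i, j}"
      using indep_iid_normal by (rule iid_normal.indep_vars_subset) simp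
    then have "(\<integral>w. (\<Prod>k\<in>{i, j}. w k) \<partial>iid_normal) = (\<Prod>k\<in>{i, j}. \<integral>w. w k \<partial>iid_normal)"
      by (intro iid_normal.indep_vars_lebesgue_integral int) auto
    then show ?thesis using False by (simp add: mean)
  qed
qed

lemma lin_span_coords_nat:
  "Y \<in> lin_span coords \<Longrightarrow> \<exists>N (b :: nat \<Rightarrow> real). Y = (\<lambda>w. \<Sum>j<N. b j * w j)"
proof (induction rule: lin_span.induct)
  case zero
  show ?case by (intro exI[of _ 0]) simp
next
  case (add f g c)
  then obtain N b i where f: "f = (\<lambda>w. \<Sum>j<N. b j * w j)" and g: "g = (\<lambda>w. w (i::nat))"
    by (auto simp: coords_def)
  define b' where "b' j = (if j = i then c else 0) + (if j < N then b j else 0)" for j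
  let ?M = "max N (Suc i)"
  have "c * w i + (\<Sum>j<N. b j * w j) = (\<Sum>j<?M. b' j * w j)" for w :: "nat \<Rightarrow> real"
  proof -
    have "(\<Sum>j<?M. b' j * w j) = (\<Sum>j<?M. if j = i then c * w j else 0) + (\<Sum>j<?M. if j < N then b j * w j else 0)"
      unfolding b'_def sum.distrib[symmetric] by (intro sum.cong) (auto simp: distrib_right)
    also have "(\<Sum>j<?M. if j < N then b j * w j else 0) = (\<Sum>j<N. b j * w j)"
      by (intro sum.mono_neutral_cong_right) auto
    finally show ?thesis by (simp add: sum.delta)
  qed
  then show ?case unfolding f g by (intro exI[of _ ?M] exI[of _ b']) simp
qed

lemma integral_products_iid_normal:
  "(\<integral>w. (\<Sum>i<N. a i * w i) * (\<Sum>j<N. b j * w j) \<partial>iid_normal) = (\<Sum>i<N. a i * b i)"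
  "integrable iid_normal (\<lambda>w. (\<Sum>i<N. a i * w i) * (\<Sum>j<N. b j * w j))"
proof -
  have eq: "(\<Sum>i<N. a i * w i) * (\<Sum>j<N. b j * w j) = (\<Sum>i<N. \<Sum>j<N. a i * b j * (w i * w j))" for w :: "nat \<Rightarrow> real"
    by (simp add: sum_product mult_ac)
  have int: "integrable iid_normal (\<lambda>w. a i * b j * (w i * w j))" for i j
    using moments_iid_normal by simp
  show "integrable iid_normal (\<lambda>w. (\<Sum>i<N. a i * w i) * (\<Sum>j<N. b j * w j))"
    unfolding eq by (intro Bochner_Integration.integrable_sum int)
  have "(\<integral>w. (\<Sum>i<N. a i * w i) * (\<Sum>j<N. b j * w j) \<partial>iid_normal) =
      (\<Sum>i<N. \<Sum>j<N. a i * b j * (if i = j then 1 else 0))"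
    unfolding eq using int by (simp add: moments_iid_normal)
  also have "\<dots> = (\<Sum>i<N. a i * b i)"
    by (intro sum.cong refl) (simp add: sum.delta if_distrib cong: if_cong)
  finally show "(\<integral>w. (\<Sum>i<N. a i * w i) * (\<Sum>j<N. b j * w j) \<partial>iid_normal) = (\<Sum>i<N. a i * b i)" .
qed

lemma char_iid_normal:
  "(CLINT w|iid_normal. iexp (\<Sum>j<N. b j * w j)) = exp (- (\<Sum>j<N. (b j)\<^sup>2) / 2)"
proof -
  let ?X = "\<lambda>j w. b j * w j"
  have "iid_normal.indep_vars (\<lambda>_. borel) ?X UNIV"
    using indep_iid_normal by (rule iid_normal.indep_vars_compose2) auto
  then have ind: "iid_normal.indep_vars (\<lambda>_. borel) ?X {..<N}"
    by (rule iid_normal.indep_vars_subset) simp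
  have one: "char (distr iid_normal borel (?X j)) 1 = of_real (exp (- (b j)\<^sup>2 / 2))" for j
  proof -
    have "char (distr iid_normal borel (?X j)) 1 = (CLINT w|iid_normal. iexp (b j * w j))"
      unfolding char_def by (subst integral_distr) auto
    also have "\<dots> = (CLINT x|distr iid_normal borel (\<lambda>w. w j). iexp (b j * x))"
      by (subst integral_distr) auto
    also have "\<dots> = char std_normal_distribution (b j)"
      by (simp add: distr_coord_iid_normal char_def)
    finally show ?thesis by (simp add: char_std_normal_distribution)
  qed
  have "(CLINT w|iid_normal. iexp (\<Sum>j<N. b j * w j)) =
      char (distr iid_normal borel (\<lambda>w. \<Sum>j<N. ?X j w)) 1"
    unfolding char_def by (subst integral_distr) auto
  also have "\<dots> = (\<Prod>j<N. char (distr iid_normal borel (?X j)) 1)"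
    by (rule iid_normal.char_distr_sum[OF ind])
  also have "\<dots> = of_real (\<Prod>j<N. exp (- (b j)\<^sup>2 / 2))" by (simp add: one)
  also have "(\<Prod>j<N. exp (- (b j)\<^sup>2 / 2)) = exp (- (\<Sum>j<N. (b j)\<^sup>2) / 2)"
    by (simp add: exp_sum[symmetric] sum_negf sum_divide_distrib)
  finally show ?thesis .
qed

lemma gauss_space_iid_normal: "gauss_space iid_normal (lin_span coords)"
  unfolding gauss_space_def
proof (intro conjI ballI allI)
  show "prob_space iid_normal" by (rule iid_normal.prob_space_axioms)
  show "lin_span coords \<subseteq> borel_measurable iid_normal"
    using coords_measurable[OF sets_iid_normal] by (auto intro: lin_span_measurable)
  show "lin_closed (lin_span coords)" by (rule lin_closed_lin_span)
  fix Y :: "(nat \<Rightarrow> real) \<Rightarrow> real" and c :: real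
  assume "Y \<in> lin_span coords"
  then obtain N b where Y: "Y = (\<lambda>w. \<Sum>j<N. b j * w j)" using lin_span_coords_nat by blast
  show "integrable iid_normal (\<lambda>w. (Y w)\<^sup>2)"
    unfolding Y power2_eq_square by (rule integral_products_iid_normal)
  show "(\<integral>w. Y w \<partial>iid_normal) = 0"
    unfolding Y by (simp add: moments_iid_normal)
  have var: "(\<integral>w. (Y w)\<^sup>2 \<partial>iid_normal) = (\<Sum>j<N. (b j)\<^sup>2)"
    unfolding Y power2_eq_square by (rule integral_products_iid_normal)
  have [measurable]: "Y \<in> borel_measurable iid_normal" unfolding Y by simp
  have int: "integrable iid_normal (\<lambda>w. cis c * iexp (Y w))"
    by (intro integrable_mult_right iid_normal.integrable_iexp) auto
  have "(\<integral>w. cos (Y w + c) \<partial>iid_normal) = (\<integral>w. Re (cis c * iexp (Y w)) \<partial>iid_normal)"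
  proof -
    have "Re (cis c * iexp t) = cos (t + c)" for t
      by (simp only: cis_conv_exp[symmetric] cis_mult cis.sel add.commute)
    then show ?thesis by simp
  qed
  also have "\<dots> = Re (CLINT w|iid_normal. cis c * iexp (Y w))" using int by (rule integral_Re)
  also have "(CLINT w|iid_normal. cis c * iexp (Y w)) = cis c * of_real (exp (- (\<Sum>j<N. (b j)\<^sup>2) / 2))"
    using char_iid_normal[of b N] unfolding Y by simp
  finally show "(\<integral>w. cos (Y w + c) \<partial>iid_normal) = cos c * exp (- (\<integral>w. (Y w)\<^sup>2 \<partial>iid_normal) / 2)"
    by (simp add: var)
qed

text \<open>With a triangular factorisation, each coordinate of the process is a finite linear combination
of independent normal variables, so no convergence question arises.\<close>

lemma gaussian_process_exists:
  fixes R :: "int \<Rightarrow> int \<Rightarrow> real"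
  assumes "psd_kernel (\<lambda>i j. R (int_decode i) (int_decode j))"
  obtains M :: "(int \<Rightarrow> real) measure" where
    "gauss_space M (lin_span coords)" "sets M = sets (PiM UNIV (\<lambda>_. borel))"
    "\<And>k l. (\<integral>x. x k * x l \<partial>M) = R k l"
proof -
  obtain L where L: "\<And>i j. R (int_decode i) (int_decode j) = (\<Sum>h\<le>i. L i h * L j h)"
    and L0: "\<And>i h. i < h \<Longrightarrow> L i h = 0" using cholesky[OF assms] by metis
  define X where "X i w = (\<Sum>h<Suc i. L i h * w h)" for i and w :: "nat \<Rightarrow> real"
  define Phi where "Phi w k = X (int_encode k) w" for w k
  let ?B = "PiM UNIV (\<lambda>_::int. borel :: real measure)"
  have X_meas [measurable]: "X i \<in> borel_measurable iid_normal" for i unfolding X_def by simp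
  have Phi [measurable]: "Phi \<in> measurable iid_normal ?B"
    unfolding Phi_def by (rule measurable_PiM_single') auto
  have X_span: "X i \<in> lin_span coords" for i
  proof -
    have "(\<lambda>w. L i h * w h) \<in> lin_span coords" for h
      by (rule lin_span_cmult, rule lin_span_base) (simp add: coords_def)
    then have "(\<lambda>w. \<Sum>h<Suc i. L i h * w h) \<in> lin_span coords" by (rule lin_span_sum[rotated]) simp
    then show ?thesis by (simp only: X_def[abs_def])
  qed
  have prod: "(\<integral>w. X i w * X j w \<partial>iid_normal) = R (int_decode i) (int_decode j)" for i j
  proof -
    have pad: "X i w = (\<Sum>h<max (Suc i) (Suc j). L i h * w h)"
      "X j w = (\<Sum>h<max (Suc i) (Suc j). L j h * w h)" for w
      unfolding X_def by (intro sum.mono_neutral_left; auto simp: L0)+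
    have "(\<integral>w. X i w * X j w \<partial>iid_normal) = (\<Sum>h<max (Suc i) (Suc j). L i h * L j h)"
      unfolding pad by (rule integral_products_iid_normal)
    also have "\<dots> = (\<Sum>h\<le>i. L i h * L j h)"
      by (intro sum.mono_neutral_right) (auto simp: L0)
    finally show ?thesis by (simp add: L)
  qed
  show thesis
  proof (rule that[of "distr iid_normal ?B Phi"])
    show "gauss_space (distr iid_normal ?B Phi) (lin_span coords)"
    proof (rule gauss_space_distr[OF gauss_space_iid_normal Phi])
      show "lin_span coords \<subseteq> borel_measurable ?B"
        using coords_measurable[of ?B] by (auto intro: lin_span_measurable)
      show "(\<lambda>w. Y (Phi w)) \<in> lin_span coords" if "Y \<in> lin_span coords" for Y
      proof (rule lin_span_compose[OF _ that])
        fix g :: "(int \<Rightarrow> real) \<Rightarrow> real" assume "g \<in> coords"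
        then obtain k where "g = (\<lambda>x. x k)" by (auto simp: coords_def)
        then show "(\<lambda>w. g (Phi w)) \<in> lin_span coords"
          using X_span[of "int_encode k"] by (simp add: Phi_def)
      qed
    qed (rule lin_closed_lin_span)
    show "(\<integral>x. x k * x l \<partial>distr iid_normal ?B Phi) = R k l" for k l
      using prod[of "int_encode k" "int_encode l"] by (subst integral_distr) (auto simp: Phi_def)
  qed simp
qed

definition half_spaces :: "('x \<Rightarrow> real) set \<Rightarrow> 'x set set" where
  "half_spaces V = {{x. Y x > t} |Y t. Y \<in> V}"

lemma measurable_half_spaces: "Y \<in> V \<Longrightarrow> Y \<in> borel_measurable (sigma UNIV (half_spaces V))"
  by (rule borel_measurableI_greater) (auto simp: half_spaces_def)

lemma generated_by_half_spaces:
  assumes "(\<lambda>x. x) \<in> measurable (sigma UNIV (half_spaces V)) K" "space K = UNIV"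
  shows "sets K \<subseteq> sigma_sets UNIV {{x. Y x > t} |Y t. Y \<in> V}"
proof
  fix A assume "A \<in> sets K"
  then have "(\<lambda>x. x) -` A \<inter> space (sigma UNIV (half_spaces V)) \<in> sets (sigma UNIV (half_spaces V))"
    using assms(1) by (rule measurable_sets[rotated])
  then show "A \<in> sigma_sets UNIV {{x. Y x > t} |Y t. Y \<in> V}"
    by (simp add: half_spaces_def)
qed

lemma PiM_generated:
  assumes "sets M = sets (PiM UNIV (\<lambda>_. borel))" "coords \<subseteq> V"
  shows "sets M \<subseteq> sigma_sets UNIV {{x. Y x > t} |Y t. Y \<in> V}"
proof (rule generated_by_half_spaces)
  have "(\<lambda>x. x) \<in> measurable (sigma UNIV (half_spaces V)) (PiM UNIV (\<lambda>_. borel))"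
  proof (rule measurable_PiM_single')
    fix i
    have "(\<lambda>x. x i) \<in> V" using assms(2) by (auto simp: coords_def)
    then show "(\<lambda>x. x i) \<in> borel_measurable (sigma UNIV (half_spaces V))"
      by (rule measurable_half_spaces)
  qed simp
  then show "(\<lambda>x. x) \<in> measurable (sigma UNIV (half_spaces V)) M"
    using assms(1) by (simp cong: measurable_cong_sets)
  show "space M = UNIV" using sets_eq_imp_space_eq[OF assms(1)] by (simp add: space_PiM)
qed

definition pair_forms :: "('x \<Rightarrow> real) set \<Rightarrow> ('x \<times> 'x \<Rightarrow> real) set" where
  "pair_forms V = {\<lambda>p. Y (fst p) + Z (snd p) |Y Z. Y \<in> V \<and> Z \<in> V}"

lemma pair_formsI: "Y \<in> V \<Longrightarrow> Z \<in> V \<Longrightarrow> (\<lambda>p. Y (fst p) + Z (snd p)) \<in> pair_forms V"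
  unfolding pair_forms_def by blast

context gaussian_system
begin

interpretation KK: pair_prob_space K K ..

lemma fst_form:
  assumes "Y \<in> V"
  shows "integrable (K \<Otimes>\<^sub>M K) (\<lambda>p. (Y (fst p))\<^sup>2)" "(\<integral>p. Y (fst p) \<partial>(K \<Otimes>\<^sub>M K)) = 0"
    "(\<integral>p. (Y (fst p))\<^sup>2 \<partial>(K \<Otimes>\<^sub>M K)) = (\<integral>x. (Y x)\<^sup>2 \<partial>K)"
proof -
  note V_meas[OF assms, measurable]
  have d: "distr (K \<Otimes>\<^sub>M K) K fst = K" by (rule distr_pair_fst)
  show "integrable (K \<Otimes>\<^sub>M K) (\<lambda>p. (Y (fst p))\<^sup>2)"
    using V_sq[OF assms] integrable_distr_eq[of fst "K \<Otimes>\<^sub>M K" K "\<lambda>x. (Y x)\<^sup>2"] by (simp add: d)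
  show "(\<integral>p. Y (fst p) \<partial>(K \<Otimes>\<^sub>M K)) = 0"
    using V_mean[OF assms] integral_distr[of fst "K \<Otimes>\<^sub>M K" K Y] by (simp add: d)
  show "(\<integral>p. (Y (fst p))\<^sup>2 \<partial>(K \<Otimes>\<^sub>M K)) = (\<integral>x. (Y x)\<^sup>2 \<partial>K)"
    using integral_distr[of fst "K \<Otimes>\<^sub>M K" K "\<lambda>x. (Y x)\<^sup>2"] by (simp add: d)
qed

lemma distr_pair_snd: "distr (K \<Otimes>\<^sub>M K) K snd = K"
proof -
  have "distr (K \<Otimes>\<^sub>M K) K snd = distr (distr (K \<Otimes>\<^sub>M K) (K \<Otimes>\<^sub>M K) (\<lambda>(x, y). (y, x))) K fst"
    by (subst distr_distr) (auto intro!: distr_cong)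
  also have "distr (K \<Otimes>\<^sub>M K) (K \<Otimes>\<^sub>M K) (\<lambda>(x, y). (y, x)) = K \<Otimes>\<^sub>M K"
    by (rule KK.distr_pair_swap[symmetric])
  finally show ?thesis by (simp add: distr_pair_fst)
qed

lemma snd_form:
  assumes "Y \<in> V"
  shows "integrable (K \<Otimes>\<^sub>M K) (\<lambda>p. (Y (snd p))\<^sup>2)" "(\<integral>p. Y (snd p) \<partial>(K \<Otimes>\<^sub>M K)) = 0"
    "(\<integral>p. (Y (snd p))\<^sup>2 \<partial>(K \<Otimes>\<^sub>M K)) = (\<integral>x. (Y x)\<^sup>2 \<partial>K)"
proof -
  note V_meas[OF assms, measurable]
  note d = distr_pair_snd
  show "integrable (K \<Otimes>\<^sub>M K) (\<lambda>p. (Y (snd p))\<^sup>2)"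
    using V_sq[OF assms] integrable_distr_eq[of snd "K \<Otimes>\<^sub>M K" K "\<lambda>x. (Y x)\<^sup>2"] by (simp add: d)
  show "(\<integral>p. Y (snd p) \<partial>(K \<Otimes>\<^sub>M K)) = 0"
    using V_mean[OF assms] integral_distr[of snd "K \<Otimes>\<^sub>M K" K Y] by (simp add: d)
  show "(\<integral>p. (Y (snd p))\<^sup>2 \<partial>(K \<Otimes>\<^sub>M K)) = (\<integral>x. (Y x)\<^sup>2 \<partial>K)"
    using integral_distr[of snd "K \<Otimes>\<^sub>M K" K "\<lambda>x. (Y x)\<^sup>2"] by (simp add: d)
qed

lemma cross_form:
  assumes Y: "Y \<in> V" and Z: "Z \<in> V"
  shows "integrable (K \<Otimes>\<^sub>M K) (\<lambda>p. Y (fst p) * Z (snd p))"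
    "(\<integral>p. Y (fst p) * Z (snd p) \<partial>(K \<Otimes>\<^sub>M K)) = 0"
proof -
  note V_meas[OF Y, measurable] V_meas[OF Z, measurable]
  show int: "integrable (K \<Otimes>\<^sub>M K) (\<lambda>p. Y (fst p) * Z (snd p))"
    using fst_form[OF Y] snd_form[OF Z] by (intro KK.mult_integrable) auto
  have "(\<integral>p. Y (fst p) * Z (snd p) \<partial>(K \<Otimes>\<^sub>M K)) = (\<integral>x. \<integral>y. Y x * Z y \<partial>K \<partial>K)"
    using KK.integral_fst'[OF int] by simp
  then show "(\<integral>p. Y (fst p) * Z (snd p) \<partial>(K \<Otimes>\<^sub>M K)) = 0" using V_mean[OF Z] by simp
qed

text \<open>Forms on the two factors are independent and centred, so variances add up.\<close>

lemma gaussian_system_pair: "gaussian_system (K \<Otimes>\<^sub>M K) (pair_forms V)"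
proof (intro gaussian_system.intro gaussian_system_axioms.intro)
  show "prob_space (K \<Otimes>\<^sub>M K)" by (rule KK.prob_space_axioms)
  show "space (K \<Otimes>\<^sub>M K) = UNIV" by (simp add: space_pair_measure space_K)
  have zero: "(\<lambda>_. 0) \<in> V" using gauss by (simp add: gauss_space_def lin_closed_def)
  show "sets (K \<Otimes>\<^sub>M K) \<subseteq> sigma_sets UNIV {{x. Y x > t} |Y t. Y \<in> pair_forms V}"
  proof (rule generated_by_half_spaces)
    let ?S = "sigma UNIV (half_spaces (pair_forms V))"
    have gen': "f \<in> measurable ?S K" if f: "\<And>Y. Y \<in> V \<Longrightarrow> (\<lambda>p. Y (f p)) \<in> borel_measurable ?S" for f
    proof -
      have sub: "half_spaces V \<subseteq> Pow UNIV" by simp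
      have "f \<in> measurable ?S (sigma UNIV (half_spaces V))"
      proof (rule measurable_measure_of)
        fix B assume "B \<in> half_spaces V"
        then obtain Y t where B: "B = {x. Y x > t}" "Y \<in> V" by (auto simp: half_spaces_def)
        have "{p \<in> space ?S. t < Y (f p)} \<in> sets ?S" using f[OF B(2)] by measurable
        then show "f -` B \<inter> space ?S \<in> sets ?S" by (simp add: B(1) vimage_def)
      qed auto
      moreover have "sets K \<subseteq> sets (sigma UNIV (half_spaces V))"
        using gen by (simp add: half_spaces_def)
      ultimately show ?thesis
        unfolding measurable_def by (auto simp: space_K)
    qed
    show "(\<lambda>p. p) \<in> measurable ?S (K \<Otimes>\<^sub>M K)"
    proof (rule measurable_Pair[of fst _ _ snd, simplified])
      show "fst \<in> measurable ?S K"
      proof (rule gen')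
        fix Y assume "Y \<in> V"
        from measurable_half_spaces[OF pair_formsI[OF this zero]] show "(\<lambda>p. Y (fst p)) \<in> borel_measurable ?S" by simp
      qed
      show "snd \<in> measurable ?S K"
      proof (rule gen')
        fix Y assume "Y \<in> V"
        from measurable_half_spaces[OF pair_formsI[OF zero this]] show "(\<lambda>p. Y (snd p)) \<in> borel_measurable ?S" by simp
      qed
    qed
  qed (simp add: space_pair_measure space_K)
  show "gauss_space (K \<Otimes>\<^sub>M K) (pair_forms V)"
    unfolding gauss_space_def
  proof (intro conjI ballI allI)
    show "prob_space (K \<Otimes>\<^sub>M K)" by (rule KK.prob_space_axioms)
    show "pair_forms V \<subseteq> borel_measurable (K \<Otimes>\<^sub>M K)"
      by (auto simp: pair_forms_def)
    show "lin_closed (pair_forms V)"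
      unfolding lin_closed_def
    proof (intro conjI ballI allI)
      show "(\<lambda>_. 0) \<in> pair_forms V"
        unfolding pair_forms_def using zero by (intro CollectI exI[of _ "\<lambda>_. 0"]) auto
      fix f g c d assume "f \<in> pair_forms V" "g \<in> pair_forms V"
      then obtain Y Z Y' Z' where fg: "f = (\<lambda>p. Y (fst p) + Z (snd p))" "g = (\<lambda>p. Y' (fst p) + Z' (snd p))"
        and V: "Y \<in> V" "Z \<in> V" "Y' \<in> V" "Z' \<in> V" unfolding pair_forms_def by blast
      show "(\<lambda>p. c * f p + d * g p) \<in> pair_forms V"
        unfolding pair_forms_def
        by (intro CollectI exI[of _ "\<lambda>x. c * Y x + d * Y' x"] exI[of _ "\<lambda>x. c * Z x + d * Z' x"])
          (simp add: fg algebra_simps V_lin[OF V(1) V(3)] V_lin[OF V(2) V(4)])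
    qed
    fix f b assume "f \<in> pair_forms V"
    then obtain Y Z where f: "f = (\<lambda>p. Y (fst p) + Z (snd p))" and Y: "Y \<in> V" and Z: "Z \<in> V"
      unfolding pair_forms_def by blast
    note V_meas[OF Y, measurable] V_meas[OF Z, measurable]
    have sq: "(f p)\<^sup>2 = (Y (fst p))\<^sup>2 + (Z (snd p))\<^sup>2 + 2 * (Y (fst p) * Z (snd p))" for p
      by (simp add: f power2_sum)
    show "integrable (K \<Otimes>\<^sub>M K) (\<lambda>p. (f p)\<^sup>2)"
      unfolding sq using fst_form[OF Y] snd_form[OF Z] cross_form[OF Y Z] by simp
    have int: "integrable (K \<Otimes>\<^sub>M K) (\<lambda>p. Y (fst p))" "integrable (K \<Otimes>\<^sub>M K) (\<lambda>p. Z (snd p))"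
      using fst_form[OF Y] snd_form[OF Z] by (auto intro!: KK.square_integrableD)
    show "(\<integral>p. f p \<partial>(K \<Otimes>\<^sub>M K)) = 0"
      unfolding f using int fst_form[OF Y] snd_form[OF Z] by simp
    have var: "(\<integral>p. (f p)\<^sup>2 \<partial>(K \<Otimes>\<^sub>M K)) = (\<integral>x. (Y x)\<^sup>2 \<partial>K) + (\<integral>x. (Z x)\<^sup>2 \<partial>K)"
      unfolding sq using fst_form[OF Y] snd_form[OF Z] cross_form[OF Y Z] by simp
    have ci: "integrable (K \<Otimes>\<^sub>M K) (\<lambda>p. cos (f p + b))"
      unfolding f by (intro KK.integrable_const_bound[where B = 1]) auto
    have "(\<integral>p. cos (f p + b) \<partial>(K \<Otimes>\<^sub>M K)) = (\<integral>x. \<integral>y. cos (Z y + (Y x + b)) \<partial>K \<partial>K)"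
      using KK.integral_fst'[OF ci] by (simp add: f algebra_simps)
    also have "\<dots> = (cos b * exp (- (\<integral>x. (Y x)\<^sup>2 \<partial>K) / 2)) * exp (- (\<integral>x. (Z x)\<^sup>2 \<partial>K) / 2)"
      by (simp add: V_cos[OF Z] V_cos[OF Y])
    also have "\<dots> = cos b * exp (- (\<integral>p. (f p)\<^sup>2 \<partial>(K \<Otimes>\<^sub>M K)) / 2)"
      unfolding var by (simp add: mult_exp_exp diff_divide_distrib)
    finally show "(\<integral>p. cos (f p + b) \<partial>(K \<Otimes>\<^sub>M K)) = cos b * exp (- (\<integral>p. (f p)\<^sup>2 \<partial>(K \<Otimes>\<^sub>M K)) / 2)" .
  qed
qed

end

section \<open>Eigenvalues of the given system\<close>

lemma standard_prob_space_imp_prob_space: "standard_prob_space M \<Longrightarrow> prob_space M"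
  by (auto simp: standard_prob_space_def intro: prob_space.prob_space_completion)

locale dyn = prob_space X for S :: "'a \<Rightarrow> 'a" and X :: "'a measure" +
  assumes dyn: "dynamical_system S X"
begin

definition S' :: "'a \<Rightarrow> 'a" where "S' = inv_into (space X) S"

lemma S_bij: "bij_betw S (space X) (space X)"
  and S_meas [measurable]: "S \<in> measurable X X"
  and S'_meas [measurable]: "S' \<in> measurable X X"
  using dyn by (auto simp: dynamical_system_def S'_def)

lemma S_S': "x \<in> space X \<Longrightarrow> S (S' x) = x" and S'_S: "x \<in> space X \<Longrightarrow> S' (S x) = x"
  using S_bij by (auto simp: S'_def bij_betw_def f_inv_into_f)

lemma S_space: "x \<in> space X \<Longrightarrow> S x \<in> space X" and S'_space: "x \<in> space X \<Longrightarrow> S' x \<in> space X"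
  using measurable_space[OF S_meas] measurable_space[OF S'_meas] by auto

lemma distr_S: "distr X X S = X"
  using dyn by (intro measure_eqI) (auto simp: emeasure_distr dynamical_system_def)

lemma distr_S': "distr X X S' = X"
proof -
  have "distr X X S' = distr (distr X X S) X S'" by (simp add: distr_S)
  also have "\<dots> = distr X X (S' \<circ> S)" by (rule distr_distr) auto
  also have "\<dots> = distr X X (\<lambda>x. x)" by (rule distr_cong) (auto simp: S'_S)
  finally show ?thesis by (simp add: distr_id2)
qed

lemma iter_meas: "iterate X S k \<in> measurable X X"
proof -
  have "R ^^ n \<in> measurable X X" if "R \<in> measurable X X" for R n
    by (induction n) (simp, simp only: funpow.simps, rule measurable_comp[OF _ that])
  then show ?thesis using S_meas S'_meas by (simp add: iterate_def S'_def)
qed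

lemma iter_distr: "distr X X (iterate X S k) = X"
proof -
  have "distr X X (R ^^ n) = X" if R: "R \<in> measurable X X" "distr X X R = X" for R n
  proof (induction n)
    case (Suc n)
    have Rn: "R ^^ n \<in> measurable X X" for n
      by (induction n) (simp, simp only: funpow.simps, rule measurable_comp[OF _ R(1)])
    have "distr X X (R ^^ Suc n) = distr (distr X X (R ^^ n)) X R"
      using distr_distr[OF R(1) Rn[of n]] by simp
    then show ?case by (simp only: Suc R)
  qed (simp add: distr_id2)
  then show ?thesis using S_meas S'_meas distr_S distr_S' by (simp add: iterate_def S'_def)
qed

lemma AE_iter: "AE x in X. P x \<Longrightarrow> AE x in X. P (iterate X S k x)"
  using AE_distrD[OF iter_meas[of k], of P] unfolding iter_distr .

lemma funpow_inverse:
  assumes "\<And>x. x \<in> E \<Longrightarrow> R x \<in> E" "\<And>x. x \<in> E \<Longrightarrow> R' (R x) = x" "x \<in> E"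
  shows "(R' ^^ n) ((R ^^ n) x) = x"
proof -
  have E: "(R ^^ n) x \<in> E" for n by (induction n) (auto simp: assms)
  show ?thesis
  proof (induction n)
    case (Suc n)
    have "(R' ^^ Suc n) ((R ^^ Suc n) x) = (R' ^^ n) (R' (R ((R ^^ n) x)))"
      by (subst funpow_Suc_right) simp
    then show ?case by (simp only: assms(2)[OF E] Suc)
  qed simp
qed

lemma iter_inverse: "x \<in> space X \<Longrightarrow> iterate X S (- k) (iterate X S k x) = x"
proof -
  assume x: "x \<in> space X"
  have "(S' ^^ n) ((S ^^ n) x) = x" for n by (rule funpow_inverse[OF S_space S'_S x])
  moreover have "(S ^^ n) ((S' ^^ n) x) = x" for n by (rule funpow_inverse[OF S'_space S_S' x])
  ultimately show ?thesis by (cases "k = 0") (auto simp: iterate_def S'_def)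
qed

lemma iter_space: "x \<in> space X \<Longrightarrow> iterate X S k x \<in> space X"
  using measurable_space[OF iter_meas] .

lemma iter_image:
  assumes "A \<in> sets X"
  shows "iterate X S k ` A = iterate X S (- k) -` A \<inter> space X"
proof
  show "iterate X S k ` A \<subseteq> iterate X S (- k) -` A \<inter> space X"
    using sets.sets_into_space[OF assms] by (auto simp: iter_inverse iter_space)
  show "iterate X S (- k) -` A \<inter> space X \<subseteq> iterate X S k ` A"
  proof
    fix x assume "x \<in> iterate X S (- k) -` A \<inter> space X"
    then show "x \<in> iterate X S k ` A"
      using iter_inverse[of x "- k"] by (metis IntD1 IntD2 image_eqI minus_minus vimageD)
  qed
qed

lemma eigenfunction_iter:
  assumes f: "AE x in X. f (S x) = c * f x" and c: "c \<noteq> 0"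
  shows "AE x in X. f (iterate X S k x) = (c powi k :: complex) * f x"
proof -
  have step: "AE x in X. f (iterate X S (int n) x) = c ^ n * f x" for n
  proof (induction n)
    case (Suc n)
    have "AE x in X. f (S (iterate X S (int n) x)) = c * f (iterate X S (int n) x)"
      using AE_iter[OF f] .
    with Suc show ?case
      by eventually_elim (simp add: iterate_def nat_add_distrib)
  qed (simp add: iterate_def)
  show ?thesis
  proof (cases "0 \<le> k")
    case True
    then show ?thesis using step[of "nat k"] by (simp add: power_int_def)
  next
    case False
    have "AE x in X. f (iterate X S (- k) (iterate X S k x)) = c ^ nat (- k) * f (iterate X S k x)"
      using AE_iter[OF step[of "nat (- k)"], of k] False by simp
    then show ?thesis
      using AE_space
    proof eventually_elim
      case (elim x)
      then have "f x = c ^ nat (- k) * f (iterate X S k x)" by (simp add: iter_inverse)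
      then show ?case using False c by (simp add: power_int_def field_simps)
    qed
  qed
qed

lemma eigenvalue_norm:
  assumes "L2_fun X f" "\<not> (AE x in X. f x = 0)" and c: "AE x in X. f (S x) = c * f x"
  shows "cmod c = 1"
proof -
  have [measurable]: "f \<in> borel_measurable X" and int: "integrable X (\<lambda>x. (cmod (f x))\<^sup>2)"
    using assms(1) by (auto simp: L2_fun_def)
  let ?I = "\<integral>x. (cmod (f x))\<^sup>2 \<partial>X"
  have "?I = (\<integral>x. (cmod (f x))\<^sup>2 \<partial>distr X X S)" by (simp add: distr_S)
  also have "\<dots> = (\<integral>x. (cmod (f (S x)))\<^sup>2 \<partial>X)" by (subst integral_distr) auto
  also have "\<dots> = (\<integral>x. (cmod c)\<^sup>2 * (cmod (f x))\<^sup>2 \<partial>X)"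
    using c by (intro integral_cong_AE) (auto simp: norm_mult power_mult_distrib)
  finally have "?I = (cmod c)\<^sup>2 * ?I" by simp
  moreover have "?I \<noteq> 0"
    using assms(2) integral_nonneg_eq_0_iff_AE[OF int] by auto
  ultimately have "(cmod c)\<^sup>2 = 1" by simp
  then show ?thesis by (simp add: power2_eq_1_iff) (smt (verit) norm_ge_zero)
qed

text \<open>Countably many discs of relative radius \<open>h\<close> around nonzero centres cover all
nonzero values of \<open>f\<close>.\<close>

lemma concentrated_level_set:
  fixes f :: "'a \<Rightarrow> complex"
  assumes f [measurable]: "f \<in> borel_measurable X" and nz: "\<not> (AE x in X. f x = 0)" and h: "0 < h" "h \<le> 1 / 2"
  obtains z where "z \<noteq> 0" "0 < measure X {x \<in> space X. cmod (f x - z) < h * cmod z}"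
proof -
  obtain D :: "complex set" where D: "countable D" "\<And>U. open U \<Longrightarrow> U \<noteq> {} \<Longrightarrow> \<exists>d\<in>D. d \<in> U"
    using countable_dense_setE by blast
  have "\<exists>z\<in>D - {0}. measure X {x \<in> space X. cmod (f x - z) < h * cmod z} \<noteq> 0"
  proof (rule ccontr)
    assume no: "\<not> ?thesis"
    have "AE x in X. \<not> cmod (f x - z) < h * cmod z" if "z \<in> D - {0}" for z
    proof (rule AE_I'[of "{x \<in> space X. cmod (f x - z) < h * cmod z}"])
      show "{x \<in> space X. cmod (f x - z) < h * cmod z} \<in> null_sets X"
        using no that by (auto simp: null_sets_def emeasure_eq_measure)
    qed auto
    then have "AE x in X. \<forall>z\<in>D - {0}. \<not> cmod (f x - z) < h * cmod z"
      using D(1) by (subst AE_ball_countable) auto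
    then have "AE x in X. f x = 0"
    proof eventually_elim
      case (elim x)
      show ?case
      proof (rule ccontr)
        assume w: "f x \<noteq> 0"
        define r where "r = h / 2 * cmod (f x)"
        have r: "0 < r" using w h by (simp add: r_def)
        obtain z where z: "z \<in> D" "z \<in> ball (f x) r" using D(2)[of "ball (f x) r"] r by auto
        have d: "cmod (f x - z) < r" using z by (simp add: dist_norm)
        have "r \<le> 1 / 2 / 2 * cmod (f x)"
          unfolding r_def using h by (intro mult_right_mono) auto
        then have big: "cmod (f x) / 2 < cmod z"
        proof -
          have "cmod (f x) - cmod z < r" using d norm_triangle_ineq2[of "f x" z] by linarith
          moreover have "0 < cmod (f x)" using w by simp
          ultimately show ?thesis using \<open>r \<le> 1 / 2 / 2 * cmod (f x)\<close> by linarith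
        qed
        then have "z \<noteq> 0" using w by auto
        moreover have "r < h * cmod z" using big h by (simp add: r_def mult.commute)
        ultimately show False using elim z d by force
      qed
    qed
    with nz show False by simp
  qed
  then obtain z where z: "z \<noteq> 0" "measure X {x \<in> space X. cmod (f x - z) < h * cmod z} \<noteq> 0" by auto
  from z have "z \<noteq> 0" "0 < measure X {x \<in> space X. cmod (f x - z) < h * cmod z}"
    by (simp_all add: zero_less_measure_iff)
  then show thesis by (rule that)
qed

text \<open>On a set \<open>A\<close> of positive measure the eigenfunction is nearly constant and not zero.
By rigidity some point of \<open>A\<close> is moved into \<open>A\<close>, while its value is
multiplied by the power of the eigenvalue, which therefore is close to \<open>1\<close>.\<close>

lemma eigenvalue_rigid_angle:
  assumes rig: "rigidity_sequence S X m" and f: "L2_fun X f" "\<not> (AE x in X. f x = 0)"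
    and ev: "AE x in X. f (S x) = cis t * f x"
  shows "t \<in> rigid_angles m"
proof -
  have [measurable]: "f \<in> borel_measurable X" using f by (simp add: L2_fun_def)
  have "(\<lambda>l. cis (of_int (m l) * (- t))) \<longlonglongrightarrow> 1"
  proof (rule tendstoI)
    fix e :: real assume "e > 0"
    define h where "h = min (1 / 2) (e / 8)"
    have h: "0 < h" "h \<le> 1 / 2" "4 * h < e" using \<open>e > 0\<close> by (auto simp: h_def min_def)
    obtain z where z: "z \<noteq> 0" "0 < measure X {x \<in> space X. cmod (f x - z) < h * cmod z}"
      using concentrated_level_set[OF _ f(2) h(1,2)] by auto
    define A where "A = {x \<in> space X. cmod (f x - z) < h * cmod z}"
    have A [measurable]: "A \<in> sets X" unfolding A_def by simp
    have Apos: "0 < measure X A" using z by (simp add: A_def)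
    have "\<forall>\<^sub>F l in sequentially. measure X (sym_diff (iterate X S (m l) ` A) A) < measure X A"
      using rig[unfolded rigidity_sequence_def, rule_format, OF A] Apos by (rule order_tendstoD(2))
    then show "\<forall>\<^sub>F l in sequentially. dist (cis (of_int (m l) * (- t))) 1 < e"
    proof eventually_elim
      case (elim l)
      let ?R = "iterate X S (- m l)" and ?c = "cis t powi (- m l)"
      define B where "B = ?R -` A \<inter> space X"
      have B [measurable]: "B \<in> sets X" unfolding B_def using iter_meas A by (rule measurable_sets)
      have "measure X (sym_diff B A) < measure X A" using elim by (simp add: iter_image[OF A] B_def)
      moreover have "measure X A \<le> measure X (A \<inter> B) + measure X (sym_diff B A)"
        by (rule order_trans[OF finite_measure_mono measure_Un_le]) auto
      ultimately have pos: "0 < measure X (A \<inter> B)" by linarith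
      have "AE x in X. f (?R x) = ?c * f x" by (rule eigenfunction_iter[OF ev]) simp
      then obtain N where N: "N \<in> null_sets X" "{x \<in> space X. f (?R x) \<noteq> ?c * f x} \<subseteq> N"
        by (auto elim: AE_E simp: null_sets_def)
      have "\<not> A \<inter> B \<subseteq> N"
      proof
        assume "A \<inter> B \<subseteq> N"
        then have "measure X (A \<inter> B) \<le> measure X N" using N by (intro finite_measure_mono) auto
        then show False using pos N by (simp add: measure_eq_0_null_sets)
      qed
      then obtain x where x: "x \<in> A" "x \<in> B" "x \<notin> N" by auto
      then have y: "cmod (f (?R x) - z) < h * cmod z" "cmod (f x - z) < h * cmod z" "f (?R x) = ?c * f x"
        using N by (auto simp: B_def A_def)
      have zpos: "0 < cmod z" using z by simp
      have hz: "h * cmod z \<le> cmod z / 2" using h(2) zpos by (simp add: mult_right_mono field_simps)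
      have fx: "cmod z / 2 \<le> cmod (f x)"
        using y(2) hz norm_triangle_ineq2[of z "f x"] by (simp add: norm_minus_commute)
      have "cmod (?c - 1) * cmod (f x) = cmod (f (?R x) - f x)"
        by (simp add: y(3) left_diff_distrib flip: norm_mult)
      also have "\<dots> \<le> cmod (f (?R x) - z) + cmod (f x - z)"
        by (metis norm_triangle_sub dist_commute dist_norm dist_triangle2)
      also have "\<dots> < 2 * h * cmod z" using y by simp
      finally have "cmod (?c - 1) * cmod (f x) < 2 * h * cmod z" .
      moreover have "cmod (?c - 1) * (cmod z / 2) \<le> cmod (?c - 1) * cmod (f x)"
        using fx by (intro mult_left_mono) auto
      ultimately have "cmod (?c - 1) * cmod z < 4 * h * cmod z" by simp
      then have "cmod (?c - 1) < 4 * h" using zpos by simp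
      moreover have "?c = cis (of_int (m l) * (- t))" by (simp add: cis_power_int)
      ultimately show ?case using h(3) by (simp add: dist_norm)
    qed
  qed
  then have "- t \<in> rigid_angles m" by (simp only: rigid_angles_def mem_Collect_eq)
  then show ?thesis using rigid_angles_minus by fastforce
qed

lemma L2_fun_lin: "L2_fun X f \<Longrightarrow> L2_fun X g \<Longrightarrow> L2_fun X (\<lambda>x. a * f x + b * g x)"
proof -
  assume f: "L2_fun X f" and g: "L2_fun X g"
  then have [measurable]: "f \<in> borel_measurable X" "g \<in> borel_measurable X" by (auto simp: L2_fun_def)
  have "(cmod (a * f x + b * g x))\<^sup>2 \<le> 2 * (cmod a)\<^sup>2 * (cmod (f x))\<^sup>2 + 2 * (cmod b)\<^sup>2 * (cmod (g x))\<^sup>2" for x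
  proof -
    have "(cmod (a * f x + b * g x))\<^sup>2 \<le> (cmod (a * f x) + cmod (b * g x))\<^sup>2"
      by (intro power_mono norm_triangle_ineq) simp
    also have "\<dots> \<le> 2 * (cmod (a * f x))\<^sup>2 + 2 * (cmod (b * g x))\<^sup>2"
      using sum_squares_bound[of "cmod (a * f x)" "cmod (b * g x)"] by (simp add: power2_sum)
    finally show ?thesis by (simp add: norm_mult power_mult_distrib)
  qed
  note le = this
  have dom: "integrable X (\<lambda>x. 2 * (cmod a)\<^sup>2 * (cmod (f x))\<^sup>2 + 2 * (cmod b)\<^sup>2 * (cmod (g x))\<^sup>2)"
    using f g by (simp add: L2_fun_def)
  have "integrable X (\<lambda>x. (cmod (a * f x + b * g x))\<^sup>2)"
  proof (rule Bochner_Integration.integrable_bound[OF dom])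
    show "AE x in X. norm ((cmod (a * f x + b * g x))\<^sup>2)
        \<le> norm (2 * (cmod a)\<^sup>2 * (cmod (f x))\<^sup>2 + 2 * (cmod b)\<^sup>2 * (cmod (g x))\<^sup>2)"
      by (rule AE_I2, unfold real_norm_def, rule order_trans[OF _ abs_ge_self]) (simp add: le)
  qed simp
  then show ?thesis by (simp add: L2_fun_def)
qed

lemma L2_fun_sum: "(\<And>i. i < n \<Longrightarrow> L2_fun X (g i)) \<Longrightarrow> L2_fun X (\<lambda>x. \<Sum>i<(n::nat). a i * g i x)"
proof (induction n)
  case 0
  then show ?case by (simp add: L2_fun_def)
next
  case (Suc n)
  then show ?case using L2_fun_lin[of "\<lambda>x. \<Sum>i<n. a i * g i x" "g n" 1 "a n"] by simp
qed

text \<open>Linear combinations of eigenfunctions are invariant under \<open>S ^^ q\<close>, and they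
approximate the indicator function of \<open>A\<close> in \<open>L\<^sup>2\<close>.\<close>

lemma torsion_imp_periodic:
  assumes ds: "discrete_spectrum S X"
    and tors: "\<And>f c. L2_fun X f \<Longrightarrow> \<not> (AE x in X. f x = 0) \<Longrightarrow> AE x in X. f (S x) = c * f x \<Longrightarrow> c ^ q = 1"
    and A [measurable]: "A \<in> sets X"
  shows "AE x in X. (S ^^ q) x \<in> A \<longleftrightarrow> x \<in> A"
proof -
  let ?R = "S ^^ q"
  have R [measurable]: "?R \<in> measurable X X" using iter_meas[of "int q"] by (simp add: iterate_def)
  have distrR: "distr X X ?R = X" using iter_distr[of "int q"] by (simp add: iterate_def)
  let ?f = "indicator A :: 'a \<Rightarrow> complex"
  have ind: "(cmod (?f x))\<^sup>2 = indicator A x" for x by (simp add: indicator_def)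
  have fL2: "L2_fun X ?f" unfolding L2_fun_def ind by (simp add: less_top[symmetric])
  have "measure X {x \<in> space X. (?R x \<in> A) \<noteq> (x \<in> A)} \<le> 4 * (e * e)" if "e > 0" for e
  proof -
    obtain n :: nat and a g where g: "\<And>i. i < n \<Longrightarrow> eigenfunction S X (g i)"
      and close: "L2_dist X ?f (\<lambda>x. \<Sum>i<n. a i * g i x) < e"
      using ds fL2 \<open>e > 0\<close> unfolding discrete_spectrum_def by blast
    define F where "F x = (\<Sum>i<n. a i * g i x)" for x
    have FL2: "L2_fun X F"
      unfolding F_def using g by (intro L2_fun_sum) (auto simp: eigenfunction_def)
    then have [measurable]: "F \<in> borel_measurable X" by (simp add: L2_fun_def)
    have "AE x in X. \<forall>i\<in>{..<n}. g i (?R x) = g i x"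
    proof (subst AE_ball_countable, simp, intro ballI)
      fix i assume "i \<in> {..<n}"
      then obtain c where c: "L2_fun X (g i)" "\<not> (AE x in X. g i x = 0)" "AE x in X. g i (S x) = c * g i x"
        using g by (auto simp: eigenfunction_def)
      have "c \<noteq> 0" using eigenvalue_norm[OF c] by auto
      from eigenfunction_iter[OF c(3) this, of "int q"] tors[OF c]
      show "AE x in X. g i (?R x) = g i x" by (simp add: iterate_def)
    qed
    then have Finv: "AE x in X. F (?R x) = F x" by eventually_elim (simp add: F_def)
    have "L2_fun X (\<lambda>x. 1 * ?f x + - 1 * F x)" by (rule L2_fun_lin[OF fL2 FL2])
    then have int: "integrable X (\<lambda>x. (cmod (?f x - F x))\<^sup>2)" by (simp add: L2_fun_def)
    let ?I = "\<integral>x. (cmod (?f x - F x))\<^sup>2 \<partial>X"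
    have "sqrt ?I < e" using close by (simp add: L2_dist_def F_def)
    then have I: "?I < e * e"
      by (metis \<open>e > 0\<close> less_eq_real_def power2_eq_square real_sqrt_less_iff real_sqrt_unique)
    have intR: "integrable X (\<lambda>x. (cmod (?f (?R x) - F (?R x)))\<^sup>2)"
      using int integrable_distr_eq[of ?R X X "\<lambda>x. (cmod (?f x - F x))\<^sup>2"] by (simp add: distrR)
    have IR: "(\<integral>x. (cmod (?f (?R x) - F (?R x)))\<^sup>2 \<partial>X) = ?I"
      using integral_distr[of ?R X X "\<lambda>x. (cmod (?f x - F x))\<^sup>2"] by (simp add: distrR)
    have bound: "AE x in X. indicator {x \<in> space X. (?R x \<in> A) \<noteq> (x \<in> A)} x \<le>
        2 * (cmod (?f (?R x) - F (?R x)))\<^sup>2 + 2 * (cmod (?f x - F x))\<^sup>2"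
      using Finv
    proof eventually_elim
      case (elim x)
      have "indicator {x \<in> space X. (?R x \<in> A) \<noteq> (x \<in> A)} x \<le> (cmod (?f (?R x) - ?f x))\<^sup>2"
        by (auto simp: indicator_def)
      also have "cmod (?f (?R x) - ?f x) \<le> cmod (?f (?R x) - F (?R x)) + cmod (?f x - F x)"
        using norm_triangle_ineq4[of "?f (?R x) - F (?R x)" "?f x - F x"] elim by simp
      then have "(cmod (?f (?R x) - ?f x))\<^sup>2 \<le> (cmod (?f (?R x) - F (?R x)) + cmod (?f x - F x))\<^sup>2"
        by (rule power_mono) simp
      also have "\<dots> \<le> 2 * (cmod (?f (?R x) - F (?R x)))\<^sup>2 + 2 * (cmod (?f x - F x))\<^sup>2"
        using sum_squares_bound[of "cmod (?f (?R x) - F (?R x))" "cmod (?f x - F x)"] by (simp add: power2_sum)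
      finally show ?case .
    qed
    have "measure X {x \<in> space X. (?R x \<in> A) \<noteq> (x \<in> A)} =
        (\<integral>x. indicator {x \<in> space X. (?R x \<in> A) \<noteq> (x \<in> A)} x \<partial>X)" by simp
    also have "\<dots> \<le> (\<integral>x. 2 * (cmod (?f (?R x) - F (?R x)))\<^sup>2 + 2 * (cmod (?f x - F x))\<^sup>2 \<partial>X)"
      using int intR bound by (intro integral_mono_AE) (auto simp: less_top[symmetric])
    also have "\<dots> = 4 * ?I" using int intR IR by simp
    also have "\<dots> \<le> 4 * (e * e)" using I by simp
    finally show ?thesis .
  qed
  note est = this
  have "measure X {x \<in> space X. (?R x \<in> A) \<noteq> (x \<in> A)} \<le> 0"
  proof (rule field_le_epsilon)
    fix e :: real assume "e > 0"
    then show "measure X {x \<in> space X. (?R x \<in> A) \<noteq> (x \<in> A)} \<le> 0 + e"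
      using est[of "sqrt (e / 4)"] by simp
  qed
  then have "measure X {x \<in> space X. (?R x \<in> A) \<noteq> (x \<in> A)} = 0" by (simp add: measure_le_0_iff)
  then have "{x \<in> space X. (?R x \<in> A) \<noteq> (x \<in> A)} \<in> null_sets X"
    by (auto simp: null_sets_def emeasure_eq_measure)
  then show ?thesis by (rule AE_I') auto
qed

lemma small_sets:
  assumes "no_atoms X"
  shows "\<exists>A\<in>sets X. 0 < measure X A \<and> measure X A \<le> (1 / 2) ^ n"
proof (induction n)
  case 0
  show ?case by (intro bexI[of _ "space X"]) (auto simp: prob_space)
next
  case (Suc n)
  then obtain A where A: "A \<in> sets X" "0 < measure X A" "measure X A \<le> (1 / 2) ^ n" by auto
  then obtain B where B: "B \<in> sets X" "B \<subseteq> A" "emeasure X B \<noteq> 0" "emeasure X B \<noteq> emeasure X A"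
    using assms unfolding no_atoms_def by (auto simp: emeasure_eq_measure)
  have d: "measure X (A - B) = measure X A - measure X B" using A B by (intro finite_measure_Diff) auto
  have pos: "0 < measure X B" "measure X B < measure X A"
    using B A finite_measure_mono[OF B(2) A(1)] by (auto simp: emeasure_eq_measure less_le)
  show ?case
  proof (cases "measure X B \<le> measure X A / 2")
    case True
    then show ?thesis using A B pos by (intro bexI[of _ B]) auto
  next
    case False
    then show ?thesis using A B pos d by (intro bexI[of _ "A - B"]) auto
  qed
qed

text \<open>The set of points that visit \<open>A\<close> infinitely often is strictly invariant. By
periodicity it agrees, up to a null set, with the union of the first \<open>q\<close> preimages
of \<open>A\<close>, so its measure is positive and, for small \<open>A\<close>, less than
\<open>1\<close>.\<close>

lemma not_all_torsion:
  assumes erg: "ergodic S X" and ds: "discrete_spectrum S X" and na: "no_atoms X" and q: "q > 0"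
    and tors: "\<And>f c. L2_fun X f \<Longrightarrow> \<not> (AE x in X. f x = 0) \<Longrightarrow> AE x in X. f (S x) = c * f x \<Longrightarrow> c ^ q = 1"
  shows False
proof -
  have "\<forall>\<^sub>F n in sequentially. (1 / 2 :: real) ^ n < 1 / real q"
    using q by (intro order_tendstoD(2)[OF LIMSEQ_realpow_zero]) auto
  then obtain n where n: "(1 / 2 :: real) ^ n < 1 / real q" by (auto simp: eventually_sequentially)
  obtain A where A [measurable]: "A \<in> sets X" and Apos: "0 < measure X A" and "measure X A \<le> (1 / 2) ^ n"
    using small_sets[OF na] by blast
  then have "measure X A < 1 / real q" using n by simp
  then have Asmall: "real q * measure X A < 1" using q by (simp add: field_simps)
  have Sk [measurable]: "S ^^ k \<in> measurable X X" for k using iter_meas[of "int k"] by (simp add: iterate_def)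
  have Sk_meas: "measure X ((S ^^ k) -` A \<inter> space X) = measure X A" for k
    using iter_distr[of "int k"] measure_distr[OF Sk[of k] A] by (simp add: iterate_def)
  define D where "D = {x \<in> space X. \<exists>\<^sub>\<infinity>k. (S ^^ k) x \<in> A}"
  have D [measurable]: "D \<in> sets X" unfolding D_def INFM_nat by measurable
  have "S -` D \<inter> space X = D"
  proof -
    have "(\<exists>\<^sub>\<infinity>k. (S ^^ k) (S x) \<in> A) \<longleftrightarrow> (\<exists>\<^sub>\<infinity>k. (S ^^ k) x \<in> A)" for x
    proof -
      have "(\<exists>\<^sub>\<infinity>k. (S ^^ Suc k) x \<in> A) \<longleftrightarrow> (\<exists>\<^sub>\<infinity>k. (S ^^ k) x \<in> A)"
        unfolding INFM_nat by (metis Suc_lessD Suc_lessE less_Suc_eq_0_disj not_less_eq Suc_less_eq)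
      then show ?thesis by (simp add: funpow_swap1)
    qed
    then show ?thesis by (auto simp: D_def S_space)
  qed
  then have D01: "measure X D = 0 \<or> measure X D = 1" using erg D by (simp add: ergodic_def)
  have per1: "AE x in X. (S ^^ q) x \<in> A \<longleftrightarrow> x \<in> A"
    by (rule torsion_imp_periodic[OF ds tors A])
  have "AE x in X. \<forall>k. (S ^^ q) ((S ^^ k) x) \<in> A \<longleftrightarrow> (S ^^ k) x \<in> A"
    unfolding AE_all_countable
  proof
    fix k
    show "AE x in X. (S ^^ q) ((S ^^ k) x) \<in> A \<longleftrightarrow> (S ^^ k) x \<in> A"
      using AE_iter[OF per1, of "int k"] by (simp add: iterate_def)
  qed
  then have per: "AE x in X. \<forall>k. (S ^^ (k + q)) x \<in> A \<longleftrightarrow> (S ^^ k) x \<in> A"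
    by (simp add: funpow_add add.commute[of _ q])
  have mult: "(S ^^ (k + q * j)) x \<in> A \<longleftrightarrow> (S ^^ k) x \<in> A"
    if "\<forall>k. (S ^^ (k + q)) x \<in> A \<longleftrightarrow> (S ^^ k) x \<in> A" for x k j
  proof (induction j)
    case (Suc j)
    have "k + q * Suc j = (k + q * j) + q" by simp
    then show ?case using that Suc by metis
  qed simp
  have "measure X A \<le> measure X D"
  proof (rule finite_measure_mono_AE)
    show "AE x in X. x \<in> A \<longrightarrow> x \<in> D"
      using per AE_space
    proof eventually_elim
      case (elim x)
      have "\<exists>k>i. (S ^^ k) x \<in> A" if "x \<in> A" for i
      proof (intro exI conjI)
        have "1 * Suc i \<le> q * Suc i" using q by (intro mult_le_mono1) simp
        then show "i < 0 + q * Suc i" by simp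
        show "(S ^^ (0 + q * Suc i)) x \<in> A" using mult[OF elim(1)] that by (metis funpow_0)
      qed
      then show ?case using elim by (auto simp: D_def INFM_nat)
    qed
  qed simp
  moreover have "measure X D \<le> real q * measure X A"
  proof -
    have "measure X D \<le> measure X (\<Union>i<q. (S ^^ i) -` A \<inter> space X)"
    proof (rule finite_measure_mono_AE)
      show "AE x in X. x \<in> D \<longrightarrow> x \<in> (\<Union>i<q. (S ^^ i) -` A \<inter> space X)"
        using per AE_space
      proof eventually_elim
        case (elim x)
        have "x \<in> (\<Union>i<q. (S ^^ i) -` A \<inter> space X)" if "x \<in> D"
        proof -
          have "\<exists>\<^sub>\<infinity>k. (S ^^ k) x \<in> A" using that by (simp add: D_def)
          then obtain k where "(S ^^ k) x \<in> A" by (auto dest: INFM_EX)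
          then have "(S ^^ (k mod q)) x \<in> A" using mult[OF elim(1), of "k mod q" "k div q"] by simp
          then show ?thesis using elim q by (auto intro!: bexI[of _ "k mod q"])
        qed
        then show ?case ..
      qed
    qed (auto intro!: sets.finite_UN measurable_sets[OF Sk A])
    also have "\<dots> \<le> (\<Sum>i<q. measure X ((S ^^ i) -` A \<inter> space X))"
      by (intro finite_measure_subadditive_finite) (auto intro!: measurable_sets[OF Sk A])
    also have "\<dots> = real q * measure X A" by (simp add: Sk_meas)
    finally show ?thesis .
  qed
  ultimately show False using D01 Apos Asmall by auto
qed

theorem small_rigid_angles:
  assumes "ergodic S X" "discrete_spectrum S X" "no_atoms X" "rigidity_sequence S X m"
  shows "\<forall>d>0. \<exists>t\<in>rigid_angles m. 0 < t \<and> t < d"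
proof (rule ccontr)
  assume "\<not> ?thesis"
  then show False
  proof (rule rigid_angles_small_or_torsion)
    fix q :: nat assume q: "q > 0" "\<And>t. t \<in> rigid_angles m \<Longrightarrow> cis t ^ q = 1"
    show False
    proof (rule not_all_torsion[OF assms(1,2,3) q(1)])
      fix f c assume f: "L2_fun X f" "\<not> (AE x in X. f x = 0)" and ev: "AE x in X. f (S x) = c * f x"
      have c: "c = cis (Arg c)" using eigenvalue_norm[OF f ev] rcis_cmod_Arg[of c] by (simp add: rcis_def)
      have "AE x in X. f (S x) = cis (Arg c) * f x" using ev unfolding c[symmetric] .
      then have "Arg c \<in> rigid_angles m" by (rule eigenvalue_rigid_angle[OF assms(4) f])
      then have "cis (Arg c) ^ q = 1" by (rule q(2))
      then show "c ^ q = 1" unfolding c[symmetric] .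
    qed
  qed
qed

end

section \<open>The Gaussian shift\<close>

text \<open>Both the invariance and the decorrelation of covariances need to be checked on generators only.\<close>

lemma span_bilinear_tendsto:
  fixes B :: "nat \<Rightarrow> ('x \<Rightarrow> real) \<Rightarrow> ('x \<Rightarrow> real) \<Rightarrow> real"
  assumes left: "\<And>i c Y Y' Z. Y \<in> lin_span G \<Longrightarrow> Y' \<in> lin_span G \<Longrightarrow> Z \<in> lin_span G \<Longrightarrow>
      B i (\<lambda>x. c * Y x + Y' x) Z = c * B i Y Z + B i Y' Z"
    and right: "\<And>i c Y Y' Z. Y \<in> lin_span G \<Longrightarrow> Y' \<in> lin_span G \<Longrightarrow> Z \<in> lin_span G \<Longrightarrow>
      B i Z (\<lambda>x. c * Y x + Y' x) = c * B i Z Y + B i Z Y'"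
    and null: "\<And>i Z. B i (\<lambda>_. 0) Z = 0" "\<And>i Z. B i Z (\<lambda>_. 0) = 0"
    and base: "\<And>g h. g \<in> G \<Longrightarrow> h \<in> G \<Longrightarrow> (\<lambda>i. B i g h) \<longlonglongrightarrow> 0"
    and Y: "Y \<in> lin_span G" and Z: "Z \<in> lin_span G"
  shows "(\<lambda>i. B i Y Z) \<longlonglongrightarrow> 0"
  using Y
proof (induction rule: lin_span.induct)
  case zero
  show ?case by (simp add: null)
next
  case (add f g c)
  have g: "g \<in> lin_span G" using add.hyps(2) by (rule lin_span_base)
  have "(\<lambda>i. B i g Z) \<longlonglongrightarrow> 0"
    using Z
  proof (induction rule: lin_span.induct)
    case zero
    show ?case by (simp add: null)
  next
    case (add f' h c')
    have "(\<lambda>i. c' * B i g h + B i g f') \<longlonglongrightarrow> c' * 0 + 0"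
      using base[OF \<open>g \<in> G\<close> add.hyps(2)] add.IH by (intro tendsto_intros)
    then show ?case using right[OF lin_span_base[OF add.hyps(2)] add.hyps(1) g] by simp
  qed
  then have "(\<lambda>i. c * B i g Z + B i f Z) \<longlonglongrightarrow> c * 0 + 0"
    using add.IH by (intro tendsto_intros)
  then show ?case using left[OF g add.hyps(1) Z] by simp
qed

definition shift :: "int \<Rightarrow> (int \<Rightarrow> real) \<Rightarrow> int \<Rightarrow> real" where
  "shift k x = (\<lambda>i. x (i + k))"

lemma shift_shift: "shift j (shift k x) = shift (j + k) x"
  by (simp add: shift_def add_ac)

lemma shift_0 [simp]: "shift 0 x = x" by (simp add: shift_def)

lemma funpow_shift: "shift k ^^ n = shift (int n * k)"
proof (induction n)
  case (Suc n)
  show ?case by (rule ext) (simp add: Suc shift_shift algebra_simps)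
qed (auto simp: fun_eq_iff)

lemma bij_shift: "bij (shift k)"
  by (rule bij_betw_byWitness[where f' = "shift (- k)"]) (auto simp: shift_shift)

lemma inv_shift: "inv (shift k) = shift (- k)"
  by (rule inv_unique_comp) (auto simp: fun_eq_iff shift_shift)

lemma iterate_shift: "space M = UNIV \<Longrightarrow> iterate M (shift 1) k = shift k"
  by (auto simp: iterate_def inv_shift funpow_shift)

lemma shift_image: "shift k ` A = shift (- k) -` A"
proof
  show "shift (- k) -` A \<subseteq> shift k ` A"
  proof
    fix x assume "x \<in> shift (- k) -` A"
    then show "x \<in> shift k ` A" by (intro image_eqI[of _ _ "shift (- k) x"]) (auto simp: shift_shift)
  qed
qed (auto simp: shift_shift)

lemma shift_measurable:
  assumes "sets M = sets (PiM UNIV (\<lambda>_. borel))"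
  shows "shift k \<in> measurable M M"
proof -
  have "shift k \<in> measurable (PiM UNIV (\<lambda>_. borel)) (PiM UNIV (\<lambda>_. borel))"
    unfolding shift_def by (rule measurable_PiM_single') auto
  then show ?thesis using assms by (simp cong: measurable_cong_sets)
qed

lemma standard_prob_space_PiM:
  fixes M :: "(int \<Rightarrow> real) measure"
  assumes "prob_space M" "sets M = sets (PiM UNIV (\<lambda>_. borel))"
  shows "standard_prob_space M"
proof -
  have sp: "space M = UNIV" using sets_eq_imp_space_eq[OF assms(2)] by (simp add: space_PiM)
  have "completely_metrizable_space (product_topology (\<lambda>_::int. euclidean :: real topology) UNIV)"
    by (simp add: completely_metrizable_space_product_topology completely_metrizable_space_euclidean)
  then have "completely_metrizable_space (euclidean :: (int \<Rightarrow> real) topology)"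
    by (simp only: euclidean_product_topology)
  moreover have "second_countable (euclidean :: (int \<Rightarrow> real) topology)"
  proof -
    obtain B :: "(int \<Rightarrow> real) set set" where B: "countable B" "topological_basis B"
      using ex_countable_basis by blast
    show ?thesis
      unfolding second_countable_def
    proof (intro exI conjI ballI allI impI)
      show "countable B" by (rule B)
      show "openin euclidean V" if "V \<in> B" for V using topological_basis_open[OF B(2) that] by simp
      fix U :: "(int \<Rightarrow> real) set" and x assume "openin euclidean U \<and> x \<in> U"
      then have "open U" "x \<in> U" by auto
      then show "\<exists>V\<in>B. x \<in> V \<and> V \<subseteq> U" by (rule topological_basisE[OF B(2)]) blast
    qed
  qed
  moreover have "sets M = sigma_sets (space M) {U. openin euclidean U}"
  proof -
    have "sets M = sets (borel :: (int \<Rightarrow> real) measure)"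
      unfolding assms(2) by (rule sets_PiM_equal_borel)
    then show ?thesis by (simp add: sp borel_def)
  qed
  ultimately show ?thesis
    unfolding standard_prob_space_def polish_topology_def using assms(1) sp
    by (intro exI[of _ M] exI[of _ euclidean]) auto
qed

text \<open>By the intermediate value theorem for the distribution function of \<open>Y\<close> on
\<open>A\<close>, a level of \<open>Y\<close> splits \<open>A\<close> into halves.\<close>

lemma (in prob_space) no_atoms_if_continuous_law:
  assumes Y [measurable]: "Y \<in> borel_measurable M" and pt: "\<And>t::real. measure M {x \<in> space M. Y x = t} = 0"
  shows "no_atoms M"
  unfolding no_atoms_def
proof (intro notI)
  assume "\<exists>A\<in>sets M. emeasure M A > 0 \<and>
          (\<forall>B\<in>sets M. B \<subseteq> A \<longrightarrow> emeasure M B = 0 \<or> emeasure M B = emeasure M A)"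
  then obtain A where A [measurable]: "A \<in> sets M" and pos: "emeasure M A > 0"
    and atom: "\<And>B. B \<in> sets M \<Longrightarrow> B \<subseteq> A \<Longrightarrow> emeasure M B = 0 \<or> emeasure M B = emeasure M A" by blast
  define N where "N = distr (density M (indicator A)) borel Y"
  have em: "emeasure N B = emeasure M (A \<inter> (Y -` B \<inter> space M))" if [measurable]: "B \<in> sets borel" for B
  proof -
    have "emeasure N B = emeasure (density M (indicator A)) (Y -` B \<inter> space M)"
      unfolding N_def by (subst emeasure_distr) auto
    also have "\<dots> = (\<integral>\<^sup>+x. indicator A x * indicator (Y -` B \<inter> space M) x \<partial>M)"
      by (subst emeasure_density) auto
    also have "\<dots> = (\<integral>\<^sup>+x. indicator (A \<inter> (Y -` B \<inter> space M)) x \<partial>M)"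
      by (intro nn_integral_cong) (auto simp: indicator_def)
    finally show ?thesis by simp
  qed
  have eN: "measure N B = measure M (A \<inter> (Y -` B \<inter> space M))" if "B \<in> sets borel" for B
    using em[OF that] by (simp add: measure_def)
  interpret N: finite_borel_measure N
  proof (intro finite_borel_measure.intro finite_borel_measure_axioms.intro finite_measureI)
    show "sets N = sets borel" by (simp add: N_def)
    have "space N = UNIV" by (simp add: N_def)
    then show "emeasure N (space N) \<noteq> \<infinity>" by (simp add: em emeasure_eq_measure)
  qed
  have cont: "isCont (cdf N) t" for t
  proof -
    have "measure N {t} \<le> measure M {x \<in> space M. Y x = t}"
      by (simp add: eN) (intro finite_measure_mono; auto)
    then show ?thesis using pt[of t] by (simp add: N.isCont_cdf measure_le_0_iff)
  qed
  let ?a = "measure M A"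
  have a: "0 < ?a" using pos by (simp add: emeasure_eq_measure)
  have "A \<inter> space M = A" using sets.sets_into_space[OF A] by auto
  then have top: "measure N (space N) = ?a" using eN[of UNIV] by (simp add: N_def)
  have "\<forall>\<^sub>F t in at_bot. cdf N t < ?a / 2" using N.cdf_lim_at_bot a by (intro order_tendstoD) auto
  then obtain t1 where t1: "cdf N t1 < ?a / 2" by (auto simp: eventually_at_bot_linorder)
  have "\<forall>\<^sub>F t in at_top. ?a / 2 < cdf N t" using N.cdf_lim_at_top a top by (intro order_tendstoD) auto
  then have "\<forall>\<^sub>F t in at_top. ?a / 2 < cdf N t \<and> t1 \<le> t"
    using eventually_ge_at_top[of t1] by (rule eventually_conj)
  then obtain t2 where t2: "?a / 2 < cdf N t2" "t1 \<le> t2" by (auto simp: eventually_at_top_linorder)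
  obtain t where "cdf N t = ?a / 2"
    using IVT[of "cdf N" t1 "?a / 2" t2] t1 t2 cont by auto
  then have "measure M (A \<inter> (Y -` {..t} \<inter> space M)) = ?a / 2" by (simp add: cdf_def eN)
  with atom[of "A \<inter> (Y -` {..t} \<inter> space M)"] a show False by (auto simp: emeasure_eq_measure)
qed

text \<open>Rigidity reduces to \<open>E (x (k - m l) - x k)\<^sup>2 = 2 - 2 * r (m l)\<close>. The
covariances along the times \<open>n i\<close> vanish in the limit for all lags, in both factors
of the product system, while forms on different factors are uncorrelated at all times.\<close>

theorem gaussian_shift_system:
  assumes small: "\<forall>d>0. \<exists>t\<in>rigid_angles m. 0 < t \<and> t < d"
  obtains M :: "(int \<Rightarrow> real) measure" where "dynamical_system (shift 1) M" "no_atoms M"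
    "weakly_mixing (shift 1) M" "rigidity_sequence (shift 1) M m"
proof -
  obtain th where th: "\<And>j. 0 < th j" "\<And>j. th j < 1" "\<And>j. th (Suc j) < th j / 3"
    and rig: "\<And>e. e > 0 \<Longrightarrow>
       \<forall>\<^sub>F l in sequentially. \<forall>J. (\<Sum>j<J. (1 - cos (of_int (m l) * th j)) / (real j + 2)) \<le> e"
    using choose_angles[OF small] by blast
  obtain n where n: "\<And>k::int. (\<lambda>i. riesz_cov th (real (n i) + of_int k)) \<longlonglongrightarrow> 0"
    using riesz_cov_mixing_times[of th] th by blast
  let ?R = "\<lambda>k l :: int. riesz_cov th (of_int k - of_int l)"
  let ?V = "lin_span coords :: ((int \<Rightarrow> real) \<Rightarrow> real) set"
  have "\<exists>M. gauss_space M ?V \<and> sets M = sets (PiM UNIV (\<lambda>_. borel)) \<and>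
      (\<forall>k l. (\<integral>x. x k * x l \<partial>M) = ?R k l)"
  proof (rule gaussian_process_exists[where R = ?R])
    show "psd_kernel (\<lambda>i j. ?R (int_decode i) (int_decode j))"
      by (rule psd_riesz_cov[of th "\<lambda>i. of_int (int_decode i)"])
  qed blast
  then obtain M :: "(int \<Rightarrow> real) measure" where gauss: "gauss_space M ?V"
    and sM: "sets M = sets (PiM UNIV (\<lambda>_. borel))"
    and cov: "\<And>k l. (\<integral>x. x k * x l \<partial>M) = ?R k l"
    by blast
  have spM: "space M = UNIV" using sets_eq_imp_space_eq[OF sM] by (simp add: space_PiM)
  interpret gaussian_system M ?V
  proof (intro gaussian_system.intro gaussian_system_axioms.intro)
    show "prob_space M" using gauss by (simp add: gauss_space_def)
    show "sets M \<subseteq> sigma_sets UNIV {{x. Y x > t} |Y t. Y \<in> ?V}"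
      using sM by (rule PiM_generated) (auto intro: lin_span_base)
  qed (fact gauss spM)+
  have sh [measurable]: "shift k \<in> measurable M M" for k using sM by (rule shift_measurable)
  have coordV: "(\<lambda>x. x k) \<in> ?V" for k by (rule lin_span_base) (simp add: coords_def)
  have shV: "(\<lambda>x. Y (shift k x)) \<in> ?V" if "Y \<in> ?V" for Y k
  proof (rule lin_span_compose[OF _ that])
    fix g :: "(int \<Rightarrow> real) \<Rightarrow> real" assume "g \<in> coords"
    then obtain j where "g = (\<lambda>x. x j)" by (auto simp: coords_def)
    then show "(\<lambda>x. g (shift k x)) \<in> ?V" using coordV by (simp add: shift_def)
  qed
  have prod_int: "integrable M (\<lambda>x. Y x * Z x)" if "Y \<in> ?V" "Z \<in> ?V" for Y Z
    using that by (intro mult_integrable V_sq V_meas)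
  \<comment> \<open>\<open>b = 1\<close> with constant shifts expresses invariance, \<open>b = 0\<close> expresses decorrelation\<close>
  have bilin: "(\<lambda>i. (\<integral>x. Y (shift (p i) x) * Z (shift (q i) x) \<partial>M) - b * (\<integral>x. Y x * Z x \<partial>M)) \<longlonglongrightarrow> 0"
    if Y: "Y \<in> ?V" and Z: "Z \<in> ?V"
      and base: "\<And>k l. (\<lambda>i. ?R (k + p i) (l + q i) - b * ?R k l) \<longlonglongrightarrow> 0" for Y Z p q b
  proof (rule span_bilinear_tendsto[where G = coords, OF _ _ _ _ _ Y Z])
    fix i c Y Y' Z assume V: "Y \<in> ?V" "Y' \<in> ?V" "Z \<in> ?V"
    note int = prod_int[OF shV[OF V(1)] shV[OF V(3)]] prod_int[OF shV[OF V(2)] shV[OF V(3)]]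
      prod_int[OF shV[OF V(3)] shV[OF V(1)]] prod_int[OF shV[OF V(3)] shV[OF V(2)]]
      prod_int[OF V(1) V(3)] prod_int[OF V(2) V(3)] prod_int[OF V(3) V(1)] prod_int[OF V(3) V(2)]
    show "(\<integral>x. (c * Y (shift (p i) x) + Y' (shift (p i) x)) * Z (shift (q i) x) \<partial>M) -
         b * (\<integral>x. (c * Y x + Y' x) * Z x \<partial>M) =
       c * ((\<integral>x. Y (shift (p i) x) * Z (shift (q i) x) \<partial>M) - b * (\<integral>x. Y x * Z x \<partial>M)) +
       ((\<integral>x. Y' (shift (p i) x) * Z (shift (q i) x) \<partial>M) - b * (\<integral>x. Y' x * Z x \<partial>M))"
      using int by (simp add: distrib_right mult.assoc) (simp add: algebra_simps)
    show "(\<integral>x. Z (shift (p i) x) * (c * Y (shift (q i) x) + Y' (shift (q i) x)) \<partial>M) -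
         b * (\<integral>x. Z x * (c * Y x + Y' x) \<partial>M) =
       c * ((\<integral>x. Z (shift (p i) x) * Y (shift (q i) x) \<partial>M) - b * (\<integral>x. Z x * Y x \<partial>M)) +
       ((\<integral>x. Z (shift (p i) x) * Y' (shift (q i) x) \<partial>M) - b * (\<integral>x. Z x * Y' x \<partial>M))"
      using int by (simp add: distrib_left mult.left_commute) (simp add: algebra_simps)
  next
    fix g h :: "(int \<Rightarrow> real) \<Rightarrow> real" assume "g \<in> coords" "h \<in> coords"
    then obtain k l where "g = (\<lambda>x. x k)" "h = (\<lambda>x. x l)" by (auto simp: coords_def)
    then show "(\<lambda>i. (\<integral>x. g (shift (p i) x) * h (shift (q i) x) \<partial>M) - b * (\<integral>x. g x * h x \<partial>M)) \<longlonglongrightarrow> 0"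
      using base[of k l] by (simp add: shift_def cov)
  qed simp_all
  have pres: "distr M M (shift k) = M" for k
  proof (rule covariance_preserving_imp_measure_preserving[OF sh shV])
    fix Y assume Y: "Y \<in> ?V"
    show "(\<integral>x. (Y (shift k x))\<^sup>2 \<partial>M) = (\<integral>x. (Y x)\<^sup>2 \<partial>M)"
      using bilin[OF Y Y, of "\<lambda>_. k" "\<lambda>_. k" 1] by (simp add: LIMSEQ_const_iff power2_eq_square)
  qed
  have inv: "inv_into (space M) (shift 1) = shift (- 1)" by (simp add: spM inv_shift)
  have dyn: "dynamical_system (shift 1) M"
    unfolding dynamical_system_def inv
  proof (intro conjI ballI)
    show "standard_prob_space M" using prob_space_axioms sM by (rule standard_prob_space_PiM)
    show "bij_betw (shift 1) (space M) (space M)" using bij_shift by (simp add: spM)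
    fix A assume "A \<in> sets M"
    then show "emeasure M (shift 1 -` A \<inter> space M) = emeasure M A"
      using emeasure_distr[OF sh[of 1], of A] by (simp add: pres)
  qed (rule sh)+
  have rigid: "rigidity_sequence (shift 1) M m"
    unfolding rigidity_sequence_def
  proof
    fix A assume A: "A \<in> sets M"
    have "(\<lambda>l. measure M (sym_diff (shift (- m l) -` A) A)) \<longlonglongrightarrow> 0"
    proof (rule L2_convergence_imp_rigid[OF sh pres shV _ A])
      fix Y assume "Y \<in> ?V"
      then show "(\<lambda>l. \<integral>x. (Y (shift (- m l) x) - Y x)\<^sup>2 \<partial>M) \<longlonglongrightarrow> 0"
      proof (induction rule: lin_span.induct)
        case (add f g c)
        then have V: "f \<in> ?V" "g \<in> ?V" by (auto intro: lin_span_base)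
        obtain k where g: "g = (\<lambda>x. x k)" using add.hyps(2) by (auto simp: coords_def)
        have int: "integrable M (\<lambda>x. (h (shift (- m l) x) - h x)\<^sup>2)" if "h \<in> ?V" for h l
          using V_sq[OF V_lin[OF shV[OF that] that, of 1 _ "- 1"]] by simp
        have "(\<lambda>l. \<integral>x. (g (shift (- m l) x) - g x)\<^sup>2 \<partial>M) = (\<lambda>l. 2 - 2 * riesz_cov th (of_int (m l)))"
        proof
          fix l
          have "(\<integral>x. (g (shift (- m l) x) - g x)\<^sup>2 \<partial>M) =
             (\<integral>x. x (k - m l) * x (k - m l) + x k * x k - 2 * (x (k - m l) * x k) \<partial>M)"
            by (simp add: g shift_def power2_eq_square algebra_simps)
          also have "\<dots> = 2 - 2 * riesz_cov th (of_int (m l))"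
            using prod_int[OF coordV coordV] by (simp add: cov riesz_cov_0 riesz_cov_minus)
          finally show "(\<integral>x. (g (shift (- m l) x) - g x)\<^sup>2 \<partial>M) = 2 - 2 * riesz_cov th (of_int (m l))" .
        qed
        moreover have "(\<lambda>l. 2 - 2 * riesz_cov th (of_int (m l))) \<longlonglongrightarrow> 2 - 2 * 1"
          by (intro tendsto_intros riesz_cov_tendsto_1 rig)
        ultimately have glim: "(\<lambda>l. \<integral>x. (g (shift (- m l) x) - g x)\<^sup>2 \<partial>M) \<longlonglongrightarrow> 0" by simp
        let ?B = "\<lambda>l. 2 * c\<^sup>2 * (\<integral>x. (g (shift (- m l) x) - g x)\<^sup>2 \<partial>M) + 2 * (\<integral>x. (f (shift (- m l) x) - f x)\<^sup>2 \<partial>M)"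
        have "?B \<longlonglongrightarrow> 2 * c\<^sup>2 * 0 + 2 * 0" by (intro tendsto_intros glim add.IH)
        then have B: "?B \<longlonglongrightarrow> 0" by simp
        show ?case
        proof (rule Lim_null_comparison[OF always_eventually B], rule allI)
          fix l
          let ?u = "\<lambda>x. g (shift (- m l) x) - g x" and ?v = "\<lambda>x. f (shift (- m l) x) - f x"
          let ?w = "\<lambda>x. c * g (shift (- m l) x) + f (shift (- m l) x) - (c * g x + f x)"
          have "(\<integral>x. (?w x)\<^sup>2 \<partial>M) \<le> (\<integral>x. 2 * c\<^sup>2 * (?u x)\<^sup>2 + 2 * (?v x)\<^sup>2 \<partial>M)"
          proof (rule integral_mono)
            show "integrable M (\<lambda>x. (?w x)\<^sup>2)" by (rule int) (rule lin_span.add[OF add.hyps])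
            show "integrable M (\<lambda>x. 2 * c\<^sup>2 * (?u x)\<^sup>2 + 2 * (?v x)\<^sup>2)"
              using int[OF V(1)] int[OF V(2)] by simp
            fix x
            have "(?w x)\<^sup>2 = (c * ?u x + ?v x)\<^sup>2" by (simp add: algebra_simps)
            also have "\<dots> \<le> 2 * (c * ?u x)\<^sup>2 + 2 * (?v x)\<^sup>2"
              using sum_squares_bound[of "c * ?u x" "?v x"] by (simp add: power2_sum)
            finally show "(?w x)\<^sup>2 \<le> 2 * c\<^sup>2 * (?u x)\<^sup>2 + 2 * (?v x)\<^sup>2" by (simp add: power_mult_distrib)
          qed
          also have "\<dots> = ?B l" using int[OF V(1)] int[OF V(2)] by simp
          finally show "norm (\<integral>x. (?w x)\<^sup>2 \<partial>M) \<le> ?B l" by simp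
        qed
      qed simp
    qed
    then show "(\<lambda>l. measure M (sym_diff (iterate M (shift 1) (m l) ` A) A)) \<longlonglongrightarrow> 0"
      by (simp add: iterate_shift[OF spM] shift_image)
  qed
  have mix: "weakly_mixing (shift 1) M"
    unfolding weakly_mixing_def ergodic_def
  proof (intro ballI impI)
    let ?T = "map_prod (shift 1) (shift 1) :: (int \<Rightarrow> real) \<times> (int \<Rightarrow> real) \<Rightarrow> _"
    interpret P: gaussian_system "M \<Otimes>\<^sub>M M" "pair_forms ?V" by (rule gaussian_system_pair)
    have T: "?T \<in> measurable (M \<Otimes>\<^sub>M M) (M \<Otimes>\<^sub>M M)" by (simp add: map_prod_def)
    have Tn: "(?T ^^ j) p = (shift (int j) (fst p), shift (int j) (snd p))" for j p
      by (induction j) (simp_all add: shift_shift)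
    have TV: "(\<lambda>p. Y (?T p)) \<in> pair_forms ?V" if YP: "Y \<in> pair_forms ?V" for Y
    proof -
      obtain Y1 Y2 where "Y = (\<lambda>p. Y1 (fst p) + Y2 (snd p))" "Y1 \<in> ?V" "Y2 \<in> ?V"
        using YP unfolding pair_forms_def by blast
      then show ?thesis using pair_formsI[OF shV[of Y1 1] shV[of Y2 1]] by simp
    qed
    have Tpres: "distr (M \<Otimes>\<^sub>M M) (M \<Otimes>\<^sub>M M) ?T = M \<Otimes>\<^sub>M M"
    proof -
      have "distr M M (shift 1) \<Otimes>\<^sub>M distr M M (shift 1) =
          distr (M \<Otimes>\<^sub>M M) (M \<Otimes>\<^sub>M M) (\<lambda>(x, y). (shift 1 x, shift 1 y))"
        by (rule pair_measure_distr) (simp_all add: pres sigma_finite_measure_axioms)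
      then show ?thesis by (simp add: pres map_prod_def)
    qed
    fix A assume A: "A \<in> sets (M \<Otimes>\<^sub>M M)" "?T -` A \<inter> space (M \<Otimes>\<^sub>M M) = A"
    show "measure (M \<Otimes>\<^sub>M M) A = 0 \<or> measure (M \<Otimes>\<^sub>M M) A = 1"
    proof (rule P.decorrelation_imp_ergodic[OF T Tpres TV _ A(1), of n])
      show "?T -` A = A" using A(2) by (simp add: P.space_K)
      fix Y Z assume "Y \<in> pair_forms ?V" "Z \<in> pair_forms ?V"
      then obtain Y1 Y2 Z1 Z2 where Y: "Y = (\<lambda>p. Y1 (fst p) + Y2 (snd p))" and Z: "Z = (\<lambda>p. Z1 (fst p) + Z2 (snd p))"
        and V: "Y1 \<in> ?V" "Y2 \<in> ?V" "Z1 \<in> ?V" "Z2 \<in> ?V" unfolding pair_forms_def by blast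
      have dec: "(\<lambda>i. \<integral>x. Y (shift (int (n i)) x) * Z x \<partial>M) \<longlonglongrightarrow> 0" if "Y \<in> ?V" "Z \<in> ?V" for Y Z
        using bilin[OF that, of "\<lambda>i. int (n i)" "\<lambda>_. 0" 0] n[of "k - l" for k l]
        by (simp add: algebra_simps)
      have "(\<integral>p. Y ((?T ^^ n i) p) * Z p \<partial>(M \<Otimes>\<^sub>M M)) =
        (\<integral>x. Y1 (shift (int (n i)) x) * Z1 x \<partial>M) + (\<integral>x. Y2 (shift (int (n i)) x) * Z2 x \<partial>M)" for i
      proof -
        define W1 where "W1 = (\<lambda>x. Y1 (shift (int (n i)) x))"
        define W2 where "W2 = (\<lambda>x. Y2 (shift (int (n i)) x))"
        have W: "W1 \<in> ?V" "W2 \<in> ?V" unfolding W1_def W2_def by (rule shV[OF V(1)], rule shV[OF V(2)])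
        note [measurable] = V_meas[OF W(1)] V_meas[OF W(2)] V_meas[OF V(3)] V_meas[OF V(4)]
        have f: "integrable (M \<Otimes>\<^sub>M M) (\<lambda>p. W1 (fst p) * Z1 (fst p))"
          "(\<integral>p. W1 (fst p) * Z1 (fst p) \<partial>(M \<Otimes>\<^sub>M M)) = (\<integral>x. W1 x * Z1 x \<partial>M)"
          using prod_int[OF W(1) V(3)] integral_distr[of fst "M \<Otimes>\<^sub>M M" M "\<lambda>x. W1 x * Z1 x"]
            integrable_distr_eq[of fst "M \<Otimes>\<^sub>M M" M "\<lambda>x. W1 x * Z1 x"] by (simp_all add: distr_pair_fst)
        have s: "integrable (M \<Otimes>\<^sub>M M) (\<lambda>p. W2 (snd p) * Z2 (snd p))"
          "(\<integral>p. W2 (snd p) * Z2 (snd p) \<partial>(M \<Otimes>\<^sub>M M)) = (\<integral>x. W2 x * Z2 x \<partial>M)"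
          using prod_int[OF W(2) V(4)] integral_distr[of snd "M \<Otimes>\<^sub>M M" M "\<lambda>x. W2 x * Z2 x"]
            integrable_distr_eq[of snd "M \<Otimes>\<^sub>M M" M "\<lambda>x. W2 x * Z2 x"] by (simp_all add: distr_pair_snd)
        have "(\<integral>p. Y ((?T ^^ n i) p) * Z p \<partial>(M \<Otimes>\<^sub>M M)) =
          (\<integral>p. W1 (fst p) * Z1 (fst p) + W2 (snd p) * Z2 (snd p) + W1 (fst p) * Z2 (snd p)
             + Z1 (fst p) * W2 (snd p) \<partial>(M \<Otimes>\<^sub>M M))"
          unfolding Tn by (intro Bochner_Integration.integral_cong)
            (simp_all add: Y Z W1_def W2_def algebra_simps)
        also have "\<dots> = (\<integral>x. W1 x * Z1 x \<partial>M) + (\<integral>x. W2 x * Z2 x \<partial>M)"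
          using f s cross_form[OF W(1) V(4)] cross_form[OF V(3) W(2)] by simp
        finally show ?thesis by (simp add: W1_def W2_def)
      qed
      moreover have "(\<lambda>i. (\<integral>x. Y1 (shift (int (n i)) x) * Z1 x \<partial>M) + (\<integral>x. Y2 (shift (int (n i)) x) * Z2 x \<partial>M)) \<longlonglongrightarrow> 0 + 0"
        by (intro tendsto_add dec V)
      ultimately show "(\<lambda>i. \<integral>p. Y ((?T ^^ n i) p) * Z p \<partial>(M \<Otimes>\<^sub>M M)) \<longlonglongrightarrow> 0" by simp
    qed
  qed
  have "no_atoms M"
  proof (rule no_atoms_if_continuous_law)
    show m0 [measurable]: "(\<lambda>x. x 0) \<in> borel_measurable M" using V_meas[OF coordV] .
    let ?D = "distr M borel (\<lambda>x. x 0)"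
    have "?D = std_normal_distribution"
    proof (rule Levy_uniqueness)
      show "real_distribution ?D" by (rule real_distribution_distr) simp
      show "real_distribution std_normal_distribution" by (rule real_dist_normal_dist)
      show "char ?D = char std_normal_distribution"
      proof
        fix s
        have sV: "(\<lambda>x. s * x 0 + 0 * x 0) \<in> ?V" by (rule V_lin[OF coordV coordV])
        have var: "(\<integral>x. (s * x 0)\<^sup>2 \<partial>M) = s\<^sup>2"
        proof -
          have "(\<lambda>x. (s * x 0)\<^sup>2) = (\<lambda>x :: int \<Rightarrow> real. s\<^sup>2 * (x 0 * x 0))"
            by (simp add: power2_eq_square mult_ac fun_eq_iff)
          then show ?thesis using cov[of 0 0] by (simp add: riesz_cov_0)
        qed
        have "integrable M (\<lambda>x. iexp (s * x 0))" by (rule integrable_iexp) auto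
        then have int: "integrable M (\<lambda>x. cis (s * x 0))" by (simp add: cis_conv_exp)
        have c: "char ?D s = (\<integral>x. cis (s * x 0) \<partial>M)"
          unfolding char_def by (subst integral_distr) (auto simp: cis_conv_exp)
        have "Re (char ?D s) = (\<integral>x. cos (s * x 0 + 0) \<partial>M)"
          unfolding c using integral_Re[OF int] by simp
        also have "\<dots> = exp (- s\<^sup>2 / 2)" using V_cos[OF sV, of 0] var by simp
        finally have re: "Re (char ?D s) = exp (- s\<^sup>2 / 2)" .
        \<comment> \<open>the sine is a cosine with phase \<open>- pi / 2\<close>, so it has mean \<open>0\<close>\<close>
        have "Im (char ?D s) = (\<integral>x. cos (s * x 0 + (- pi / 2)) \<partial>M)"
          unfolding c using integral_Im[OF int] by (simp add: cos_diff)
        also have "\<dots> = 0" using V_cos[OF sV, of "- pi / 2"] by simp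
        finally show "char ?D s = char std_normal_distribution s"
          using re by (simp add: char_std_normal_distribution complex_eq_iff)
      qed
    qed
    moreover have "measure std_normal_distribution {t} = 0" for t
    proof -
      have "emeasure std_normal_distribution {t} = 0"
        by (subst emeasure_density) (auto simp: nn_integral_0_iff_AE intro!: AE_I'[of "{t}"] split: split_indicator)
      then show ?thesis by (simp add: measure_def)
    qed
    ultimately have "measure ?D {t} = 0" for t by simp
    then show "measure M {x \<in> space M. x 0 = t} = 0" for t
      using measure_distr[of "\<lambda>x. x 0" M borel "{t}"] by (simp add: vimage_def Int_def conj_commute)
  qed
  with dyn mix rigid show thesis by (intro that)
qed

(* HOL cannot quantify existentially over types, so the carrier of the new system is taken
   inside the two-sided real sequences. This loses nothing: every Polish space is Borel
   isomorphic to a Borel set of such sequences, and space M may be any subset. *)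
theorem mainTheorem4:
  fixes S :: "'a \<Rightarrow> 'a" and X :: "'a measure" and m :: "nat \<Rightarrow> int"
  assumes "dynamical_system S X"
    and "ergodic S X"
    and "discrete_spectrum S X"
    and "no_atoms X"
    and "rigidity_sequence S X m"
  shows "\<exists>(T :: (int \<Rightarrow> real) \<Rightarrow> (int \<Rightarrow> real)) (M :: (int \<Rightarrow> real) measure).
           dynamical_system T M \<and> no_atoms M \<and> weakly_mixing T M \<and> rigidity_sequence T M m"
proof -
  interpret dyn S X
    using assms(1) standard_prob_space_imp_prob_space
    by (intro dyn.intro dyn_axioms.intro) (auto simp: dynamical_system_def)
  from gaussian_shift_system[OF small_rigid_angles[OF assms(2-5)]] show ?thesis by metis
qed

end
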